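(* For every integer $n>0$ there exists a unitary operator $U$ on a separable complex Hilbert space such that the tensor product $$U\otimes U^2\otimes U^4\otimes\dots\otimes U^{2^n}$$ (the tensor product of the operators $U^{2^k}$, $k=0,1,\dots,n$) is unitarily equivalent to the unitary operator with simple Lebesgue spectrum.
   Context: Two unitary operators $V$ on $H$ and $W$ on $K$ are called isomorphic (unitarily equivalent) if there is a unitary map $\Phi:H\to K$ with $\Phi V=W\Phi$. The unitary operator with simple Lebesgue spectrum is the operator of multiplication by the variable $z$ on $L_2(\mathbf{T},\lambda)$, where $\mathbf{T}=\{z\in\mathbf{C}:|z|=1\}$ and $\lambda$ is Lebesgue measure on $\mathbf{T}$; equivalently, it is the standard bilateral shift in $\ell_2(\mathbf{Z})$. For a unitary operator $U$ on $H$, the product $U\otimes U^2\otimes\dots\otimes U^{2^n}$ acts on the Hilbert space tensor product $H^{\otimes(n+1)}$. *)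

theory Defs
  imports "HOL-Analysis.Analysis" "HOL-Algebra.Module"
begin

section \<open>Complex Hilbert spaces with an explicit carrier\<close>

definition complex_ring :: "complex ring" where
  "complex_ring = \<lparr>carrier = UNIV, mult = (*), one = 1, zero = 0, add = (+)\<rparr>"

text \<open>Carriers are explicit sets, because the tensor powers of a space and the
  quotients by null functions do not live on one fixed type.  The fields \<open>mult\<close> and \<open>one\<close>,
  which modules inherit from the ring record, carry no information.\<close>

record 'a inner_module = "(complex, 'a) module" +
  cinner :: "'a \<Rightarrow> 'a \<Rightarrow> complex"

definition cnorm :: "('a, 'm) inner_module_scheme \<Rightarrow> 'a \<Rightarrow> real" where
  "cnorm H x = sqrt (Re (cinner H x x))"

definition cdist :: "('a, 'm) inner_module_scheme \<Rightarrow> 'a \<Rightarrow> 'a \<Rightarrow> real" where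
  "cdist H x y = cnorm H (x \<ominus>\<^bsub>H\<^esub> y)"

text \<open>The inner product is linear in its first argument.\<close>

locale complex_inner_space = Module.module complex_ring H for H (structure) +
  assumes cinner_add_left: "\<lbrakk>x \<in> carrier H; y \<in> carrier H; z \<in> carrier H\<rbrakk> \<Longrightarrow>
      cinner H (x \<oplus> y) z = cinner H x z + cinner H y z"
    and cinner_smult_left: "\<lbrakk>x \<in> carrier H; y \<in> carrier H\<rbrakk> \<Longrightarrow>
      cinner H (a \<odot>\<^bsub>H\<^esub> x) y = a * cinner H x y"
    and cinner_commute: "\<lbrakk>x \<in> carrier H; y \<in> carrier H\<rbrakk> \<Longrightarrow>
      cinner H x y = cnj (cinner H y x)"
    and cinner_pos: "\<lbrakk>x \<in> carrier H; x \<noteq> \<zero>\<rbrakk> \<Longrightarrow> 0 < Re (cinner H x x)"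

definition cauchy_in :: "('a, 'm) inner_module_scheme \<Rightarrow> (nat \<Rightarrow> 'a) \<Rightarrow> bool" where
  "cauchy_in H s \<longleftrightarrow> range s \<subseteq> carrier H \<and>
     (\<forall>e>0. \<exists>N. \<forall>m\<ge>N. \<forall>n\<ge>N. cdist H (s m) (s n) < e)"

locale hilbert_space = complex_inner_space +
  assumes complete:
    "cauchy_in H s \<Longrightarrow> \<exists>l\<in>carrier H. (\<lambda>n. cdist H (s n) l) \<longlonglongrightarrow> 0"

definition separable :: "('a, 'm) inner_module_scheme \<Rightarrow> bool" where
  "separable H \<longleftrightarrow> (\<exists>D. countable D \<and> D \<subseteq> carrier H \<and>
     (\<forall>x\<in>carrier H. \<forall>e>0. \<exists>d\<in>D. cdist H x d < e))"


section \<open>Operators\<close>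

definition linear_map ::
  "('a, 'm) inner_module_scheme \<Rightarrow> ('b, 'k) inner_module_scheme \<Rightarrow> ('a \<Rightarrow> 'b) \<Rightarrow> bool" where
  "linear_map H K A \<longleftrightarrow> A \<in> carrier H \<rightarrow> carrier K \<and>
     (\<forall>x\<in>carrier H. \<forall>y\<in>carrier H. A (x \<oplus>\<^bsub>H\<^esub> y) = A x \<oplus>\<^bsub>K\<^esub> A y) \<and>
     (\<forall>a. \<forall>x\<in>carrier H. A (a \<odot>\<^bsub>H\<^esub> x) = a \<odot>\<^bsub>K\<^esub> A x)"

definition bounded_linear_map ::
  "('a, 'm) inner_module_scheme \<Rightarrow> ('b, 'k) inner_module_scheme \<Rightarrow> ('a \<Rightarrow> 'b) \<Rightarrow> bool" where
  "bounded_linear_map H K A \<longleftrightarrow> linear_map H K A \<and>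
     (\<exists>C. \<forall>x\<in>carrier H. cnorm K (A x) \<le> C * cnorm H x)"

definition unitary_map ::
  "('a, 'm) inner_module_scheme \<Rightarrow> ('b, 'k) inner_module_scheme \<Rightarrow> ('a \<Rightarrow> 'b) \<Rightarrow> bool" where
  "unitary_map H K A \<longleftrightarrow> linear_map H K A \<and> bij_betw A (carrier H) (carrier K) \<and>
     (\<forall>x\<in>carrier H. \<forall>y\<in>carrier H. cinner K (A x) (A y) = cinner H x y)"

abbreviation unitary_operator :: "('a, 'm) inner_module_scheme \<Rightarrow> ('a \<Rightarrow> 'a) \<Rightarrow> bool" where
  "unitary_operator H U \<equiv> unitary_map H H U"

definition unitarily_equivalent ::
  "('a, 'm) inner_module_scheme \<Rightarrow> ('a \<Rightarrow> 'a) \<Rightarrow> ('b, 'k) inner_module_scheme \<Rightarrow> ('b \<Rightarrow> 'b) \<Rightarrow> bool"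
  where
  "unitarily_equivalent H V K W \<longleftrightarrow>
     (\<exists>\<Phi>. unitary_map H K \<Phi> \<and> (\<forall>x\<in>carrier H. \<Phi> (V x) = W (\<Phi> x)))"


section \<open>Completion of an inner product space\<close>

text \<open>Cauchy sequences modulo null sequences.  All operations are computed on arbitrary
  representatives.\<close>

definition completion_rel :: "('a, 'm) inner_module_scheme \<Rightarrow> ((nat \<Rightarrow> 'a) \<times> (nat \<Rightarrow> 'a)) set" where
  "completion_rel P =
     {(s, t). cauchy_in P s \<and> cauchy_in P t \<and> (\<lambda>n. cdist P (s n) (t n)) \<longlonglongrightarrow> 0}"

definition completion :: "('a, 'm) inner_module_scheme \<Rightarrow> (nat \<Rightarrow> 'a) set inner_module" where
  "completion P = \<lparr>
     carrier = {s. cauchy_in P s} // completion_rel P,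
     mult = undefined, one = undefined,
     zero = completion_rel P `` {\<lambda>n. \<zero>\<^bsub>P\<^esub>},
     add = (\<lambda>X Y. \<Union>s\<in>X. \<Union>t\<in>Y. completion_rel P `` {\<lambda>n. s n \<oplus>\<^bsub>P\<^esub> t n}),
     smult = (\<lambda>a X. \<Union>s\<in>X. completion_rel P `` {\<lambda>n. a \<odot>\<^bsub>P\<^esub> s n}),
     cinner = (\<lambda>X Y. the_elem (\<Union>s\<in>X. \<Union>t\<in>Y. {lim (\<lambda>n. cinner P (s n) (t n))}))\<rparr>"

definition completion_embed :: "('a, 'm) inner_module_scheme \<Rightarrow> 'a \<Rightarrow> (nat \<Rightarrow> 'a) set" where
  "completion_embed P x = completion_rel P `` {\<lambda>n. x}"


section \<open>Hilbert space tensor products\<close>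

text \<open>The construction for a finite family, as in Reed and Simon (vol. I, Section II.4):
  \<open>\<Otimes>\<^sub>i x\<^sub>i\<close> is the conjugate-multilinear form \<open>y \<mapsto> \<Prod>\<^sub>i \<langle>x\<^sub>i, y\<^sub>i\<rangle>\<close>; the algebraic tensor product
  is the linear span of these forms, with the inner product determined by
  \<open>\<langle>\<Otimes>\<^sub>i x\<^sub>i, \<Otimes>\<^sub>i y\<^sub>i\<rangle> = \<Prod>\<^sub>i \<langle>x\<^sub>i, y\<^sub>i\<rangle>\<close>; the tensor product is its completion.\<close>

abbreviation tuples :: "'i set \<Rightarrow> ('i \<Rightarrow> ('a, 'm) inner_module_scheme) \<Rightarrow> ('i \<Rightarrow> 'a) set" where
  "tuples I H \<equiv> (\<Pi>\<^sub>E i\<in>I. carrier (H i))"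

definition simple_form ::
  "'i set \<Rightarrow> ('i \<Rightarrow> ('a, 'm) inner_module_scheme) \<Rightarrow> ('i \<Rightarrow> 'a) \<Rightarrow> ('i \<Rightarrow> 'a) \<Rightarrow> complex" where
  "simple_form I H x = (\<lambda>y\<in>tuples I H. \<Prod>i\<in>I. cinner (H i) (x i) (y i))"

definition form_comb ::
  "'i set \<Rightarrow> ('i \<Rightarrow> ('a, 'm) inner_module_scheme) \<Rightarrow> ('i \<Rightarrow> 'a) set \<Rightarrow> (('i \<Rightarrow> 'a) \<Rightarrow> complex)
     \<Rightarrow> ('i \<Rightarrow> 'a) \<Rightarrow> complex" where
  "form_comb I H S a = (\<lambda>y\<in>tuples I H. \<Sum>x\<in>S. a x * simple_form I H x y)"

definition algebraic_tensor ::
  "'i set \<Rightarrow> ('i \<Rightarrow> ('a, 'm) inner_module_scheme) \<Rightarrow> (('i \<Rightarrow> 'a) \<Rightarrow> complex) inner_module" where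
  "algebraic_tensor I H = \<lparr>
     carrier = {form_comb I H S a | S a. finite S \<and> S \<subseteq> tuples I H},
     mult = undefined, one = undefined,
     zero = (\<lambda>y\<in>tuples I H. 0),
     add = (\<lambda>F G. \<lambda>y\<in>tuples I H. F y + G y),
     smult = (\<lambda>c F. \<lambda>y\<in>tuples I H. c * F y),
     cinner = (\<lambda>F G. THE c. \<exists>S a R b.
       finite S \<and> S \<subseteq> tuples I H \<and> F = form_comb I H S a \<and>
       finite R \<and> R \<subseteq> tuples I H \<and> G = form_comb I H R b \<and>
       c = (\<Sum>x\<in>S. \<Sum>y\<in>R. a x * cnj (b y) * (\<Prod>i\<in>I. cinner (H i) (x i) (y i))))\<rparr>"

definition hilbert_tensor ::
  "'i set \<Rightarrow> ('i \<Rightarrow> ('a, 'm) inner_module_scheme) \<Rightarrow> (nat \<Rightarrow> ('i \<Rightarrow> 'a) \<Rightarrow> complex) set inner_module"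
  where
  "hilbert_tensor I H = completion (algebraic_tensor I H)"

definition simple_tensor ::
  "'i set \<Rightarrow> ('i \<Rightarrow> ('a, 'm) inner_module_scheme) \<Rightarrow> ('i \<Rightarrow> 'a)
     \<Rightarrow> (nat \<Rightarrow> ('i \<Rightarrow> 'a) \<Rightarrow> complex) set" where
  "simple_tensor I H x = completion_embed (algebraic_tensor I H) (simple_form I H x)"

text \<open>Extensionality only pins down the values outside the carrier.\<close>

definition tensor_operator ::
  "'i set \<Rightarrow> ('i \<Rightarrow> ('a, 'm) inner_module_scheme) \<Rightarrow> ('i \<Rightarrow> 'a \<Rightarrow> 'a)
     \<Rightarrow> (nat \<Rightarrow> ('i \<Rightarrow> 'a) \<Rightarrow> complex) set \<Rightarrow> (nat \<Rightarrow> ('i \<Rightarrow> 'a) \<Rightarrow> complex) set" where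
  "tensor_operator I H A = (THE W.
     W \<in> extensional (carrier (hilbert_tensor I H)) \<and>
     bounded_linear_map (hilbert_tensor I H) (hilbert_tensor I H) W \<and>
     (\<forall>x\<in>tuples I H. W (simple_tensor I H x) = simple_tensor I H (\<lambda>i\<in>I. A i (x i))))"


section \<open>The space \<open>L\<^sub>2\<close> and the operator with simple Lebesgue spectrum\<close>

definition square_integrable :: "'b measure \<Rightarrow> ('b \<Rightarrow> complex) set" where
  "square_integrable M = {f \<in> borel_measurable M. integrable M (\<lambda>x. (cmod (f x))\<^sup>2)}"

definition L2_rel :: "'b measure \<Rightarrow> (('b \<Rightarrow> complex) \<times> ('b \<Rightarrow> complex)) set" where
  "L2_rel M = {(f, g). f \<in> square_integrable M \<and> g \<in> square_integrable M \<and> (AE x in M. f x = g x)}"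

definition L2 :: "'b measure \<Rightarrow> ('b \<Rightarrow> complex) set inner_module" where
  "L2 M = \<lparr>
     carrier = square_integrable M // L2_rel M,
     mult = undefined, one = undefined,
     zero = L2_rel M `` {\<lambda>x. 0},
     add = (\<lambda>X Y. \<Union>f\<in>X. \<Union>g\<in>Y. L2_rel M `` {\<lambda>x. f x + g x}),
     smult = (\<lambda>a X. \<Union>f\<in>X. L2_rel M `` {\<lambda>x. a * f x}),
     cinner = (\<lambda>X Y. the_elem (\<Union>f\<in>X. \<Union>g\<in>Y. {\<integral>x. f x * cnj (g x) \<partial>M}))\<rparr>"

text \<open>Lebesgue measure on the unit circle, normalised to total mass 1.\<close>

definition circle_measure :: "complex measure" where
  "circle_measure =
     distr (restrict_space lborel {0..<1}) (restrict_space borel (sphere 0 1)) (\<lambda>t. cis (2 * pi * t))"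

definition mult_by_z :: "(complex \<Rightarrow> complex) set \<Rightarrow> (complex \<Rightarrow> complex) set" where
  "mult_by_z X = (\<Union>f\<in>X. L2_rel circle_measure `` {\<lambda>z. z * f z})"

end

theory Submission
  imports Defs "HOL-Probability.Probability"
begin

text \<open>Let \<open>\<mu>\<close> be the law of \<open>Z = exp (2 \<pi> i X)\<close>, where the binary digits of \<open>X\<close> are independent fair
  bits at the positions divisible by \<open>n + 1\<close> and vanish elsewhere, and let \<open>U\<close> be multiplication
  by the variable on \<open>L\<^sub>2(\<mu>)\<close>.  If \<open>X\<^sub>0, \<dots>, X\<^sub>n\<close> are independent copies of \<open>X\<close>, then
  the digits of \<open>2\<^sup>k X\<^sub>k\<close> occupy the positions congruent to \<open>- k\<close>, so \<open>\<Sum>\<^sub>k 2\<^sup>k X\<^sub>k\<close> is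
  uniform and determines all \<open>X\<^sub>k\<close>.  Conversely, splitting the digits of a uniform point
  of the circle gives independent copies \<open>Z\<^sub>k\<close> of \<open>Z\<close> on the circle itself with \<open>\<Prod>\<^sub>k Z\<^sub>k\<^bsup>2\<^sup>k\<^esup> = z\<close>.
  Hence \<open>\<Otimes>\<^sub>k f\<^sub>k \<mapsto> \<Prod>\<^sub>k f\<^sub>k(Z\<^sub>k)\<close> is isometric by independence, has dense range because
  the \<open>Z\<^sub>k\<close> generate the Borel sets of the circle, and turns \<open>\<Otimes>\<^sub>k U\<^bsup>2\<^sup>k\<^esup>\<close> into multiplication by \<open>z\<close>.\<close>

section \<open>Inner product spaces\<close>

text \<open>The digit positions come from a tiling: doubling an angle shifts its binary digits by
  one place, so the powers 2^k turn a set A of positions into A, A - 1, ..., A - n, and these have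
  to partition the positive integers; the multiples of n + 1 do so. Two obstacles shape the rest.
  The tensor product is a completion of a space of forms and \<open>tensor_operator\<close> is a
  definite description, so neither can be computed with directly. The abstract part therefore shows
  that every Hilbert space with a map \<open>\<tau>\<close> on tuples that has the prescribed inner
  products and a dense span is a model of the tensor product, and that a unitary operator acting
  correctly on the range of \<open>\<tau>\<close> corresponds to the tensor operator. The other
  obstacle is the ambiguity of binary expansions at dyadic points, which a passage to a product
  space would meet as an isomorphism modulo null sets. Reading digits from half-open arcs of the
  circle itself makes the product formula true at every point, so that only independence, equality
  of the laws and identities of classes involve the measure.\<close>

lemma complex_ring_simps [simp]:
  "carrier complex_ring = UNIV" "mult complex_ring = (*)" "one complex_ring = 1"
  "zero complex_ring = 0" "add complex_ring = (+)"
  by (simp_all add: complex_ring_def)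

lemma cring_complex_ring: "cring complex_ring"
proof (rule cringI)
  show "abelian_group complex_ring"
    by (rule abelian_groupI) (auto intro: exI[of _ "- x" for x] simp: algebra_simps ab_left_minus)
  show "Group.comm_monoid complex_ring"
    by (rule comm_monoidI) (auto simp: algebra_simps)
qed (auto simp: algebra_simps)

lemma complex_inner_spaceI:
  assumes "abelian_group H"
    and "\<And>a x. x \<in> carrier H \<Longrightarrow> a \<odot>\<^bsub>H\<^esub> x \<in> carrier H"
    and "\<And>a b x. x \<in> carrier H \<Longrightarrow> (a + b) \<odot>\<^bsub>H\<^esub> x = a \<odot>\<^bsub>H\<^esub> x \<oplus>\<^bsub>H\<^esub> b \<odot>\<^bsub>H\<^esub> x"
    and "\<And>a x y. x \<in> carrier H \<Longrightarrow> y \<in> carrier H \<Longrightarrow>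
        a \<odot>\<^bsub>H\<^esub> (x \<oplus>\<^bsub>H\<^esub> y) = a \<odot>\<^bsub>H\<^esub> x \<oplus>\<^bsub>H\<^esub> a \<odot>\<^bsub>H\<^esub> y"
    and "\<And>a b x. x \<in> carrier H \<Longrightarrow> (a * b) \<odot>\<^bsub>H\<^esub> x = a \<odot>\<^bsub>H\<^esub> (b \<odot>\<^bsub>H\<^esub> x)"
    and "\<And>x. x \<in> carrier H \<Longrightarrow> 1 \<odot>\<^bsub>H\<^esub> x = x"
    and "\<And>x y z. x \<in> carrier H \<Longrightarrow> y \<in> carrier H \<Longrightarrow> z \<in> carrier H \<Longrightarrow>
        cinner H (x \<oplus>\<^bsub>H\<^esub> y) z = cinner H x z + cinner H y z"
    and "\<And>a x y. x \<in> carrier H \<Longrightarrow> y \<in> carrier H \<Longrightarrow>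
        cinner H (a \<odot>\<^bsub>H\<^esub> x) y = a * cinner H x y"
    and "\<And>x y. x \<in> carrier H \<Longrightarrow> y \<in> carrier H \<Longrightarrow> cinner H x y = cnj (cinner H y x)"
    and "\<And>x. x \<in> carrier H \<Longrightarrow> x \<noteq> \<zero>\<^bsub>H\<^esub> \<Longrightarrow> 0 < Re (cinner H x x)"
  shows "complex_inner_space H"
proof -
  have "Module.module complex_ring H"
    by (rule moduleI) (simp_all add: cring_complex_ring assms)
  then show ?thesis
    unfolding complex_inner_space_def complex_inner_space_axioms_def using assms(7-10) by blast
qed

context complex_inner_space
begin

lemma smult_in [simp, intro]: "x \<in> carrier H \<Longrightarrow> a \<odot> x \<in> carrier H"
  by simp

lemma smult_add_left: "x \<in> carrier H \<Longrightarrow> (a + b) \<odot> x = a \<odot> x \<oplus> b \<odot> x"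
  using smult_l_distr[of a b x] by simp

lemma smult_add_right:
  "x \<in> carrier H \<Longrightarrow> y \<in> carrier H \<Longrightarrow> a \<odot> (x \<oplus> y) = a \<odot> x \<oplus> a \<odot> y"
  using smult_r_distr[of a x y] by simp

lemma smult_smult: "x \<in> carrier H \<Longrightarrow> a \<odot> (b \<odot> x) = (a * b) \<odot> x"
  using smult_assoc1[of a b x] by simp

lemma one_smult [simp]: "x \<in> carrier H \<Longrightarrow> 1 \<odot> x = x"
  using smult_one[of x] by simp

lemma zero_smult [simp]: "x \<in> carrier H \<Longrightarrow> 0 \<odot> x = \<zero>"
  using smult_l_null[of x] by simp

lemma smult_zero [simp]: "a \<odot> \<zero> = \<zero>"
  using smult_r_null[of a] by simp

lemma minus_eq_smult: "x \<in> carrier H \<Longrightarrow> \<ominus> x = (-1) \<odot> x"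
proof (rule M.minus_equality)
  assume x: "x \<in> carrier H"
  have "(-1) \<odot> x \<oplus> 1 \<odot> x = \<zero>"
    using smult_add_left[OF x, of "-1" 1] x by simp
  then show "(-1) \<odot> x \<oplus> x = \<zero>" using x by simp
qed auto

lemma diff_eq: "x \<in> carrier H \<Longrightarrow> y \<in> carrier H \<Longrightarrow> x \<ominus> y = x \<oplus> (-1) \<odot> y"
  by (simp add: M.minus_eq minus_eq_smult)

lemma diff_in [simp, intro]: "x \<in> carrier H \<Longrightarrow> y \<in> carrier H \<Longrightarrow> x \<ominus> y \<in> carrier H"
  by (rule M.minus_closed)

lemma cinner_add_right:
  "x \<in> carrier H \<Longrightarrow> y \<in> carrier H \<Longrightarrow> z \<in> carrier H \<Longrightarrow>
    cinner H x (y \<oplus> z) = cinner H x y + cinner H x z"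
  using cinner_commute[of x "y \<oplus> z"] cinner_commute[of x y] cinner_commute[of x z]
  by (simp add: cinner_add_left)

lemma cinner_smult_right:
  "x \<in> carrier H \<Longrightarrow> y \<in> carrier H \<Longrightarrow> cinner H x (a \<odot> y) = cnj a * cinner H x y"
  using cinner_commute[of x "a \<odot> y"] cinner_commute[of x y]
  by (simp add: cinner_smult_left)

lemma cinner_zero_left [simp]: "x \<in> carrier H \<Longrightarrow> cinner H \<zero> x = 0"
  using cinner_smult_left[of \<zero> x 0] by simp

lemma cinner_zero_right [simp]: "x \<in> carrier H \<Longrightarrow> cinner H x \<zero> = 0"
  using cinner_smult_right[of x \<zero> 0] by simp

lemma cinner_diff_left:
  "x \<in> carrier H \<Longrightarrow> y \<in> carrier H \<Longrightarrow> z \<in> carrier H \<Longrightarrow>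
    cinner H (x \<ominus> y) z = cinner H x z - cinner H y z"
  by (simp add: diff_eq cinner_add_left cinner_smult_left)

lemma cinner_diff_right:
  "x \<in> carrier H \<Longrightarrow> y \<in> carrier H \<Longrightarrow> z \<in> carrier H \<Longrightarrow>
    cinner H x (y \<ominus> z) = cinner H x y - cinner H x z"
  by (simp add: diff_eq cinner_add_right cinner_smult_right)

lemma cinner_self: "x \<in> carrier H \<Longrightarrow> cinner H x x = of_real ((cnorm H x)\<^sup>2)"
proof -
  assume x: "x \<in> carrier H"
  have "Re (cinner H x x) \<ge> 0"
    using cinner_pos[OF x] x by (cases "x = \<zero>") auto
  moreover have "Im (cinner H x x) = 0"
    using arg_cong[OF cinner_commute[OF x x], of Im] by simp
  ultimately show ?thesis by (simp add: complex_eq_iff cnorm_def)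
qed

lemma cnorm_nonneg [simp]: "x \<in> carrier H \<Longrightarrow> 0 \<le> cnorm H x"
  using cinner_pos[of x] by (cases "x = \<zero>") (auto simp: cnorm_def)

lemma cnorm_zero [simp]: "cnorm H \<zero> = 0"
  by (simp add: cnorm_def)

lemma cnorm_eq_0: "x \<in> carrier H \<Longrightarrow> cnorm H x = 0 \<longleftrightarrow> x = \<zero>"
  using cinner_pos[of x] by (cases "x = \<zero>") (auto simp: cnorm_def)

lemma cnorm_sq: "x \<in> carrier H \<Longrightarrow> (cnorm H x)\<^sup>2 = Re (cinner H x x)"
  by (simp add: cinner_self)

lemma cnorm_smult: "x \<in> carrier H \<Longrightarrow> cnorm H (a \<odot> x) = cmod a * cnorm H x"
proof -
  assume x: "x \<in> carrier H"
  have "cinner H (a \<odot> x) (a \<odot> x) = (a * cnj a) * cinner H x x"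
    using x by (simp add: cinner_smult_left cinner_smult_right)
  also have "\<dots> = of_real ((cmod a * cnorm H x)\<^sup>2)"
    using x complex_norm_square[of a] by (simp add: cinner_self power_mult_distrib)
  finally show ?thesis
    using x by (simp add: cnorm_def[of H "a \<odot> x"])
qed

lemma cauchy_schwarz:
  assumes x: "x \<in> carrier H" and y: "y \<in> carrier H"
  shows "cmod (cinner H x y) \<le> cnorm H x * cnorm H y"
proof (cases "y = \<zero>")
  case False
  define b where "b = cnorm H y"
  define c where "c = cinner H x y"
  have b: "b > 0"
    using cnorm_nonneg[OF y] cnorm_eq_0[OF y] False unfolding b_def by linarith
  \<comment> \<open>This is the component of \<open>x\<close> orthogonal to \<open>y\<close>. Its
    squared norm, which equals \<open>cinner H w x\<close> by orthogonality, is the defect in the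
    inequality.\<close>
  define w where "w = x \<ominus> (c / of_real (b\<^sup>2)) \<odot> y"
  have w: "w \<in> carrier H" unfolding w_def using x y by auto
  have yx: "cinner H y x = cnj c"
    unfolding c_def by (rule cinner_commute[OF y x])
  have wy: "cinner H w y = 0"
    unfolding w_def using x y b
    by (simp add: cinner_diff_left cinner_smult_left cinner_self b_def[symmetric] c_def[symmetric])
  have "cinner H w w = cinner H w x"
    using w x y wy by (subst (2) w_def) (simp add: cinner_diff_right cinner_smult_right)
  also have "\<dots> = of_real ((cnorm H x)\<^sup>2) - c * cnj c / of_real (b\<^sup>2)"
    unfolding w_def using x y
    by (simp add: cinner_diff_left cinner_smult_left cinner_self yx)
  also have "\<dots> = of_real ((cnorm H x)\<^sup>2 - (cmod c)\<^sup>2 / b\<^sup>2)"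
    by (simp add: complex_norm_square[symmetric])
  finally have "(cnorm H x)\<^sup>2 - (cmod c)\<^sup>2 / b\<^sup>2 = (cnorm H w)\<^sup>2"
    using w by (metis cinner_self of_real_eq_iff)
  then have "(cmod c)\<^sup>2 / b\<^sup>2 \<le> (cnorm H x)\<^sup>2"
    by (metis diff_ge_0_iff_ge zero_le_power2)
  then have "(cmod c)\<^sup>2 \<le> (cnorm H x * b)\<^sup>2"
    using b by (simp add: field_simps power_mult_distrib)
  then show ?thesis
    unfolding c_def[symmetric] b_def[symmetric]
    using b x by (meson cnorm_nonneg less_imp_le mult_nonneg_nonneg power2_le_imp_le)
qed (use x in simp)

lemma cnorm_triangle:
  assumes x: "x \<in> carrier H" and y: "y \<in> carrier H"
  shows "cnorm H (x \<oplus> y) \<le> cnorm H x + cnorm H y"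
proof -
  have "(cnorm H (x \<oplus> y))\<^sup>2 = (cnorm H x)\<^sup>2 + (cnorm H y)\<^sup>2 + Re (cinner H x y) + Re (cinner H y x)"
    using x y by (simp add: cnorm_sq cinner_add_left cinner_add_right)
  also have "\<dots> \<le> (cnorm H x)\<^sup>2 + (cnorm H y)\<^sup>2 + cnorm H x * cnorm H y + cnorm H y * cnorm H x"
    by (intro add_mono order_refl complex_Re_le_cmod[THEN order_trans] cauchy_schwarz x y)
  also have "\<dots> = (cnorm H x + cnorm H y)\<^sup>2"
    by (simp add: power2_eq_square algebra_simps)
  finally show ?thesis
    using x y by (meson cnorm_nonneg add_nonneg_nonneg power2_le_imp_le)
qed

section \<open>The metric of an inner product space: limits and Cauchy sequences\<close>

lemma cdist_nonneg [simp]: "x \<in> carrier H \<Longrightarrow> y \<in> carrier H \<Longrightarrow> 0 \<le> cdist H x y"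
  by (simp add: cdist_def)

lemma cdist_self [simp]: "x \<in> carrier H \<Longrightarrow> cdist H x x = 0"
  by (simp add: cdist_def M.r_neg M.minus_eq)

lemma diff_eq_zero: "x \<in> carrier H \<Longrightarrow> y \<in> carrier H \<Longrightarrow> x \<ominus> y = \<zero> \<longleftrightarrow> x = y"
  by (metis M.a_inv_closed M.minus_eq M.minus_equality M.minus_minus M.r_neg)

lemma cdist_eq_0: "x \<in> carrier H \<Longrightarrow> y \<in> carrier H \<Longrightarrow> cdist H x y = 0 \<longleftrightarrow> x = y"
  by (simp add: cdist_def cnorm_eq_0 diff_eq_zero)

lemma diff_comm: "x \<in> carrier H \<Longrightarrow> y \<in> carrier H \<Longrightarrow> y \<ominus> x = (-1) \<odot> (x \<ominus> y)"
  by (simp add: diff_eq smult_add_right smult_smult M.a_comm)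

lemma cdist_commute: "x \<in> carrier H \<Longrightarrow> y \<in> carrier H \<Longrightarrow> cdist H x y = cdist H y x"
  by (simp add: cdist_def diff_comm[of x y] cnorm_smult)

lemma cdist_triangle:
  assumes "x \<in> carrier H" "y \<in> carrier H" "z \<in> carrier H"
  shows "cdist H x z \<le> cdist H x y + cdist H y z"
proof -
  have "x \<ominus> z = (x \<ominus> y) \<oplus> (y \<ominus> z)"
    using assms by (simp add: M.minus_eq M.a_assoc M.r_neg1)
  then show ?thesis
    unfolding cdist_def using cnorm_triangle[of "x \<ominus> y" "y \<ominus> z"] assms by simp
qed

lemma cdist_add:
  assumes "x \<in> carrier H" "y \<in> carrier H" "x' \<in> carrier H" "y' \<in> carrier H"
  shows "cdist H (x \<oplus> y) (x' \<oplus> y') \<le> cdist H x x' + cdist H y y'"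
proof -
  have "(x \<oplus> y) \<ominus> (x' \<oplus> y') = (x \<ominus> x') \<oplus> (y \<ominus> y')"
    using assms by (simp add: diff_eq smult_add_right M.a_ac)
  then show ?thesis
    unfolding cdist_def using cnorm_triangle[of "x \<ominus> x'" "y \<ominus> y'"] assms by simp
qed

lemma cdist_smult:
  assumes "x \<in> carrier H" "y \<in> carrier H"
  shows "cdist H (a \<odot> x) (a \<odot> y) = cmod a * cdist H x y"
proof -
  have "(a \<odot> x) \<ominus> (a \<odot> y) = a \<odot> (x \<ominus> y)"
    using assms by (simp add: diff_eq smult_add_right smult_smult)
  then show ?thesis
    unfolding cdist_def using assms by (simp add: cnorm_smult)
qed

lemma cnorm_le_cdist:
  assumes "x \<in> carrier H" "y \<in> carrier H"
  shows "cnorm H x \<le> cnorm H y + cdist H x y"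
proof -
  have "x = y \<oplus> (x \<ominus> y)"
    using assms by (metis M.a_comm M.add.inv_solve_right' M.minus_eq diff_in)
  then show ?thesis
    using cnorm_triangle[of y "x \<ominus> y"] assms unfolding cdist_def by simp
qed

text \<open>Bounding the norm of \<open>y'\<close> by that of \<open>y\<close> plus a distance gives
  a right-hand side that tends to 0 with the two distances, with no separate boundedness argument
  for convergent sequences.\<close>

lemma cinner_cdist:
  assumes "x \<in> carrier H" "y \<in> carrier H" "x' \<in> carrier H" "y' \<in> carrier H"
  shows "cmod (cinner H x' y' - cinner H x y)
    \<le> cdist H x' x * (cnorm H y + cdist H y' y) + cnorm H x * cdist H y' y"
proof -
  have "cinner H x' y' - cinner H x y = cinner H (x' \<ominus> x) y' + cinner H x (y' \<ominus> y)"
    using assms by (simp add: cinner_diff_left cinner_diff_right)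
  also have "cmod \<dots> \<le> cmod (cinner H (x' \<ominus> x) y') + cmod (cinner H x (y' \<ominus> y))"
    by (rule norm_triangle_ineq)
  also have "\<dots> \<le> cdist H x' x * cnorm H y' + cnorm H x * cdist H y' y"
    unfolding cdist_def using assms by (intro add_mono cauchy_schwarz) auto
  also have "\<dots> \<le> cdist H x' x * (cnorm H y + cdist H y' y) + cnorm H x * cdist H y' y"
    using assms by (intro add_mono mult_left_mono cnorm_le_cdist) auto
  finally show ?thesis .
qed

lemma tendsto_cinner:
  assumes "range s \<subseteq> carrier H" "range t \<subseteq> carrier H" "x \<in> carrier H" "y \<in> carrier H"
    and s: "(\<lambda>n. cdist H (s n) x) \<longlonglongrightarrow> 0" and t: "(\<lambda>n. cdist H (t n) y) \<longlonglongrightarrow> 0"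
  shows "(\<lambda>n. cinner H (s n) (t n)) \<longlonglongrightarrow> cinner H x y"
proof -
  have "(\<lambda>n. cdist H (s n) x * (cnorm H y + cdist H (t n) y) + cnorm H x * cdist H (t n) y)
      \<longlonglongrightarrow> 0 * (cnorm H y + 0) + cnorm H x * 0"
    by (intro tendsto_intros s t)
  then have "(\<lambda>n. cdist H (s n) x * (cnorm H y + cdist H (t n) y) + cnorm H x * cdist H (t n) y)
      \<longlonglongrightarrow> 0" by simp
  then have "(\<lambda>n. cinner H (s n) (t n) - cinner H x y) \<longlonglongrightarrow> 0"
    by (rule Lim_null_comparison[rotated])
       (use assms in \<open>auto intro!: always_eventually cinner_cdist\<close>)
  then show ?thesis by (simp add: LIM_zero_iff)
qed

lemma limit_unique:
  assumes "range s \<subseteq> carrier H" "x \<in> carrier H" "y \<in> carrier H"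
    and "(\<lambda>n. cdist H (s n) x) \<longlonglongrightarrow> 0" "(\<lambda>n. cdist H (s n) y) \<longlonglongrightarrow> 0"
  shows "x = y"
proof -
  have le: "cdist H x y \<le> cdist H (s n) x + cdist H (s n) y" for n
    using cdist_triangle[of x "s n" y] cdist_commute[of x "s n"] assms(1-3) by auto
  have "(\<lambda>n. cdist H (s n) x + cdist H (s n) y) \<longlonglongrightarrow> 0 + 0"
    by (intro tendsto_intros assms)
  then have "cdist H x y \<le> 0 + 0"
    by (rule LIMSEQ_le_const) (use le in auto)
  then have "cdist H x y = 0" using cdist_nonneg[OF assms(2,3)] by linarith
  then show ?thesis using cdist_eq_0 assms by blast
qed

lemma convergent_imp_cauchy_in:
  assumes s: "range s \<subseteq> carrier H" and x: "x \<in> carrier H" and "(\<lambda>n. cdist H (s n) x) \<longlonglongrightarrow> 0"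
  shows "cauchy_in H s"
  unfolding cauchy_in_def
proof (intro conjI allI impI s)
  fix e :: real assume "e > 0"
  then obtain N where N: "\<And>n. n \<ge> N \<Longrightarrow> cdist H (s n) x < e / 2"
    using order_tendstoD(2)[OF assms(3), of "e / 2"] by (auto simp: eventually_sequentially)
  have "cdist H (s m) (s n) < e" if "m \<ge> N" "n \<ge> N" for m n
    using cdist_triangle[of "s m" x "s n"] cdist_commute[of x "s n"] N[OF that(1)] N[OF that(2)] s x
    by force
  then show "\<exists>N. \<forall>m\<ge>N. \<forall>n\<ge>N. cdist H (s m) (s n) < e" by blast
qed

lemma finsum_in [simp, intro]:
  "f \<in> S \<rightarrow> carrier H \<Longrightarrow> finsum H f S \<in> carrier H"
  by (rule M.finsum_closed)

lemma cinner_finsum_left: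
  assumes "f \<in> S \<rightarrow> carrier H" "y \<in> carrier H" "finite S"
  shows "cinner H (finsum H f S) y = (\<Sum>x\<in>S. cinner H (f x) y)"
  using assms(3,1)
proof induction
  case (insert a S)
  then have "finsum H f S \<in> carrier H" "f a \<in> carrier H" by auto
  then show ?case
    using insert assms(2) by (simp add: cinner_add_left)
qed (use assms in simp)

end

section \<open>Completions and tensor products\<close>

text \<open>The purpose is to recognise \<open>K\<close> as the completion of \<open>P\<close>. The
  metric structure of \<open>P\<close> is pulled back from \<open>K\<close> through
  \<open>phi_cinner\<close>, so all limit arguments take place in the complete space
  \<open>K\<close>.\<close>

locale dense_isometry =
  K: hilbert_space K + P: abelian_group P
  for K :: "('b, 'k) inner_module_scheme" and P :: "('a, 'm) inner_module_scheme" +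
  fixes \<phi> :: "'a \<Rightarrow> 'b"
  assumes smult_P: "x \<in> carrier P \<Longrightarrow> a \<odot>\<^bsub>P\<^esub> x \<in> carrier P"
    and phi_in [simp, intro]: "x \<in> carrier P \<Longrightarrow> \<phi> x \<in> carrier K"
    and phi_add: "x \<in> carrier P \<Longrightarrow> y \<in> carrier P \<Longrightarrow> \<phi> (x \<oplus>\<^bsub>P\<^esub> y) = \<phi> x \<oplus>\<^bsub>K\<^esub> \<phi> y"
    and phi_smult: "x \<in> carrier P \<Longrightarrow> \<phi> (a \<odot>\<^bsub>P\<^esub> x) = a \<odot>\<^bsub>K\<^esub> \<phi> x"
    and phi_cinner: "x \<in> carrier P \<Longrightarrow> y \<in> carrier P \<Longrightarrow> cinner P x y = cinner K (\<phi> x) (\<phi> y)"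
    and phi_dense: "k \<in> carrier K \<Longrightarrow> e > 0 \<Longrightarrow> \<exists>x\<in>carrier P. cdist K (\<phi> x) k < e"
begin

lemma phi_zero: "\<phi> \<zero>\<^bsub>P\<^esub> = \<zero>\<^bsub>K\<^esub>"
  using phi_add[of "\<zero>\<^bsub>P\<^esub>" "\<zero>\<^bsub>P\<^esub>"] by (simp add: K.M.add.r_cancel_one)

lemma phi_minus:
  assumes "x \<in> carrier P"
  shows "\<phi> (\<ominus>\<^bsub>P\<^esub> x) = \<ominus>\<^bsub>K\<^esub> \<phi> x"
proof -
  have "\<phi> (\<ominus>\<^bsub>P\<^esub> x) \<oplus>\<^bsub>K\<^esub> \<phi> x = \<zero>\<^bsub>K\<^esub>"
    using phi_add[of "\<ominus>\<^bsub>P\<^esub> x" x] assms by (simp add: P.l_neg phi_zero)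
  then show ?thesis using assms by (simp add: K.M.minus_equality)
qed

lemma cdist_P: "x \<in> carrier P \<Longrightarrow> y \<in> carrier P \<Longrightarrow> cdist P x y = cdist K (\<phi> x) (\<phi> y)"
  by (simp add: cdist_def cnorm_def phi_cinner P.minus_eq K.M.minus_eq phi_add phi_minus)

text \<open>The points of the completion of \<open>P\<close> are exactly the sets \<open>limit_class k\<close>, which makes
  \<open>limit_class\<close> the unitary map from \<open>K\<close> onto the completion.\<close>

definition limit_class :: "'b \<Rightarrow> (nat \<Rightarrow> 'a) set" where
  "limit_class k = {s. range s \<subseteq> carrier P \<and> (\<lambda>n. cdist K (\<phi> (s n)) k) \<longlonglongrightarrow> 0}"

lemma cauchy_in_P: "cauchy_in P s \<longleftrightarrow> range s \<subseteq> carrier P \<and> cauchy_in K (\<lambda>n. \<phi> (s n))"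
proof (cases "range s \<subseteq> carrier P")
  case True
  then have "s n \<in> carrier P" for n by auto
  then show ?thesis using True by (auto simp: cauchy_in_def cdist_P)
qed (auto simp: cauchy_in_def)

lemma limit_class_nonempty:
  assumes "k \<in> carrier K"
  obtains s where "s \<in> limit_class k"
proof -
  have "\<exists>x\<in>carrier P. cdist K (\<phi> x) k < inverse (real (Suc n))" for n
    using phi_dense[OF assms, of "inverse (real (Suc n))"] by simp
  then obtain s where s: "\<And>n. s n \<in> carrier P" "\<And>n. cdist K (\<phi> (s n)) k < inverse (real (Suc n))"
    by metis
  have "(\<lambda>n. cdist K (\<phi> (s n)) k) \<longlonglongrightarrow> 0"
    using LIMSEQ_inverse_real_of_nat
    by (rule Lim_null_comparison[rotated]) (use s assms in \<open>auto intro!: always_eventually less_imp_le\<close>)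
  then have "s \<in> limit_class k" using s by (auto simp: limit_class_def)
  then show thesis by (rule that)
qed

lemma limit_class_cauchy: "k \<in> carrier K \<Longrightarrow> s \<in> limit_class k \<Longrightarrow> cauchy_in P s"
  unfolding cauchy_in_P limit_class_def
  by (auto intro: K.convergent_imp_cauchy_in[of _ k])

lemma cauchy_limit_class:
  assumes "cauchy_in P s" obtains k where "k \<in> carrier K" "s \<in> limit_class k"
  using assms K.complete[of "\<lambda>n. \<phi> (s n)"] unfolding cauchy_in_P limit_class_def by auto

lemma limit_class_unique:
  assumes "k \<in> carrier K" "l \<in> carrier K" "s \<in> limit_class k" "s \<in> limit_class l"
  shows "k = l"
  by (rule K.limit_unique[of "\<lambda>n. \<phi> (s n)"]) (use assms in \<open>auto simp: limit_class_def\<close>)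

text \<open>Sequences at vanishing distance have the same limit in \<open>K\<close>, and sequences
  with the same limit are at vanishing distance; both directions are the triangle inequality after
  \<open>cdist_P\<close>.\<close>

lemma completion_rel_limit_class:
  assumes k: "k \<in> carrier K" and s: "s \<in> limit_class k"
  shows "completion_rel P `` {s} = limit_class k"
proof (intro Set.set_eqI)
  fix t
  have s': "range s \<subseteq> carrier P" "(\<lambda>n. cdist K (\<phi> (s n)) k) \<longlonglongrightarrow> 0"
    using s by (auto simp: limit_class_def)
  have sn [simp]: "s n \<in> carrier P" for n using s' by auto
  have "t \<in> limit_class k" if t: "cauchy_in P t" and st: "(\<lambda>n. cdist P (s n) (t n)) \<longlonglongrightarrow> 0"
  proof -
    have tn [simp]: "t n \<in> carrier P" for n using t by (auto simp: cauchy_in_def)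
    have "(\<lambda>n. cdist K (\<phi> (s n)) k + cdist P (s n) (t n)) \<longlonglongrightarrow> 0"
      by (intro tendsto_add_zero st s')
    then have "(\<lambda>n. cdist K (\<phi> (t n)) k) \<longlonglongrightarrow> 0"
      by (rule Lim_null_comparison[rotated])
         (use k K.cdist_triangle K.cdist_commute in \<open>auto intro!: always_eventually simp: cdist_P\<close>)
    then show ?thesis by (auto simp: limit_class_def)
  qed
  moreover have "(\<lambda>n. cdist P (s n) (t n)) \<longlonglongrightarrow> 0" if t: "t \<in> limit_class k"
  proof -
    have t': "(\<lambda>n. cdist K (\<phi> (t n)) k) \<longlonglongrightarrow> 0" and tn [simp]: "t n \<in> carrier P" for n
      using t by (auto simp: limit_class_def)
    have "(\<lambda>n. cdist K (\<phi> (s n)) k + cdist K (\<phi> (t n)) k) \<longlonglongrightarrow> 0"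
      by (intro tendsto_add_zero t' s')
    then show ?thesis
      by (rule Lim_null_comparison[rotated])
         (use k K.cdist_triangle[OF _ k] K.cdist_commute[OF k] in \<open>auto intro!: always_eventually simp: cdist_P\<close>)
  qed
  ultimately show "t \<in> completion_rel P `` {s} \<longleftrightarrow> t \<in> limit_class k"
    using limit_class_cauchy[OF k] s by (auto simp: completion_rel_def)
qed

text \<open>Completeness of \<open>K\<close> gives every Cauchy sequence a limit; density of the
  range of \<open>\<phi>\<close> gives every point of \<open>K\<close> an approximating sequence.
  These are the two inclusions.\<close>

lemma carrier_completion: "carrier (completion P) = limit_class ` carrier K"
proof -
  have "X \<in> {s. cauchy_in P s} // completion_rel P \<longleftrightarrow> X \<in> limit_class ` carrier K" for X
  proof
    assume "X \<in> {s. cauchy_in P s} // completion_rel P"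
    then obtain s where s: "cauchy_in P s" "X = completion_rel P `` {s}" by (auto elim: quotientE)
    then show "X \<in> limit_class ` carrier K"
      by (metis cauchy_limit_class completion_rel_limit_class image_eqI)
  next
    assume "X \<in> limit_class ` carrier K"
    then obtain k where k: "k \<in> carrier K" "X = limit_class k" by auto
    then show "X \<in> {s. cauchy_in P s} // completion_rel P"
      by (metis limit_class_nonempty limit_class_cauchy completion_rel_limit_class quotientI mem_Collect_eq)
  qed
  then show ?thesis by (auto simp: completion_def)
qed

lemma inj_on_limit_class: "inj_on limit_class (carrier K)"
  by (rule inj_onI) (metis limit_class_nonempty limit_class_unique)

lemma limit_class_add_mem:
  assumes "k \<in> carrier K" "l \<in> carrier K" "s \<in> limit_class k" "t \<in> limit_class l"
  shows "(\<lambda>n. s n \<oplus>\<^bsub>P\<^esub> t n) \<in> limit_class (k \<oplus>\<^bsub>K\<^esub> l)"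
proof -
  have sn [simp]: "s n \<in> carrier P" and tn [simp]: "t n \<in> carrier P" for n
    using assms by (auto simp: limit_class_def)
  have "(\<lambda>n. cdist K (\<phi> (s n)) k + cdist K (\<phi> (t n)) l) \<longlonglongrightarrow> 0"
    using assms by (intro tendsto_add_zero) (auto simp: limit_class_def)
  then have "(\<lambda>n. cdist K (\<phi> (s n \<oplus>\<^bsub>P\<^esub> t n)) (k \<oplus>\<^bsub>K\<^esub> l)) \<longlonglongrightarrow> 0"
    by (rule Lim_null_comparison[rotated])
       (use assms K.cdist_add in \<open>auto intro!: always_eventually simp: phi_add\<close>)
  then show ?thesis by (auto simp: limit_class_def)
qed

lemma limit_class_smult_mem:
  assumes "k \<in> carrier K" "s \<in> limit_class k"
  shows "(\<lambda>n. a \<odot>\<^bsub>P\<^esub> s n) \<in> limit_class (a \<odot>\<^bsub>K\<^esub> k)"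
proof -
  have sn [simp]: "s n \<in> carrier P" for n
    using assms by (auto simp: limit_class_def)
  have "(\<lambda>n. cmod a * cdist K (\<phi> (s n)) k) \<longlonglongrightarrow> cmod a * 0"
    using assms by (intro tendsto_intros) (auto simp: limit_class_def)
  then have "(\<lambda>n. cdist K (\<phi> (a \<odot>\<^bsub>P\<^esub> s n)) (a \<odot>\<^bsub>K\<^esub> k)) \<longlonglongrightarrow> 0"
    using assms by (simp add: phi_smult K.cdist_smult)
  then show ?thesis by (auto simp: limit_class_def smult_P)
qed

text \<open>All representatives yield the same class, so the union collapses to it. Density enters
  through the existence of representatives, without which the union would be empty. Scalar multiples
  and inner products follow the same pattern.\<close>

lemma completion_add:
  assumes k: "k \<in> carrier K" and l: "l \<in> carrier K"
  shows "limit_class k \<oplus>\<^bsub>completion P\<^esub> limit_class l = limit_class (k \<oplus>\<^bsub>K\<^esub> l)"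
proof -
  obtain s0 t0 where "s0 \<in> limit_class k" "t0 \<in> limit_class l"
    using limit_class_nonempty k l by metis
  moreover have "completion_rel P `` {\<lambda>n. s n \<oplus>\<^bsub>P\<^esub> t n} = limit_class (k \<oplus>\<^bsub>K\<^esub> l)"
    if "s \<in> limit_class k" "t \<in> limit_class l" for s t
    using limit_class_add_mem[OF k l that] k l by (intro completion_rel_limit_class) auto
  ultimately have "(\<Union>s\<in>limit_class k. \<Union>t\<in>limit_class l. completion_rel P `` {\<lambda>n. s n \<oplus>\<^bsub>P\<^esub> t n})
      = limit_class (k \<oplus>\<^bsub>K\<^esub> l)"
    by (intro UN_constant_eq[of s0] UN_constant_eq[of t0] ballI)
  then show ?thesis by (simp add: completion_def)
qed

lemma completion_smult:
  assumes k: "k \<in> carrier K"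
  shows "a \<odot>\<^bsub>completion P\<^esub> limit_class k = limit_class (a \<odot>\<^bsub>K\<^esub> k)"
proof -
  obtain s0 where "s0 \<in> limit_class k"
    using limit_class_nonempty k by metis
  moreover have "completion_rel P `` {\<lambda>n. a \<odot>\<^bsub>P\<^esub> s n} = limit_class (a \<odot>\<^bsub>K\<^esub> k)"
    if "s \<in> limit_class k" for s
    using limit_class_smult_mem[OF k that] k by (intro completion_rel_limit_class) auto
  ultimately have "(\<Union>s\<in>limit_class k. completion_rel P `` {\<lambda>n. a \<odot>\<^bsub>P\<^esub> s n})
      = limit_class (a \<odot>\<^bsub>K\<^esub> k)"
    by (intro UN_constant_eq[of s0] ballI)
  then show ?thesis by (simp add: completion_def)
qed

lemma completion_cinner:
  assumes k: "k \<in> carrier K" and l: "l \<in> carrier K"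
  shows "cinner (completion P) (limit_class k) (limit_class l) = cinner K k l"
proof -
  obtain s0 t0 where "s0 \<in> limit_class k" "t0 \<in> limit_class l"
    using limit_class_nonempty k l by metis
  moreover have "{lim (\<lambda>n. cinner P (s n) (t n))} = {cinner K k l}"
    if "s \<in> limit_class k" "t \<in> limit_class l" for s t
  proof -
    have st: "s n \<in> carrier P" "t n \<in> carrier P" for n
      using that by (auto simp: limit_class_def)
    have "(\<lambda>n. cinner K (\<phi> (s n)) (\<phi> (t n))) \<longlonglongrightarrow> cinner K k l"
      by (rule K.tendsto_cinner) (use that k l in \<open>auto simp: limit_class_def\<close>)
    then show ?thesis
      using st by (simp add: phi_cinner limI)
  qed
  ultimately have "(\<Union>s\<in>limit_class k. \<Union>t\<in>limit_class l. {lim (\<lambda>n. cinner P (s n) (t n))})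
      = {cinner K k l}"
    by (intro UN_constant_eq[of s0] UN_constant_eq[of t0] ballI)
  then show ?thesis by (simp add: completion_def)
qed

lemma limit_class_phi: "x \<in> carrier P \<Longrightarrow> limit_class (\<phi> x) = completion_embed P x"
  unfolding completion_embed_def
  by (rule completion_rel_limit_class[symmetric]) (auto simp: limit_class_def)

end

section \<open>Concrete models of the algebraic tensor product\<close>

lemma linear_map_finsum:
  assumes H: "complex_inner_space H" and K: "complex_inner_space K" and A: "linear_map H K A"
    and "finite S" "f \<in> S \<rightarrow> carrier H"
  shows "A (finsum H f S) = finsum K (\<lambda>x. A (f x)) S"
proof -
  interpret H: complex_inner_space H by fact
  interpret K: complex_inner_space K by fact
  have Ain: "A x \<in> carrier K" if "x \<in> carrier H" for x
    using A that by (auto simp: linear_map_def)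
  show ?thesis
    using assms(4,5)
  proof induction
    case empty
    have "A (0 \<odot>\<^bsub>H\<^esub> \<zero>\<^bsub>H\<^esub>) = 0 \<odot>\<^bsub>K\<^esub> A \<zero>\<^bsub>H\<^esub>"
      using A unfolding linear_map_def by blast
    then show ?case using Ain[of "\<zero>\<^bsub>H\<^esub>"] by simp
  next
    case (insert a S)
    have "A (f a \<oplus>\<^bsub>H\<^esub> finsum H f S) = A (f a) \<oplus>\<^bsub>K\<^esub> A (finsum H f S)"
      using A insert unfolding linear_map_def by auto
    moreover have "f a \<in> carrier H" "f \<in> S \<rightarrow> carrier H" "(\<lambda>x. A (f x)) \<in> S \<rightarrow> carrier K"
      using insert.prems by (auto intro!: Ain)
    ultimately show ?case using insert Ain by (simp)
  qed
qed

text \<open>\<open>\<tau>\<close> plays the part of the map from tuples to simple tensors.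
  Prescribing its inner products suffices, because vectors in the span of its range are determined
  by their inner products with that range (\<open>form_inj\<close>).\<close>

locale tensor_isometry = K: hilbert_space K
  for I :: "'i set" and H :: "'i \<Rightarrow> ('a, 'm) inner_module_scheme"
    and K :: "('b, 'k) inner_module_scheme" and \<tau> :: "('i \<Rightarrow> 'a) \<Rightarrow> 'b" +
  assumes tau_in [simp, intro]: "x \<in> tuples I H \<Longrightarrow> \<tau> x \<in> carrier K"
    and tau_cinner: "x \<in> tuples I H \<Longrightarrow> y \<in> tuples I H \<Longrightarrow>
      cinner K (\<tau> x) (\<tau> y) = (\<Prod>i\<in>I. cinner (H i) (x i) (y i))"
begin

abbreviation (input) comb :: "('i \<Rightarrow> 'a) set \<Rightarrow> (('i \<Rightarrow> 'a) \<Rightarrow> complex) \<Rightarrow> 'b" where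
  "comb S a \<equiv> finsum K (\<lambda>x. a x \<odot>\<^bsub>K\<^esub> \<tau> x) S"

definition span_tau :: "'b set" where
  "span_tau = {comb S a | S a. finite S \<and> S \<subseteq> tuples I H}"

text \<open>The elements of \<open>algebraic_tensor I H\<close> are the forms \<open>y \<mapsto> \<langle>v, \<tau> y\<rangle>\<close> with \<open>v\<close> in the span of
  the range of \<open>\<tau>\<close>.\<close>

definition form :: "'b \<Rightarrow> ('i \<Rightarrow> 'a) \<Rightarrow> complex" where
  "form v = (\<lambda>y\<in>tuples I H. cinner K v (\<tau> y))"

abbreviation "P \<equiv> algebraic_tensor I H"

lemma comb_fun: "S \<subseteq> tuples I H \<Longrightarrow> (\<lambda>x. a x \<odot>\<^bsub>K\<^esub> \<tau> x) \<in> S \<rightarrow> carrier K"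
  by auto

lemma comb_in: "S \<subseteq> tuples I H \<Longrightarrow> comb S a \<in> carrier K"
  using comb_fun by (rule K.finsum_in)

lemma spanI: "finite S \<Longrightarrow> S \<subseteq> tuples I H \<Longrightarrow> comb S a \<in> span_tau"
  unfolding span_tau_def by (intro CollectI exI[of _ S] exI[of _ a]) simp

lemma spanE:
  assumes "v \<in> span_tau"
  obtains S a where "finite S" "S \<subseteq> tuples I H" "v = comb S a"
  using assms unfolding span_tau_def by blast

lemma span_in: "v \<in> span_tau \<Longrightarrow> v \<in> carrier K"
  by (auto simp: span_tau_def intro!: comb_in)

lemma cinner_comb_left:
  "finite S \<Longrightarrow> S \<subseteq> tuples I H \<Longrightarrow> v \<in> carrier K \<Longrightarrow>
    cinner K (comb S a) v = (\<Sum>x\<in>S. a x * cinner K (\<tau> x) v)"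
  by (subst K.cinner_finsum_left) (auto intro!: sum.cong comb_fun simp: K.cinner_smult_left subset_eq)

lemma cinner_comb_right:
  assumes "finite S" "S \<subseteq> tuples I H" "v \<in> carrier K"
  shows "cinner K v (comb S a) = (\<Sum>x\<in>S. cnj (a x) * cinner K v (\<tau> x))"
proof -
  have "cinner K v (comb S a) = cnj (cinner K (comb S a) v)"
    using assms comb_in by (intro K.cinner_commute) auto
  also have "\<dots> = (\<Sum>x\<in>S. cnj (a x) * cnj (cinner K (\<tau> x) v))"
    using assms by (simp add: cinner_comb_left)
  also have "\<dots> = (\<Sum>x\<in>S. cnj (a x) * cinner K v (\<tau> x))"
    using assms by (intro sum.cong refl arg_cong2[where f="(*)"] K.cinner_commute[symmetric]) auto
  finally show ?thesis .
qed

text \<open>Padding with zero coefficients brings two combinations to a common index set, which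
  \<open>span_add\<close> needs.\<close>

lemma comb_mono:
  assumes "finite T" "S \<subseteq> T" "T \<subseteq> tuples I H"
  shows "comb S a = comb T (\<lambda>x. if x \<in> S then a x else 0)"
proof -
  have "comb T (\<lambda>x. if x \<in> S then a x else 0) = comb S (\<lambda>x. if x \<in> S then a x else 0)"
    using assms by (intro K.M.add.finprod_mono_neutral_cong_left[symmetric]) (auto simp: subset_eq)
  also have "\<dots> = comb S a"
    using assms by (intro K.M.add.finprod_cong') (auto simp: subset_eq)
  finally show ?thesis ..
qed

lemma comb_add:
  assumes "finite S" "S \<subseteq> tuples I H"
  shows "comb S a \<oplus>\<^bsub>K\<^esub> comb S b = comb S (\<lambda>x. a x + b x)"
proof -
  have "comb S (\<lambda>x. a x + b x) = finsum K (\<lambda>x. a x \<odot>\<^bsub>K\<^esub> \<tau> x \<oplus>\<^bsub>K\<^esub> b x \<odot>\<^bsub>K\<^esub> \<tau> x) S"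
    using assms by (intro K.M.add.finprod_cong') (auto simp: subset_eq K.smult_add_left)
  also have "\<dots> = comb S a \<oplus>\<^bsub>K\<^esub> comb S b"
    using assms by (intro K.M.add.finprod_multf) auto
  finally show ?thesis ..
qed

lemma comb_smult:
  assumes "finite S" "S \<subseteq> tuples I H"
  shows "c \<odot>\<^bsub>K\<^esub> comb S a = comb S (\<lambda>x. c * a x)"
proof -
  have "linear_map K K (\<lambda>v. c \<odot>\<^bsub>K\<^esub> v)"
    by (auto simp: linear_map_def K.smult_add_right K.smult_smult mult.commute)
  then have "c \<odot>\<^bsub>K\<^esub> comb S a = finsum K (\<lambda>x. c \<odot>\<^bsub>K\<^esub> (a x \<odot>\<^bsub>K\<^esub> \<tau> x)) S"
    using assms by (intro linear_map_finsum comb_fun K.complex_inner_space_axioms) auto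
  also have "\<dots> = comb S (\<lambda>x. c * a x)"
    using assms by (intro K.M.add.finprod_cong') (auto simp: subset_eq K.smult_smult)
  finally show ?thesis .
qed

lemma span_add:
  assumes "u \<in> span_tau" "v \<in> span_tau"
  shows "u \<oplus>\<^bsub>K\<^esub> v \<in> span_tau"
proof -
  obtain S a T b where u: "finite S" "S \<subseteq> tuples I H" "u = comb S a"
    and v: "finite T" "T \<subseteq> tuples I H" "v = comb T b"
    using assms unfolding span_tau_def by blast
  let ?a = "\<lambda>x. if x \<in> S then a x else 0" and ?b = "\<lambda>x. if x \<in> T then b x else 0"
  have "u \<oplus>\<^bsub>K\<^esub> v = comb (S \<union> T) (\<lambda>x. ?a x + ?b x)"
    using u v comb_mono[of "S \<union> T" S a] comb_mono[of "S \<union> T" T b]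
      comb_add[of "S \<union> T" ?a ?b] by simp
  then show ?thesis using u v by (simp add: spanI)
qed

lemma span_smult:
  assumes "v \<in> span_tau" shows "c \<odot>\<^bsub>K\<^esub> v \<in> span_tau"
proof -
  obtain S a where "finite S" "S \<subseteq> tuples I H" "v = comb S a"
    using assms unfolding span_tau_def by blast
  then show ?thesis by (simp add: comb_smult spanI)
qed

lemma span_zero: "\<zero>\<^bsub>K\<^esub> \<in> span_tau"
proof -
  have "comb {} (\<lambda>_. 0) \<in> span_tau" by (rule spanI) auto
  then show ?thesis by simp
qed

text \<open>The difference lies in the span and is orthogonal to all generators, hence orthogonal to
  itself.\<close>

lemma form_inj:
  assumes u: "u \<in> span_tau" and v: "v \<in> span_tau" and eq: "form u = form v"
  shows "u = v"
proof -
  define w where "w = u \<ominus>\<^bsub>K\<^esub> v"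
  have uK: "u \<in> carrier K" and vK: "v \<in> carrier K" using u v span_in by auto
  have "w \<in> span_tau" unfolding w_def K.diff_eq[OF uK vK] using u v by (intro span_add span_smult)
  then obtain S a where S: "finite S" "S \<subseteq> tuples I H" "w = comb S a"
    unfolding span_tau_def by blast
  have w: "w \<in> carrier K" unfolding w_def using uK vK by auto
  have "cinner K w (\<tau> x) = 0" if "x \<in> tuples I H" for x
    using fun_cong[OF eq, of x] that uK vK unfolding w_def form_def
    by (simp add: K.cinner_diff_left)
  then have "cinner K w w = 0"
    using S w by (subst (2) S(3)) (simp add: cinner_comb_right subset_eq)
  then have "w = \<zero>\<^bsub>K\<^esub>"
    using K.cinner_pos[OF w] by force
  then show ?thesis using uK vK by (simp add: w_def K.diff_eq_zero)
qed

lemma form_comb_eq: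
  assumes "finite S" "S \<subseteq> tuples I H"
  shows "form_comb I H S a = form (comb S a)"
  unfolding form_comb_def form_def simple_form_def
  using assms by (intro restrict_ext) (auto simp: cinner_comb_left tau_cinner subset_eq intro!: sum.cong)

lemma carrier_P: "carrier P = form ` span_tau"
proof -
  have "carrier P = {form_comb I H S a | S a. finite S \<and> S \<subseteq> tuples I H}"
    by (simp add: algebraic_tensor_def)
  also have "\<dots> = form ` span_tau"
  proof (intro equalityI subsetI)
    fix F assume "F \<in> {form_comb I H S a | S a. finite S \<and> S \<subseteq> tuples I H}"
    then obtain S a where "finite S" "S \<subseteq> tuples I H" "F = form_comb I H S a" by blast
    then show "F \<in> form ` span_tau" by (simp add: form_comb_eq spanI)
  next
    fix F assume "F \<in> form ` span_tau"
    then obtain v where "v \<in> span_tau" "F = form v" by blast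
    moreover from this obtain S a where "finite S" "S \<subseteq> tuples I H" "v = comb S a"
      by (elim spanE)
    ultimately have "F = form_comb I H S a" "finite S" "S \<subseteq> tuples I H"
      by (simp_all add: form_comb_eq)
    then show "F \<in> {form_comb I H S a | S a. finite S \<and> S \<subseteq> tuples I H}" by blast
  qed
  finally show ?thesis .
qed

lemma form_add:
  "u \<in> carrier K \<Longrightarrow> v \<in> carrier K \<Longrightarrow> form u \<oplus>\<^bsub>P\<^esub> form v = form (u \<oplus>\<^bsub>K\<^esub> v)"
  by (auto simp: algebraic_tensor_def form_def K.cinner_add_left fun_eq_iff)

lemma form_smult: "v \<in> carrier K \<Longrightarrow> c \<odot>\<^bsub>P\<^esub> form v = form (c \<odot>\<^bsub>K\<^esub> v)"
  by (auto simp: algebraic_tensor_def form_def K.cinner_smult_left fun_eq_iff)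

lemma form_zero: "\<zero>\<^bsub>P\<^esub> = form \<zero>\<^bsub>K\<^esub>"
  by (auto simp: algebraic_tensor_def form_def fun_eq_iff)

text \<open>The double sum in the definition is the inner product in \<open>K\<close> of the two
  combinations, and by \<open>form_inj\<close> these vectors depend on the forms only. So all
  representations give one value, and the definite description denotes it.\<close>

lemma form_cinner:
  assumes u: "u \<in> span_tau" and v: "v \<in> span_tau"
  shows "cinner P (form u) (form v) = cinner K u v"
proof -
  have val: "(\<Sum>x\<in>S. \<Sum>y\<in>R. a x * cnj (b y) * (\<Prod>i\<in>I. cinner (H i) (x i) (y i)))
      = cinner K (comb S a) (comb R b)"
    if "finite S" "S \<subseteq> tuples I H" "finite R" "R \<subseteq> tuples I H" for S R a b
  proof -
    have "cinner K (comb S a) (comb R b) = (\<Sum>x\<in>S. a x * (\<Sum>y\<in>R. cnj (b y) * cinner K (\<tau> x) (\<tau> y)))"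
      using that comb_in[of R b]
      by (simp add: cinner_comb_left) (auto simp: cinner_comb_right subset_eq intro!: sum.cong)
    also have "\<dots> = (\<Sum>x\<in>S. \<Sum>y\<in>R. a x * cnj (b y) * (\<Prod>i\<in>I. cinner (H i) (x i) (y i)))"
      using that unfolding sum_distrib_left
      by (intro sum.cong refl) (simp add: tau_cinner subset_eq)
    finally show ?thesis ..
  qed
  obtain S a R b where S: "finite S" "S \<subseteq> tuples I H" "u = comb S a"
    and R: "finite R" "R \<subseteq> tuples I H" "v = comb R b"
    using u v unfolding span_tau_def by blast
  have uniq: "c = cinner K u v" if "finite S'" "S' \<subseteq> tuples I H" "form u = form_comb I H S' a'"
    "finite R'" "R' \<subseteq> tuples I H" "form v = form_comb I H R' b'"
    "c = (\<Sum>x\<in>S'. \<Sum>y\<in>R'. a' x * cnj (b' y) * (\<Prod>i\<in>I. cinner (H i) (x i) (y i)))"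
    for c S' a' R' b'
  proof -
    have "u = comb S' a'" "v = comb R' b'"
      using that u v by (auto simp: form_comb_eq intro!: form_inj spanI)
    then show ?thesis using that val by simp
  qed
  show ?thesis
    unfolding algebraic_tensor_def inner_module.simps
  proof (rule the_equality)
    show "\<exists>S a R b. finite S \<and> S \<subseteq> tuples I H \<and> form u = form_comb I H S a \<and>
       finite R \<and> R \<subseteq> tuples I H \<and> form v = form_comb I H R b \<and>
       cinner K u v = (\<Sum>x\<in>S. \<Sum>y\<in>R. a x * cnj (b y) * (\<Prod>i\<in>I. cinner (H i) (x i) (y i)))"
      by (intro exI[of _ S] exI[of _ a] exI[of _ R] exI[of _ b]) (simp add: S R form_comb_eq val)
  qed (use uniq in blast)
qed

lemma abelian_group_P: "abelian_group P"
proof (rule abelian_groupI)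
  fix x assume "x \<in> carrier P"
  then obtain v where v: "v \<in> span_tau" "x = form v" by (auto simp: carrier_P)
  show "\<exists>y\<in>carrier P. y \<oplus>\<^bsub>P\<^esub> x = \<zero>\<^bsub>P\<^esub>"
  proof
    show "form ((-1) \<odot>\<^bsub>K\<^esub> v) \<in> carrier P" using v span_smult by (auto simp: carrier_P)
    show "form ((-1) \<odot>\<^bsub>K\<^esub> v) \<oplus>\<^bsub>P\<^esub> x = \<zero>\<^bsub>P\<^esub>"
      using v span_in by (simp add: form_add form_zero K.minus_eq_smult[symmetric] K.M.l_neg)
  qed
qed (use span_in span_add span_zero in
      \<open>auto simp: carrier_P form_add form_zero K.M.a_ac\<close>)

lemma simple_form_eq: "x \<in> tuples I H \<Longrightarrow> simple_form I H x = form (\<tau> x)"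
  unfolding form_def simple_form_def by (intro restrict_ext) (auto simp: tau_cinner)

lemma tau_span: "x \<in> tuples I H \<Longrightarrow> \<tau> x \<in> span_tau"
proof -
  assume x: "x \<in> tuples I H"
  then have "comb {x} (\<lambda>_. 1) \<in> span_tau" by (intro spanI) auto
  then show ?thesis using x by simp
qed

text \<open>This inverse is the isometry from the algebraic tensor product into \<open>K\<close>
  that instantiates \<open>\<phi>\<close> in \<open>dense_isometry\<close>.\<close>

definition unform :: "(('i \<Rightarrow> 'a) \<Rightarrow> complex) \<Rightarrow> 'b" where
  "unform = the_inv_into span_tau form"

lemma unform_form [simp]: "v \<in> span_tau \<Longrightarrow> unform (form v) = v"
  unfolding unform_def by (rule the_inv_into_f_f) (auto intro: inj_onI form_inj)

end

section \<open>Models of the Hilbert tensor product and of tensor operators\<close>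

locale tensor_realization = tensor_isometry +
  assumes span_dense: "k \<in> carrier K \<Longrightarrow> e > 0 \<Longrightarrow> \<exists>v\<in>span_tau. cdist K v k < e"
begin

lemma dense_isometry_unform: "dense_isometry K P unform"
proof (intro dense_isometry.intro dense_isometry_axioms.intro)
  show "hilbert_space K" by (rule K.hilbert_space_axioms)
  show "abelian_group P" by (rule abelian_group_P)
  fix k e :: "_" assume k: "k \<in> carrier K" and e: "(e :: real) > 0"
  show "\<exists>x\<in>carrier P. cdist K (unform x) k < e"
    using span_dense[OF k e] by (auto simp: carrier_P)
qed (use span_in span_add span_smult in \<open>auto simp: carrier_P form_add form_smult form_cinner\<close>)

sublocale D: dense_isometry K P unform
  by (rule dense_isometry_unform)

lemma limit_class_tau: "x \<in> tuples I H \<Longrightarrow> D.limit_class (\<tau> x) = simple_tensor I H x"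
  using D.limit_class_phi[of "form (\<tau> x)"] tau_span[of x]
  by (simp add: simple_tensor_def simple_form_eq carrier_P)

text \<open>Linearity extends the agreement to the span, boundedness and density to all of
  \<open>K\<close>. This supplies the uniqueness half of the definite description in
  \<open>tensor_operator\<close>.\<close>

lemma bounded_linear_map_eq_on_tau:
  assumes A: "bounded_linear_map K K A" and B: "bounded_linear_map K K B"
    and eq: "\<And>x. x \<in> tuples I H \<Longrightarrow> A (\<tau> x) = B (\<tau> x)" and k: "k \<in> carrier K"
  shows "A k = B k"
proof -
  obtain C D where C: "\<And>x. x \<in> carrier K \<Longrightarrow> cnorm K (A x) \<le> C * cnorm K x"
    and D: "\<And>x. x \<in> carrier K \<Longrightarrow> cnorm K (B x) \<le> D * cnorm K x"
    using A B unfolding bounded_linear_map_def by blast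
  have lin: "linear_map K K A" "linear_map K K B" using A B by (auto simp: bounded_linear_map_def)
  have in_K [simp]: "A x \<in> carrier K" "B x \<in> carrier K" if "x \<in> carrier K" for x
    using lin that by (auto simp: linear_map_def)
  have diff: "A (x \<ominus>\<^bsub>K\<^esub> y) = A x \<ominus>\<^bsub>K\<^esub> A y" "B (x \<ominus>\<^bsub>K\<^esub> y) = B x \<ominus>\<^bsub>K\<^esub> B y"
    if "x \<in> carrier K" "y \<in> carrier K" for x y
    using lin that by (auto simp: linear_map_def K.diff_eq)
  have eq_span: "A v = B v" if "v \<in> span_tau" for v
  proof -
    obtain S a where S: "finite S" "S \<subseteq> tuples I H" "v = comb S a"
      using \<open>v \<in> span_tau\<close> unfolding span_tau_def by blast
    have "A v = finsum K (\<lambda>x. A (a x \<odot>\<^bsub>K\<^esub> \<tau> x)) S"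
      unfolding S(3) by (intro linear_map_finsum lin comb_fun S K.complex_inner_space_axioms)
    also have "\<dots> = finsum K (\<lambda>x. B (a x \<odot>\<^bsub>K\<^esub> \<tau> x)) S"
      using S lin eq
      by (intro K.M.add.finprod_cong') (auto simp: linear_map_def subset_eq)
    also have "\<dots> = B v"
      unfolding S(3) by (intro linear_map_finsum[symmetric] lin comb_fun S K.complex_inner_space_axioms)
    finally show ?thesis .
  qed
  have "cdist K (A k) (B k) \<le> e" if e: "e > 0" for e
  proof -
    \<comment> \<open>The operators move the error by at most \<open>C + D\<close> times
      \<open>e'\<close>. Absolute values are taken because the bounds may be negative, and the
      summand 1 keeps the denominator positive.\<close>
    define e' where "e' = e / (\<bar>C\<bar> + \<bar>D\<bar> + 1)"
    have e': "e' > 0" using e by (simp add: e'_def)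
    obtain v where v: "v \<in> span_tau" "v \<in> carrier K" and d: "cdist K v k < e'"
      using span_dense[OF k e'] span_in by blast
    have "cdist K (A k) (B k) \<le> cdist K (A k) (A v) + cdist K (A v) (B k)"
      using k v by (intro K.cdist_triangle) auto
    also have "\<dots> = cnorm K (A (k \<ominus>\<^bsub>K\<^esub> v)) + cnorm K (B (v \<ominus>\<^bsub>K\<^esub> k))"
      using k v by (simp add: cdist_def diff eq_span)
    also have "\<dots> \<le> C * cnorm K (k \<ominus>\<^bsub>K\<^esub> v) + D * cnorm K (v \<ominus>\<^bsub>K\<^esub> k)"
      using k v by (intro add_mono C D) auto
    also have "\<dots> = (C + D) * cdist K v k"
      using K.cdist_commute[OF k v(2)] by (simp add: cdist_def algebra_simps)
    also have "\<dots> \<le> (\<bar>C\<bar> + \<bar>D\<bar> + 1) * e'"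
      using d e' k v by (intro mult_mono) auto
    also have "\<dots> = e" by (simp add: e'_def)
    finally show ?thesis .
  qed
  then have "cdist K (A k) (B k) \<le> 0" by (rule field_le_epsilon[of _ 0, simplified])
  then have "cdist K (A k) (B k) = 0"
    using K.cdist_nonneg[OF in_K[OF k]] by linarith
  then show ?thesis using k K.cdist_eq_0 by simp
qed

text \<open>The unitary \<open>\<kappa>\<close> from \<open>K\<close> onto the tensor product
  conjugates \<open>B\<close> into an operator \<open>W\<close> with the defining property of
  \<open>tensor_operator\<close>. Any other candidate is pulled back to \<open>K\<close> and
  compared with \<open>B\<close> there. The inverse \<open>\<psi>\<close> of \<open>\<kappa>\<close>
  is then the required equivalence.\<close>

theorem unitarily_equivalent_tensor_operator:
  assumes B: "unitary_operator K B"
    and A: "\<And>i x. i \<in> I \<Longrightarrow> x \<in> carrier (H i) \<Longrightarrow> A i x \<in> carrier (H i)"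
    and tau: "\<And>x. x \<in> tuples I H \<Longrightarrow> \<tau> (\<lambda>i\<in>I. A i (x i)) = B (\<tau> x)"
  shows "unitarily_equivalent (hilbert_tensor I H) (tensor_operator I H A) K B"
proof -
  define T where "T = hilbert_tensor I H"
  define \<kappa> where "\<kappa> = D.limit_class"
  define \<psi> where "\<psi> = the_inv_into (carrier K) \<kappa>"
  have T: "carrier T = \<kappa> ` carrier K"
    unfolding T_def hilbert_tensor_def \<kappa>_def by (rule D.carrier_completion)
  have psi [simp]: "\<psi> (\<kappa> k) = k" if "k \<in> carrier K" for k
    unfolding \<psi>_def \<kappa>_def using D.inj_on_limit_class that by (rule the_inv_into_f_f)
  have T_add: "\<kappa> k \<oplus>\<^bsub>T\<^esub> \<kappa> l = \<kappa> (k \<oplus>\<^bsub>K\<^esub> l)"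
    and T_cinner: "cinner T (\<kappa> k) (\<kappa> l) = cinner K k l" if "k \<in> carrier K" "l \<in> carrier K" for k l
    using that by (simp_all add: T_def \<kappa>_def hilbert_tensor_def D.completion_add D.completion_cinner)
  have T_smult: "c \<odot>\<^bsub>T\<^esub> \<kappa> k = \<kappa> (c \<odot>\<^bsub>K\<^esub> k)" if "k \<in> carrier K" for c k
    using that by (simp add: T_def \<kappa>_def hilbert_tensor_def D.completion_smult)
  have T_cnorm: "cnorm T (\<kappa> k) = cnorm K k" if "k \<in> carrier K" for k
    using that by (simp add: cnorm_def T_cinner)
  have T_simple: "simple_tensor I H x = \<kappa> (\<tau> x)" if "x \<in> tuples I H" for x
    using that by (simp add: limit_class_tau \<kappa>_def)
  have B_in [simp]: "B k \<in> carrier K" if "k \<in> carrier K" for k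
    using B that by (auto simp: unitary_map_def linear_map_def)
  have B_lin: "linear_map K K B" using B by (simp add: unitary_map_def)
  have B_cnorm: "cnorm K (B k) = cnorm K k" if "k \<in> carrier K" for k
    using B that by (simp add: unitary_map_def cnorm_def)
  have B_bdd: "bounded_linear_map K K B"
    unfolding bounded_linear_map_def using B_lin B_cnorm by (metis mult_1 order_refl)
  define W where "W = (\<lambda>X\<in>carrier T. \<kappa> (B (\<psi> X)))"
  have W: "W (\<kappa> k) = \<kappa> (B k)" if "k \<in> carrier K" for k
    using that by (auto simp: W_def T)
  have Ax: "(\<lambda>i\<in>I. A i (x i)) \<in> tuples I H" if "x \<in> tuples I H" for x
    using that A by (auto simp: PiE_iff)
  have "tensor_operator I H A = W"
    unfolding tensor_operator_def T_def[symmetric]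
  proof (rule the_equality, intro conjI ballI)
    show "W \<in> extensional (carrier T)" by (simp add: W_def)
    have "linear_map T T W"
      using B_lin unfolding linear_map_def
      by (auto simp: T W T_add T_smult)
    moreover have "cnorm T (W X) \<le> 1 * cnorm T X" if "X \<in> carrier T" for X
      using that by (auto simp: T W T_cnorm B_cnorm)
    ultimately show "bounded_linear_map T T W" unfolding bounded_linear_map_def by blast
    show "W (simple_tensor I H x) = simple_tensor I H (\<lambda>i\<in>I. A i (x i))" if "x \<in> tuples I H" for x
      using that Ax[OF that] by (simp add: T_simple W tau)
  next
    fix V assume V: "V \<in> extensional (carrier T) \<and> bounded_linear_map T T V \<and>
      (\<forall>x\<in>tuples I H. V (simple_tensor I H x) = simple_tensor I H (\<lambda>i\<in>I. A i (x i)))"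
    then have V_lin: "linear_map T T V" by (simp add: bounded_linear_map_def)
    have V_ex: "\<exists>l\<in>carrier K. V (\<kappa> k) = \<kappa> l" if "k \<in> carrier K" for k
      using V_lin imageI[OF that, of \<kappa>] unfolding linear_map_def T by blast
    \<comment> \<open>The candidate pulled back to \<open>K\<close>; it inherits linearity and the
      bound, so \<open>bounded_linear_map_eq_on_tau\<close> applies to it.\<close>
    define V' where "V' k = \<psi> (V (\<kappa> k))" for k
    have V'_in [simp]: "V' k \<in> carrier K" and V': "V (\<kappa> k) = \<kappa> (V' k)" if "k \<in> carrier K" for k
    proof -
      from V_ex[OF that] obtain l where l: "l \<in> carrier K" "V (\<kappa> k) = \<kappa> l" by blast
      then have "V' k = l" by (simp add: V'_def)
      then show "V' k \<in> carrier K" "V (\<kappa> k) = \<kappa> (V' k)" using l by auto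
    qed
    have "V' (k \<oplus>\<^bsub>K\<^esub> l) = V' k \<oplus>\<^bsub>K\<^esub> V' l" if "k \<in> carrier K" "l \<in> carrier K" for k l
    proof -
      have "V (\<kappa> (k \<oplus>\<^bsub>K\<^esub> l)) = V (\<kappa> k) \<oplus>\<^bsub>T\<^esub> V (\<kappa> l)"
        using V_lin that by (simp add: linear_map_def T T_add[symmetric])
      then show ?thesis using that unfolding V'_def[of "k \<oplus>\<^bsub>K\<^esub> l"] by (simp add: V' T_add)
    qed
    moreover have "V' (c \<odot>\<^bsub>K\<^esub> k) = c \<odot>\<^bsub>K\<^esub> V' k" if "k \<in> carrier K" for c k
    proof -
      have "V (\<kappa> (c \<odot>\<^bsub>K\<^esub> k)) = c \<odot>\<^bsub>T\<^esub> V (\<kappa> k)"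
        using V_lin that by (simp add: linear_map_def T T_smult[symmetric])
      then show ?thesis using that unfolding V'_def[of "c \<odot>\<^bsub>K\<^esub> k"] by (simp add: V' T_smult)
    qed
    ultimately have "linear_map K K V'" by (auto simp: linear_map_def)
    moreover obtain C where "\<And>X. X \<in> carrier T \<Longrightarrow> cnorm T (V X) \<le> C * cnorm T X"
      using V by (auto simp: bounded_linear_map_def)
    then have "cnorm K (V' k) \<le> C * cnorm K k" if "k \<in> carrier K" for k
      using that T_cnorm V' by (metis T V'_in imageI)
    ultimately have "bounded_linear_map K K V'" unfolding bounded_linear_map_def by blast
    moreover have "V' (\<tau> x) = B (\<tau> x)" if "x \<in> tuples I H" for x
      using V that Ax[OF that] unfolding V'_def by (simp add: T_simple[symmetric]) (simp add: T_simple tau)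
    ultimately have "V' k = B k" if "k \<in> carrier K" for k
      using bounded_linear_map_eq_on_tau[OF _ B_bdd] that by blast
    then have "V X = W X" if "X \<in> carrier T" for X
      using that by (auto simp: T V' W)
    moreover have "W \<in> extensional (carrier T)" by (simp add: W_def)
    ultimately show "V = W" using V by (intro extensionalityI) auto
  qed
  moreover have "unitary_map T K \<psi>"
    unfolding unitary_map_def linear_map_def bij_betw_def inj_on_def
    by (auto simp: T T_add T_smult T_cinner image_image)
  ultimately show ?thesis
    unfolding unitarily_equivalent_def T_def[symmetric]
    by (intro exI[of _ \<psi>]) (auto simp: T W)
qed

end

section \<open>The space \<open>L\<^sub>2\<close>\<close>

lemma square_integrableD:
  assumes "f \<in> square_integrable M"
  shows "f \<in> borel_measurable M" "integrable M (\<lambda>x. (cmod (f x))\<^sup>2)"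
  using assms by (auto simp: square_integrable_def)

text \<open>This allows estimates to run on squared distances, without square roots: the factor 2
  replaces the triangle inequality, and explains the recurring choice of \<open>e / 4\<close> in the
  density argument.\<close>

lemma cmod_add_sq_le: "(cmod (a + b))\<^sup>2 \<le> 2 * (cmod a)\<^sup>2 + 2 * (cmod b)\<^sup>2"
proof -
  have "(cmod (a + b))\<^sup>2 \<le> (cmod a + cmod b)\<^sup>2"
    by (intro power_mono norm_triangle_ineq) auto
  also have "\<dots> \<le> 2 * (cmod a)\<^sup>2 + 2 * (cmod b)\<^sup>2"
    using sum_squares_bound[of "cmod a" "cmod b"] by (simp add: power2_sum)
  finally show ?thesis .
qed

lemma square_integrable_add:
  assumes f: "f \<in> square_integrable M" and g: "g \<in> square_integrable M"
  shows "(\<lambda>x. f x + g x) \<in> square_integrable M"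
proof -
  note [measurable] = square_integrableD(1)[OF f] square_integrableD(1)[OF g]
  have "integrable M (\<lambda>x. 2 * (cmod (f x))\<^sup>2 + 2 * (cmod (g x))\<^sup>2)"
    using square_integrableD[OF f] square_integrableD[OF g] by simp
  then have "integrable M (\<lambda>x. (cmod (f x + g x))\<^sup>2)"
    by (rule Bochner_Integration.integrable_bound)
       (auto intro!: cmod_add_sq_le[THEN order_trans])
  then show ?thesis by (simp add: square_integrable_def)
qed

lemma square_integrable_cmult:
  assumes f: "f \<in> square_integrable M"
  shows "(\<lambda>x. c * f x) \<in> square_integrable M"
proof -
  note [measurable] = square_integrableD(1)[OF f]
  show ?thesis using square_integrableD(2)[OF f]
    by (simp add: square_integrable_def norm_mult power_mult_distrib)
qed

lemma square_integrable_zero: "(\<lambda>x. 0) \<in> square_integrable M"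
  by (simp add: square_integrable_def)

lemma square_integrable_diff:
  assumes f: "f \<in> square_integrable M" and g: "g \<in> square_integrable M"
  shows "(\<lambda>x. f x - g x) \<in> square_integrable M"
  using square_integrable_add[OF f square_integrable_cmult[OF g, of "-1"]] by simp

lemma square_integrable_bound:
  assumes "integrable M w" "f \<in> borel_measurable M" "AE x in M. (cmod (f x))\<^sup>2 \<le> w x"
  shows "f \<in> square_integrable M"
proof -
  note [measurable] = assms(2)
  have "integrable M (\<lambda>x. (cmod (f x))\<^sup>2)"
    by (rule Bochner_Integration.integrable_bound[OF assms(1)])
       (use assms(3) in \<open>auto elim!: eventually_mono\<close>)
  then show ?thesis by (simp add: square_integrable_def)
qed

lemma borel_measurable_cnj_comp [measurable (raw)]:
  "f \<in> borel_measurable M \<Longrightarrow> (\<lambda>x. cnj (f x)) \<in> borel_measurable M"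
  by (rule measurable_compose[OF _ borel_measurable_continuous_onI]) (auto intro: continuous_intros)

lemma integrable_mult_cnj:
  assumes f: "f \<in> square_integrable M" and g: "g \<in> square_integrable M"
  shows "integrable M (\<lambda>x. f x * cnj (g x))"
proof -
  note [measurable] = square_integrableD(1)[OF f] square_integrableD(1)[OF g]
  have int: "integrable M (\<lambda>x. (cmod (f x))\<^sup>2 + (cmod (g x))\<^sup>2)"
    using square_integrableD[OF f] square_integrableD[OF g] by simp
  have le: "cmod a * cmod b \<le> (cmod a)\<^sup>2 + (cmod b)\<^sup>2" for a b
    using sum_squares_bound[of "cmod a" "cmod b"] mult_nonneg_nonneg[OF norm_ge_zero[of a] norm_ge_zero[of b]]
    by linarith
  show ?thesis
  proof (rule Bochner_Integration.integrable_bound[OF int])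
    show "AE x in M. norm (f x * cnj (g x)) \<le> norm ((cmod (f x))\<^sup>2 + (cmod (g x))\<^sup>2)"
      using le by (intro AE_I2) (simp add: norm_mult)
  qed measurable
qed

definition L2_class :: "'b measure \<Rightarrow> ('b \<Rightarrow> complex) \<Rightarrow> ('b \<Rightarrow> complex) set" where
  "L2_class M f = L2_rel M `` {f}"

lemma mem_L2_class:
  "g \<in> L2_class M f \<longleftrightarrow>
    f \<in> square_integrable M \<and> g \<in> square_integrable M \<and> (AE x in M. f x = g x)"
  by (auto simp: L2_class_def L2_rel_def)

lemma L2_class_self: "f \<in> square_integrable M \<Longrightarrow> f \<in> L2_class M f"
  by (simp add: mem_L2_class)

lemma L2_class_eq_iff:
  assumes "f \<in> square_integrable M" "g \<in> square_integrable M"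
  shows "L2_class M f = L2_class M g \<longleftrightarrow> (AE x in M. f x = g x)"
proof
  assume "L2_class M f = L2_class M g"
  then have "g \<in> L2_class M f" using assms L2_class_self by auto
  then show "AE x in M. f x = g x" by (simp add: mem_L2_class)
next
  assume *: "AE x in M. f x = g x"
  show "L2_class M f = L2_class M g"
  proof (intro Set.set_eqI)
    fix h
    have "AE x in M. g x = h x" if "AE x in M. f x = h x"
      using * that by eventually_elim simp
    moreover have "AE x in M. f x = h x" if "AE x in M. g x = h x"
      using * that by eventually_elim simp
    ultimately have "(AE x in M. f x = h x) \<longleftrightarrow> (AE x in M. g x = h x)" by blast
    then show "h \<in> L2_class M f \<longleftrightarrow> h \<in> L2_class M g"
      using assms by (simp add: mem_L2_class)
  qed
qed

lemma carrier_L2: "carrier (L2 M) = L2_class M ` square_integrable M"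
  by (auto simp: L2_def quotient_def L2_class_def)

lemma L2_class_in [simp, intro]: "f \<in> square_integrable M \<Longrightarrow> L2_class M f \<in> carrier (L2 M)"
  by (simp add: carrier_L2)

lemma L2_carrierE:
  assumes "X \<in> carrier (L2 M)"
  obtains f where "f \<in> square_integrable M" "X = L2_class M f"
  using assms by (auto simp: carrier_L2)

lemma L2_zero: "\<zero>\<^bsub>L2 M\<^esub> = L2_class M (\<lambda>x. 0)"
  by (simp add: L2_def L2_class_def)

lemma L2_add:
  assumes f: "f \<in> square_integrable M" and g: "g \<in> square_integrable M"
  shows "L2_class M f \<oplus>\<^bsub>L2 M\<^esub> L2_class M g = L2_class M (\<lambda>x. f x + g x)"
proof -
  have "L2_class M (\<lambda>x. f' x + g' x) = L2_class M (\<lambda>x. f x + g x)"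
    if "f' \<in> L2_class M f" "g' \<in> L2_class M g" for f' g'
  proof -
    from that have "AE x in M. f x = f' x" "AE x in M. g x = g' x"
      by (auto simp: mem_L2_class)
    then have "AE x in M. f' x + g' x = f x + g x" by eventually_elim simp
    then show ?thesis
      using that by (subst L2_class_eq_iff) (auto simp: mem_L2_class intro!: square_integrable_add)
  qed
  then have "(\<Union>f'\<in>L2_class M f. \<Union>g'\<in>L2_class M g. L2_class M (\<lambda>x. f' x + g' x))
      = L2_class M (\<lambda>x. f x + g x)"
    by (intro UN_constant_eq[OF L2_class_self[OF f]] UN_constant_eq[OF L2_class_self[OF g]] ballI)
  then show ?thesis by (simp add: L2_def L2_class_def)
qed

lemma L2_smult:
  assumes f: "f \<in> square_integrable M"
  shows "a \<odot>\<^bsub>L2 M\<^esub> L2_class M f = L2_class M (\<lambda>x. a * f x)"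
proof -
  have "L2_class M (\<lambda>x. a * f' x) = L2_class M (\<lambda>x. a * f x)"
    if "f' \<in> L2_class M f" for f'
  proof -
    from that have "AE x in M. f x = f' x" by (simp add: mem_L2_class)
    then have "AE x in M. a * f' x = a * f x" by eventually_elim simp
    then show ?thesis
      using that by (subst L2_class_eq_iff) (auto simp: mem_L2_class intro!: square_integrable_cmult)
  qed
  then have "(\<Union>f'\<in>L2_class M f. L2_class M (\<lambda>x. a * f' x)) = L2_class M (\<lambda>x. a * f x)"
    by (intro UN_constant_eq[OF L2_class_self[OF f]] ballI)
  then show ?thesis by (simp add: L2_def L2_class_def)
qed

lemma L2_cinner:
  assumes f: "f \<in> square_integrable M" and g: "g \<in> square_integrable M"
  shows "cinner (L2 M) (L2_class M f) (L2_class M g) = (\<integral>x. f x * cnj (g x) \<partial>M)"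
proof -
  have "(\<integral>x. f' x * cnj (g' x) \<partial>M) = (\<integral>x. f x * cnj (g x) \<partial>M)"
    if "f' \<in> L2_class M f" "g' \<in> L2_class M g" for f' g'
  proof (rule integral_cong_AE)
    from that have ae: "AE x in M. f x = f' x" "AE x in M. g x = g' x"
      and [measurable]: "f' \<in> borel_measurable M" "g' \<in> borel_measurable M"
      by (auto simp: mem_L2_class dest: square_integrableD)
    note [measurable] = square_integrableD(1)[OF f] square_integrableD(1)[OF g]
    show "AE x in M. f' x * cnj (g' x) = f x * cnj (g x)"
      using ae by eventually_elim simp
    show "(\<lambda>x. f' x * cnj (g' x)) \<in> borel_measurable M" "(\<lambda>x. f x * cnj (g x)) \<in> borel_measurable M"
      by measurable
  qed
  then have "(\<Union>f'\<in>L2_class M f. \<Union>g'\<in>L2_class M g. {\<integral>x. f' x * cnj (g' x) \<partial>M})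
      = {\<integral>x. f x * cnj (g x) \<partial>M}"
    by (intro UN_constant_eq[OF L2_class_self[OF f]] UN_constant_eq[OF L2_class_self[OF g]] ballI) simp
  then show ?thesis by (simp add: L2_def)
qed

lemma L2_cinner_self:
  assumes f: "f \<in> square_integrable M"
  shows "cinner (L2 M) (L2_class M f) (L2_class M f) = of_real (\<integral>x. (cmod (f x))\<^sup>2 \<partial>M)"
  using f by (simp add: L2_cinner complex_norm_square[symmetric] del: of_real_power)

lemma complex_inner_space_L2: "complex_inner_space (L2 M)"
proof (rule complex_inner_spaceI)
  show "abelian_group (L2 M)"
  proof (rule abelian_groupI)
    fix X assume "X \<in> carrier (L2 M)"
    then obtain f where f: "f \<in> square_integrable M" "X = L2_class M f" by (rule L2_carrierE)
    then have "L2_class M (\<lambda>x. (-1) * f x) \<oplus>\<^bsub>L2 M\<^esub> X = \<zero>\<^bsub>L2 M\<^esub>"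
      using square_integrable_cmult[OF f(1), of "-1"] by (simp add: L2_add L2_zero)
    then show "\<exists>Y\<in>carrier (L2 M). Y \<oplus>\<^bsub>L2 M\<^esub> X = \<zero>\<^bsub>L2 M\<^esub>"
      using square_integrable_cmult[OF f(1), of "-1"] by blast
  qed (auto elim!: L2_carrierE simp: L2_add L2_zero square_integrable_add square_integrable_zero ac_simps)
next
  fix X assume "X \<in> carrier (L2 M)" and X: "X \<noteq> \<zero>\<^bsub>L2 M\<^esub>"
  then obtain f where f: "f \<in> square_integrable M" "X = L2_class M f" by (metis L2_carrierE)
  have "\<not> (AE x in M. f x = 0)"
    using X f L2_class_eq_iff[OF f(1) square_integrable_zero] by (simp add: L2_zero)
  then have "(\<integral>x. (cmod (f x))\<^sup>2 \<partial>M) \<noteq> 0"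
    using integral_nonneg_eq_0_iff_AE[OF square_integrableD(2)[OF f(1)]] by simp
  moreover have "(\<integral>x. (cmod (f x))\<^sup>2 \<partial>M) \<ge> 0" by (rule integral_nonneg_AE) simp
  ultimately have "(\<integral>x. (cmod (f x))\<^sup>2 \<partial>M) > 0" by linarith
  then show "0 < Re (cinner (L2 M) X X)"
    using f by (simp add: L2_cinner_self)
next
  fix X Y assume "X \<in> carrier (L2 M)" "Y \<in> carrier (L2 M)"
  then obtain f g where fg: "f \<in> square_integrable M" "X = L2_class M f"
      "g \<in> square_integrable M" "Y = L2_class M g"
    by (metis L2_carrierE)
  have "cnj (\<integral>x. g x * cnj (f x) \<partial>M) = (\<integral>x. cnj (g x * cnj (f x)) \<partial>M)"
    by (rule Bochner_Integration.integral_cnj[symmetric])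
  also have "\<dots> = (\<integral>x. f x * cnj (g x) \<partial>M)"
    by (intro Bochner_Integration.integral_cong refl) simp
  finally show "cinner (L2 M) X Y = cnj (cinner (L2 M) Y X)"
    using fg by (simp add: L2_cinner)
qed (auto elim!: L2_carrierE
      simp: L2_add L2_smult L2_cinner square_integrable_add square_integrable_cmult algebra_simps
        integrable_mult_cnj Bochner_Integration.integral_add)

lemma L2_cnorm:
  "f \<in> square_integrable M \<Longrightarrow> cnorm (L2 M) (L2_class M f) = sqrt (\<integral>x. (cmod (f x))\<^sup>2 \<partial>M)"
  by (simp add: cnorm_def L2_cinner_self)

lemma L2_diff:
  assumes f: "f \<in> square_integrable M" and g: "g \<in> square_integrable M"
  shows "L2_class M f \<ominus>\<^bsub>L2 M\<^esub> L2_class M g = L2_class M (\<lambda>x. f x - g x)"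
proof -
  interpret complex_inner_space "L2 M" by (rule complex_inner_space_L2)
  show ?thesis
    using f g square_integrable_cmult[OF g, of "-1"] by (simp add: diff_eq L2_smult L2_add)
qed

lemma L2_cdist:
  assumes f: "f \<in> square_integrable M" and g: "g \<in> square_integrable M"
  shows "cdist (L2 M) (L2_class M f) (L2_class M g) = sqrt (\<integral>x. (cmod (f x - g x))\<^sup>2 \<partial>M)"
  using assms by (simp add: cdist_def L2_diff L2_cnorm square_integrable_diff)

section \<open>Completeness of the space of square-integrable functions\<close>

lemma (in finite_measure) AE_convergent_if_L2_fast:
  fixes g :: "nat \<Rightarrow> 'a \<Rightarrow> complex"
  assumes g: "\<And>k. g k \<in> square_integrable M"
    and fast: "\<And>k. (\<integral>x. (cmod (g (Suc k) x - g k x))\<^sup>2 \<partial>M) \<le> (1/4)^k"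
  shows "AE x in M. convergent (\<lambda>k. g k x)"
proof -
  note [measurable] = square_integrableD(1)[OF g]
  define d where "d k x = cmod (g (Suc k) x - g k x)" for k x
  have [measurable]: "d k \<in> borel_measurable M" for k unfolding d_def by measurable
  have d2: "integrable M (\<lambda>x. (d k x)\<^sup>2)" for k
    unfolding d_def using square_integrableD(2)[OF square_integrable_diff[OF g g]] .
  \<comment> \<open>An arithmetic-geometric mean bound that passes from squares to first powers. The
    weight 2^k is balanced against the hypothesis: both terms then have integrals of order 2^(-k),
    the second because the measure is finite, so the increments are summable almost
    everywhere.\<close>
  have d_le: "d k x \<le> 2^k * (d k x)\<^sup>2 + (1/2)^k" for k x
  proof -
    have "0 \<le> (2^k * d k x - 1)\<^sup>2 / 2^k" by simp
    also have "\<dots> = 2^k * (d k x)\<^sup>2 - 2 * d k x + (1/2)^k"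
      by (simp add: power2_diff power2_eq_square field_simps power_divide)
    finally have "2 * d k x \<le> 2^k * (d k x)\<^sup>2 + (1/2)^k" by simp
    moreover have "d k x \<ge> 0" by (simp add: d_def)
    ultimately show ?thesis by simp
  qed
  have nn: "(\<integral>\<^sup>+x. ennreal (d k x) \<partial>M) \<le> ennreal ((1 + measure M (space M)) * (1/2)^k)" for k
  proof -
    have "(\<integral>\<^sup>+x. ennreal (d k x) \<partial>M) \<le> (\<integral>\<^sup>+x. ennreal (2^k * (d k x)\<^sup>2 + (1/2)^k) \<partial>M)"
      by (intro nn_integral_mono ennreal_leI d_le)
    also have "\<dots> = ennreal (\<integral>x. 2^k * (d k x)\<^sup>2 + (1/2)^k \<partial>M)"
      using d2 by (intro nn_integral_eq_integral) auto
    also have "(\<integral>x. 2^k * (d k x)\<^sup>2 + (1/2)^k \<partial>M)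
        = 2^k * (\<integral>x. (d k x)\<^sup>2 \<partial>M) + measure M (space M) * (1/2)^k"
      using d2 by simp
    also have "2^k * (\<integral>x. (d k x)\<^sup>2 \<partial>M) \<le> 2^k * (1/4)^k"
      unfolding d_def by (intro mult_left_mono fast) simp
    also have "2^k * (1/4)^k = ((1/2)^k :: real)"
      by (simp add: power_mult_distrib[symmetric])
    finally show ?thesis by (simp add: algebra_simps ennreal_leI)
  qed
  have "(\<integral>\<^sup>+x. (\<Sum>k. ennreal (d k x)) \<partial>M) = (\<Sum>k. \<integral>\<^sup>+x. ennreal (d k x) \<partial>M)"
    by (intro nn_integral_suminf) measurable
  also have "\<dots> \<le> (\<Sum>k. ennreal ((1 + measure M (space M)) * (1/2)^k))"
    by (intro suminf_le nn) auto
  also have "\<dots> = ennreal (\<Sum>k. (1 + measure M (space M)) * (1/2)^k)"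
    by (intro suminf_ennreal2 summable_mult summable_geometric) auto
  also have "\<dots> < \<infinity>" by simp
  finally have "AE x in M. (\<Sum>k. ennreal (d k x)) \<noteq> \<infinity>"
    by (intro nn_integral_PInf_AE) auto
  then show ?thesis
  proof eventually_elim
    case (elim x)
    have "summable (\<lambda>k. d k x)"
      by (rule summable_suminf_not_top) (use elim in \<open>auto simp: d_def\<close>)
    then have "summable (\<lambda>k. g (Suc k) x - g k x)"
      unfolding d_def by (rule summable_norm_cancel)
    then have "convergent (\<lambda>n. (\<Sum>k<n. g (Suc k) x - g k x) + g 0 x)"
      by (intro convergent_add convergent_const) (simp add: summable_iff_convergent)
    moreover have "(\<Sum>k<n. g (Suc k) x - g k x) + g 0 x = g n x" for n
      using sum_lessThan_telescope[of "\<lambda>k. g k x" n] by simp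
    ultimately show ?case by simp
  qed
qed

text \<open>A fast subsequence converges almost everywhere to \<open>h\<close>, and Fatou's lemma
  along it carries the Cauchy bound for \<open>f m - f n\<close> over to \<open>f m - h\<close>.
  That one bound yields both the square integrability of \<open>h\<close> and the
  convergence.\<close>

lemma (in finite_measure) L2_riesz_fischer:
  fixes f :: "nat \<Rightarrow> 'a \<Rightarrow> complex"
  assumes f: "\<And>n. f n \<in> square_integrable M"
    and cauchy: "\<And>e. e > 0 \<Longrightarrow> \<exists>N. \<forall>m\<ge>N. \<forall>n\<ge>N. (\<integral>x. (cmod (f m x - f n x))\<^sup>2 \<partial>M) < e"
  shows "\<exists>h\<in>square_integrable M. (\<lambda>n. \<integral>x. (cmod (f n x - h x))\<^sup>2 \<partial>M) \<longlonglongrightarrow> 0"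
proof -
  note [measurable] = square_integrableD(1)[OF f]
  obtain N where N: "\<And>k m n. m \<ge> N k \<Longrightarrow> n \<ge> N k \<Longrightarrow> (\<integral>x. (cmod (f m x - f n x))\<^sup>2 \<partial>M) < (1/4)^k"
    using cauchy[of "(1/4)^k" for k] by (metis zero_less_power divide_pos_pos zero_less_numeral zero_less_one)
  \<comment> \<open>Partial sums make \<open>r\<close> monotone and at least \<open>N k\<close>, as
    the fast increments require; adding \<open>k\<close> forces \<open>r k\<close> to infinity, so
    that any tail condition eventually holds along \<open>r\<close>.\<close>
  define r where "r k = (\<Sum>i\<le>k. N i) + k" for k
  have rN: "N k \<le> r k" "k \<le> r k" for k
    unfolding r_def using member_le_sum[of k "{..k}" N] by auto
  have r_mono: "r k \<le> r (Suc k)" for k by (simp add: r_def)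
  have "AE x in M. convergent (\<lambda>k. f (r k) x)"
    by (rule AE_convergent_if_L2_fast)
       (use f in \<open>auto intro!: less_imp_le N rN order_trans[OF rN(1) r_mono]\<close>)
  moreover define h where "h x = lim (\<lambda>k. f (r k) x)" for x
  ultimately have lim: "AE x in M. (\<lambda>k. f (r k) x) \<longlonglongrightarrow> h x"
    by (auto elim!: eventually_mono simp: convergent_LIMSEQ_iff)
  have [measurable]: "h \<in> borel_measurable M" unfolding h_def by measurable
  have bound: "(\<integral>\<^sup>+x. ennreal ((cmod (f m x - h x))\<^sup>2) \<partial>M) \<le> ennreal e"
    if e: "\<And>n. n \<ge> K \<Longrightarrow> (\<integral>x. (cmod (f m x - f n x))\<^sup>2 \<partial>M) \<le> e" for m K e
  proof -
    have "(\<integral>\<^sup>+x. ennreal ((cmod (f m x - h x))\<^sup>2) \<partial>M)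
        = (\<integral>\<^sup>+x. liminf (\<lambda>k. ennreal ((cmod (f m x - f (r k) x))\<^sup>2)) \<partial>M)"
    proof (rule nn_integral_cong_AE)
      show "AE x in M. ennreal ((cmod (f m x - h x))\<^sup>2)
          = liminf (\<lambda>k. ennreal ((cmod (f m x - f (r k) x))\<^sup>2))"
        using lim
      proof eventually_elim
        case (elim x)
        have "(\<lambda>k. ennreal ((cmod (f m x - f (r k) x))\<^sup>2)) \<longlonglongrightarrow> ennreal ((cmod (f m x - h x))\<^sup>2)"
          by (intro tendsto_ennrealI tendsto_intros elim)
        then show ?case
          by (intro lim_imp_Liminf[symmetric]) simp_all
      qed
    qed
    also have "\<dots> \<le> liminf (\<lambda>k. \<integral>\<^sup>+x. ennreal ((cmod (f m x - f (r k) x))\<^sup>2) \<partial>M)"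
      by (rule nn_integral_liminf) measurable
    also have "\<dots> \<le> limsup (\<lambda>k. \<integral>\<^sup>+x. ennreal ((cmod (f m x - f (r k) x))\<^sup>2) \<partial>M)"
      by (intro Liminf_le_Limsup) simp
    also have "\<dots> \<le> ennreal e"
    proof (rule Limsup_bounded)
      show "\<forall>\<^sub>F k in sequentially. (\<integral>\<^sup>+x. ennreal ((cmod (f m x - f (r k) x))\<^sup>2) \<partial>M) \<le> ennreal e"
        using eventually_ge_at_top[of K]
      proof eventually_elim
        case (elim k)
        have "(\<integral>\<^sup>+x. ennreal ((cmod (f m x - f (r k) x))\<^sup>2) \<partial>M)
            = ennreal (\<integral>x. (cmod (f m x - f (r k) x))\<^sup>2 \<partial>M)"
          by (intro nn_integral_eq_integral square_integrableD(2)[OF square_integrable_diff] f) auto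
        also have "\<dots> \<le> ennreal e" using elim rN(2)[of k] by (intro ennreal_leI e) simp
        finally show ?case .
      qed
    qed
    finally show ?thesis .
  qed
  have sq: "(\<lambda>x. f m x - h x) \<in> square_integrable M"
    if "\<And>n. n \<ge> K \<Longrightarrow> (\<integral>x. (cmod (f m x - f n x))\<^sup>2 \<partial>M) \<le> e" for m K e
    unfolding square_integrable_def
    using bound[of K m e, OF that] by (auto intro!: integrableI_bounded simp: le_less_trans)
  obtain K where K: "\<And>m n. m \<ge> K \<Longrightarrow> n \<ge> K \<Longrightarrow> (\<integral>x. (cmod (f m x - f n x))\<^sup>2 \<partial>M) < 1"
    using cauchy[of 1] by auto
  have "(\<lambda>x. f K x - h x) \<in> square_integrable M"
    by (rule sq[of K _ 1]) (use K in \<open>auto intro: less_imp_le\<close>)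
  then have "h \<in> square_integrable M"
    using square_integrable_diff[OF f[of K], of "\<lambda>x. f K x - h x"] by simp
  moreover have "(\<lambda>n. \<integral>x. (cmod (f n x - h x))\<^sup>2 \<partial>M) \<longlonglongrightarrow> 0"
  proof (rule LIMSEQ_I)
    fix e :: real assume "e > 0"
    then obtain K where K: "\<And>m n. m \<ge> K \<Longrightarrow> n \<ge> K \<Longrightarrow> (\<integral>x. (cmod (f m x - f n x))\<^sup>2 \<partial>M) < e / 2"
      using cauchy[of "e / 2"] by auto
    have "(\<integral>x. (cmod (f m x - h x))\<^sup>2 \<partial>M) \<le> e / 2" if "m \<ge> K" for m
    proof -
      have le: "(\<integral>x. (cmod (f m x - f n x))\<^sup>2 \<partial>M) \<le> e / 2" if "n \<ge> K" for n
        using K[OF \<open>m \<ge> K\<close> that] by simp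
      have "ennreal (\<integral>x. (cmod (f m x - h x))\<^sup>2 \<partial>M) = (\<integral>\<^sup>+x. ennreal ((cmod (f m x - h x))\<^sup>2) \<partial>M)"
        by (intro nn_integral_eq_integral[symmetric] square_integrableD(2)[OF sq[OF le]]) auto
      also have "\<dots> \<le> ennreal (e / 2)" by (rule bound[OF le])
      finally show ?thesis using \<open>e > 0\<close> by (simp add: ennreal_le_iff)
    qed
    moreover have "norm ((\<integral>x. (cmod (f m x - h x))\<^sup>2 \<partial>M) - 0) = (\<integral>x. (cmod (f m x - h x))\<^sup>2 \<partial>M)" for m
      by simp
    ultimately have "norm ((\<integral>x. (cmod (f m x - h x))\<^sup>2 \<partial>M) - 0) < e" if "m \<ge> K" for m
      using \<open>e > 0\<close> that by fastforce
    then show "\<exists>K. \<forall>m\<ge>K. norm ((\<integral>x. (cmod (f m x - h x))\<^sup>2 \<partial>M) - 0) < e" by blast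
  qed
  ultimately show ?thesis by blast
qed

lemma (in finite_measure) hilbert_space_L2: "hilbert_space (L2 M)"
proof (intro hilbert_space.intro hilbert_space_axioms.intro complex_inner_space_L2)
  fix s assume s: "cauchy_in (L2 M) s"
  then have "s n \<in> carrier (L2 M)" for n by (auto simp: cauchy_in_def)
  then have "\<forall>n. \<exists>f. f \<in> square_integrable M \<and> s n = L2_class M f"
    by (metis L2_carrierE)
  then obtain f where f: "\<And>n. f n \<in> square_integrable M" and sf: "\<And>n. s n = L2_class M (f n)"
    by metis
  have "\<exists>N. \<forall>m\<ge>N. \<forall>n\<ge>N. (\<integral>x. (cmod (f m x - f n x))\<^sup>2 \<partial>M) < e" if "e > 0" for e :: real
  proof -
    obtain N where "\<forall>m\<ge>N. \<forall>n\<ge>N. cdist (L2 M) (s m) (s n) < sqrt e"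
      using s \<open>e > 0\<close> unfolding cauchy_in_def by (meson real_sqrt_gt_zero)
    then show ?thesis by (auto simp: sf L2_cdist f)
  qed
  then obtain h where h: "h \<in> square_integrable M" "(\<lambda>n. \<integral>x. (cmod (f n x - h x))\<^sup>2 \<partial>M) \<longlonglongrightarrow> 0"
    using L2_riesz_fischer[of f, OF f] by auto
  have "(\<lambda>n. cdist (L2 M) (s n) (L2_class M h)) \<longlonglongrightarrow> 0"
    using tendsto_real_sqrt[OF h(2)] by (simp add: sf L2_cdist f h)
  then show "\<exists>l\<in>carrier (L2 M). (\<lambda>n. cdist (L2 M) (s n) l) \<longlonglongrightarrow> 0" using h by blast
qed

section \<open>Density and separability\<close>

definition L2_dist_sq :: "'b measure \<Rightarrow> ('b \<Rightarrow> complex) \<Rightarrow> ('b \<Rightarrow> complex) \<Rightarrow> real" where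
  "L2_dist_sq M f g = (\<integral>x. (cmod (f x - g x))\<^sup>2 \<partial>M)"

lemma L2_dist_sq_le:
  assumes "integrable M w" "\<And>x. x \<in> space M \<Longrightarrow> (cmod (f x - g x))\<^sup>2 \<le> w x"
    "f \<in> square_integrable M" "g \<in> square_integrable M"
  shows "L2_dist_sq M f g \<le> (\<integral>x. w x \<partial>M)"
  unfolding L2_dist_sq_def
  using assms by (intro integral_mono square_integrableD(2)[OF square_integrable_diff]) auto

lemma L2_dist_sq_integrable:
  "f \<in> square_integrable M \<Longrightarrow> g \<in> square_integrable M \<Longrightarrow> integrable M (\<lambda>x. (cmod (f x - g x))\<^sup>2)"
  using square_integrableD(2)[OF square_integrable_diff] .

lemma L2_dist_sq_add:
  assumes "f \<in> square_integrable M" "g \<in> square_integrable M"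
    "f' \<in> square_integrable M" "g' \<in> square_integrable M"
  shows "L2_dist_sq M (\<lambda>x. f x + g x) (\<lambda>x. f' x + g' x)
    \<le> 2 * L2_dist_sq M f f' + 2 * L2_dist_sq M g g'"
proof -
  have "L2_dist_sq M (\<lambda>x. f x + g x) (\<lambda>x. f' x + g' x)
      \<le> (\<integral>x. 2 * (cmod (f x - f' x))\<^sup>2 + 2 * (cmod (g x - g' x))\<^sup>2 \<partial>M)"
  proof (rule L2_dist_sq_le)
    show "(cmod (f x + g x - (f' x + g' x)))\<^sup>2 \<le> 2 * (cmod (f x - f' x))\<^sup>2 + 2 * (cmod (g x - g' x))\<^sup>2" for x
      using cmod_add_sq_le[of "f x - f' x" "g x - g' x"] by (simp add: algebra_simps)
  qed (use assms in \<open>auto intro!: L2_dist_sq_integrable square_integrable_add\<close>)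
  also have "\<dots> = 2 * L2_dist_sq M f f' + 2 * L2_dist_sq M g g'"
    using assms by (simp add: L2_dist_sq_def L2_dist_sq_integrable)
  finally show ?thesis .
qed

lemma L2_dist_sq_triangle:
  assumes "f \<in> square_integrable M" "g \<in> square_integrable M" "h \<in> square_integrable M"
  shows "L2_dist_sq M f h \<le> 2 * L2_dist_sq M f g + 2 * L2_dist_sq M g h"
proof -
  have "L2_dist_sq M f h \<le> (\<integral>x. 2 * (cmod (f x - g x))\<^sup>2 + 2 * (cmod (g x - h x))\<^sup>2 \<partial>M)"
  proof (rule L2_dist_sq_le)
    show "(cmod (f x - h x))\<^sup>2 \<le> 2 * (cmod (f x - g x))\<^sup>2 + 2 * (cmod (g x - h x))\<^sup>2" for x
      using cmod_add_sq_le[of "f x - g x" "g x - h x"] by simp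
  qed (use assms in \<open>auto intro!: L2_dist_sq_integrable\<close>)
  also have "\<dots> = 2 * L2_dist_sq M f g + 2 * L2_dist_sq M g h"
    using assms by (simp add: L2_dist_sq_def L2_dist_sq_integrable)
  finally show ?thesis .
qed

lemma L2_dist_sq_cmult: "L2_dist_sq M (\<lambda>x. c * f x) (\<lambda>x. c * g x) = (cmod c)\<^sup>2 * L2_dist_sq M f g"
  by (simp add: L2_dist_sq_def right_diff_distrib[symmetric] norm_mult power_mult_distrib)

lemma L2_dist_sq_self [simp]: "L2_dist_sq M f f = 0"
  by (simp add: L2_dist_sq_def)

lemma L2_dist_sq_cong:
  "(\<And>x. x \<in> space M \<Longrightarrow> f x = f' x) \<Longrightarrow> (\<And>x. x \<in> space M \<Longrightarrow> g x = g' x) \<Longrightarrow>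
    L2_dist_sq M f g = L2_dist_sq M f' g'"
  unfolding L2_dist_sq_def by (intro Bochner_Integration.integral_cong) auto

lemma (in finite_measure) square_integrable_indicator:
  "A \<in> sets M \<Longrightarrow> (\<lambda>x. indicator A x) \<in> square_integrable M"
  by (rule square_integrable_bound[of _ "\<lambda>_. 1"]) (auto simp: indicator_def)

text \<open>Density is reduced to a \<open>\<inter>\<close>-stable generator: the closure of \<open>D\<close> contains the
  indicators of a Dynkin system, hence the simple functions.\<close>

lemma (in finite_measure) L2_dense_criterion:
  fixes D :: "('a \<Rightarrow> complex) set"
  assumes sets: "sets M = sigma_sets (space M) G" and G: "Int_stable G" "G \<subseteq> Pow (space M)"
    and space: "space M \<in> G"
    and D: "D \<subseteq> square_integrable M"
    and ind: "\<And>A. A \<in> G \<Longrightarrow> (\<lambda>x. indicator A x) \<in> D"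
    and add: "\<And>f g. f \<in> D \<Longrightarrow> g \<in> D \<Longrightarrow> (\<lambda>x. f x + g x) \<in> D"
    and cmult: "\<And>c f e. f \<in> D \<Longrightarrow> e > 0 \<Longrightarrow> \<exists>g\<in>D. L2_dist_sq M (\<lambda>x. c * f x) g < e"
    and f: "f \<in> square_integrable M" and e: "e > 0"
  shows "\<exists>g\<in>D. L2_dist_sq M f g < e"
proof -
  \<comment> \<open>The closure of \<open>D\<close>. Scalar multiples of elements of
    \<open>D\<close> are only assumed approximable within \<open>D\<close>, so that \<open>D\<close>
    may be a countable set with rational coefficients; \<open>V_cmult\<close> recovers exact complex
    scalars in the closure.\<close>
  define V where "V = {f \<in> square_integrable M. \<forall>e>0. \<exists>g\<in>D. L2_dist_sq M f g < e}"
  have V_sq: "f \<in> square_integrable M" if "f \<in> V" for f using that by (simp add: V_def)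
  have D_sq: "f \<in> square_integrable M" if "f \<in> D" for f using that D by auto
  have D_V: "f \<in> V" if "f \<in> D" for f
    using that D_sq unfolding V_def by (auto intro!: bexI[of _ f])
  have V_D: "\<exists>h\<in>D. L2_dist_sq M f h < e" if "f \<in> V" "e > 0" for f e
    using that unfolding V_def by blast
  have V_closed: "f \<in> V" if f: "f \<in> square_integrable M"
    and near: "\<And>e. e > 0 \<Longrightarrow> \<exists>g\<in>V. L2_dist_sq M f g < e" for f
    unfolding V_def
  proof (intro CollectI conjI allI impI f)
    fix e :: real assume "e > 0"
    then obtain g where g: "g \<in> V" "L2_dist_sq M f g < e / 4" using near[of "e / 4"] by auto
    obtain h where h: "h \<in> D" "L2_dist_sq M g h < e / 4"
      using V_D[OF g(1), of "e / 4"] \<open>e > 0\<close> by auto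
    have "L2_dist_sq M f h < e"
      using L2_dist_sq_triangle[OF f V_sq[OF g(1)] D_sq[OF h(1)]] g(2) h(2) by linarith
    then show "\<exists>h\<in>D. L2_dist_sq M f h < e" using h(1) by blast
  qed
  have V_add: "(\<lambda>x. f x + g x) \<in> V" if f: "f \<in> V" and g: "g \<in> V" for f g
    unfolding V_def
  proof (intro CollectI conjI allI impI square_integrable_add V_sq f g)
    fix e :: real assume "e > 0"
    then obtain f' g' where f': "f' \<in> D" "L2_dist_sq M f f' < e / 4"
      and g': "g' \<in> D" "L2_dist_sq M g g' < e / 4"
      using V_D[OF f, of "e / 4"] V_D[OF g, of "e / 4"] by auto
    have "L2_dist_sq M (\<lambda>x. f x + g x) (\<lambda>x. f' x + g' x) < e"
      using L2_dist_sq_add[OF V_sq[OF f] V_sq[OF g] D_sq[OF f'(1)] D_sq[OF g'(1)]] f'(2) g'(2)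
      by linarith
    then show "\<exists>h\<in>D. L2_dist_sq M (\<lambda>x. f x + g x) h < e" using add[OF f'(1) g'(1)] by blast
  qed
  have V_cmult: "(\<lambda>x. c * f x) \<in> V" if f: "f \<in> V" for c f
  proof (rule V_closed)
    fix e :: real assume e: "e > 0"
    define d where "d = e / (1 + (cmod c)\<^sup>2)"
    have c0: "1 + (cmod c)\<^sup>2 > 0" by (simp add: add_pos_nonneg)
    have "d > 0" using e c0 by (simp add: d_def)
    then obtain g where g: "g \<in> D" "L2_dist_sq M f g < d" using V_D[OF f] by blast
    have "(\<lambda>x. c * g x) \<in> V"
      using cmult[OF g(1)] square_integrable_cmult[OF D_sq[OF g(1)]] by (auto simp: V_def)
    moreover have "L2_dist_sq M (\<lambda>x. c * f x) (\<lambda>x. c * g x) < e"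
    proof -
      have "L2_dist_sq M f g \<ge> 0" by (simp add: L2_dist_sq_def)
      then have "(cmod c)\<^sup>2 * L2_dist_sq M f g \<le> (1 + (cmod c)\<^sup>2) * L2_dist_sq M f g"
        by (simp add: distrib_right)
      also have "\<dots> < (1 + (cmod c)\<^sup>2) * d" using g(2) c0 by (rule mult_strict_left_mono)
      also have "\<dots> = e" using c0 by (simp add: d_def)
      finally show ?thesis by (simp add: L2_dist_sq_cmult)
    qed
    ultimately show "\<exists>g\<in>V. L2_dist_sq M (\<lambda>x. c * f x) g < e" by blast
  qed (use square_integrable_cmult V_sq f in auto)
  have V_zero: "(\<lambda>x. 0) \<in> V"
    using V_cmult[OF D_V[OF ind[OF space]], of 0] by simp
  have V_sum: "(\<lambda>x. \<Sum>i\<in>S. F i x) \<in> V" if "finite S" "\<And>i. i \<in> S \<Longrightarrow> F i \<in> V" for S and F :: "'i \<Rightarrow> _"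
    using that by induction (auto intro: V_zero V_add)
  have V_cong: "f \<in> V" if "g \<in> V" "f \<in> square_integrable M" "\<And>x. x \<in> space M \<Longrightarrow> f x = g x" for f g
  proof (rule V_closed)
    have "L2_dist_sq M f g = L2_dist_sq M g g" using that(3) by (intro L2_dist_sq_cong) auto
    then show "\<exists>g\<in>V. L2_dist_sq M f g < e" if "e > 0" for e using \<open>g \<in> V\<close> that by (intro bexI[of _ g]) simp_all
  qed fact
  \<comment> \<open>Dominated convergence, applied below both to countable disjoint unions and to
    the approximation of \<open>f\<close> by simple functions.\<close>
  have V_lim: "f \<in> V" if "\<And>i. s i \<in> V" "\<And>x. x \<in> space M \<Longrightarrow> (\<lambda>i. s i x) \<longlonglongrightarrow> f x"
    "f \<in> square_integrable M" "integrable M w" "\<And>i x. x \<in> space M \<Longrightarrow> (cmod (f x - s i x))\<^sup>2 \<le> w x"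
    for f s w
  proof (rule V_closed)
    note [measurable] = square_integrableD(1)[OF V_sq[OF that(1)]] square_integrableD(1)[OF that(3)]
    have "(\<lambda>i. L2_dist_sq M f (s i)) \<longlonglongrightarrow> (\<integral>x. 0 \<partial>M)"
      unfolding L2_dist_sq_def
    proof (rule integral_dominated_convergence[where w = w])
      show "AE x in M. (\<lambda>i. (cmod (f x - s i x))\<^sup>2) \<longlonglongrightarrow> 0"
        using that(2) by (intro AE_I2) (auto intro!: tendsto_eq_intros)
    qed (use that in auto)
    then have "(\<lambda>i. L2_dist_sq M f (s i)) \<longlonglongrightarrow> 0" by simp
    then show "\<exists>g\<in>V. L2_dist_sq M f g < e" if "e > 0" for e
      using order_tendstoD(2)[OF _ that] \<open>\<And>i. s i \<in> V\<close> by (metis eventually_happens sequentially_bot)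
  qed fact
  have V_indicator: "(\<lambda>x. indicator A x) \<in> V" if "A \<in> sets M" for A
    using G that unfolding sets
  proof (induction rule: sigma_sets_induct_disjoint)
    case (basic A) then show ?case by (intro D_V ind)
  next
    case empty show ?case using V_zero by simp
  next
    case (compl A)
    have "(\<lambda>x. indicator (space M) x + (-1) * indicator A x) \<in> V"
      by (intro V_add V_cmult D_V ind space compl)
    then show ?case
    proof (rule V_cong)
      show "(\<lambda>x. indicator (space M - A) x) \<in> square_integrable M"
        using compl(1) by (intro square_integrable_indicator) (simp add: sets[symmetric])
    qed (auto simp: indicator_def)
  next
    case (union A)
    have A: "A i \<in> sets M" for i using union(2) by (auto simp: sets)
    show ?case
    proof (rule V_lim[of "\<lambda>n x. \<Sum>i<n. indicator (A i) x" _ "\<lambda>_. 1"])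
      show "(\<lambda>x. \<Sum>i<n. indicator (A i) x) \<in> V" for n using union(3) by (intro V_sum) auto
      \<comment> \<open>Disjointness keeps the partial sums in {0, 1}, which is why the constant 1
        dominates the squared error.\<close>
      have eq: "(\<Sum>i<n. indicator (A i) x) = indicator (\<Union>i<n. A i) x" for n x
        using union(1) by (intro indicator_UN_disjoint[symmetric])
          (auto simp: disjoint_family_on_def)
      show "(\<lambda>n. \<Sum>i<n. indicator (A i) x) \<longlonglongrightarrow> indicator (\<Union>i. A i) x" for x
        unfolding eq by (rule LIMSEQ_indicator_UN)
      show "(\<lambda>x. indicator (\<Union>i. A i) x) \<in> square_integrable M"
        using A by (intro square_integrable_indicator) auto
      show "(cmod (indicator (\<Union>i. A i) x - (\<Sum>i<n. indicator (A i) x)))\<^sup>2 \<le> 1" for n x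
        unfolding eq by (auto simp: indicator_def)
    qed simp
  qed
  have V_simple: "s \<in> V" if s: "simple_function M s" for s :: "'a \<Rightarrow> complex"
  proof (rule V_cong)
    have meas: "s -` {y} \<inter> space M \<in> sets M" for y
      using s by (rule simple_functionD)
    have fin: "finite (s ` space M)" using s by (rule simple_functionD)
    show "(\<lambda>x. \<Sum>y\<in>s ` space M. y * indicator (s -` {y} \<inter> space M) x) \<in> V"
      using fin meas by (intro V_sum V_cmult V_indicator)
    show eq: "s x = (\<Sum>y\<in>s ` space M. y * indicator (s -` {y} \<inter> space M) x)" if "x \<in> space M" for x
    proof -
      have "(\<Sum>y\<in>s ` space M. y * indicator (s -` {y} \<inter> space M) x)
          = (\<Sum>y\<in>s ` space M. if y = s x then y else 0)"
        using that by (intro sum.cong) (auto simp: indicator_def)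
      then show ?thesis using fin that by simp
    qed
    obtain B where "\<And>y. y \<in> s ` space M \<Longrightarrow> cmod y \<le> B"
      using finite_imp_bounded[OF fin] by (auto simp: bounded_iff)
    then have "AE x in M. (cmod (s x))\<^sup>2 \<le> B\<^sup>2"
      by (intro AE_I2 power_mono) auto
    then show "s \<in> square_integrable M"
      using s by (intro square_integrable_bound[of _ "\<lambda>_. B\<^sup>2"])
        (auto intro: borel_measurable_simple_function)
  qed
  have "f \<in> V"
  proof -
    note fm [measurable] = square_integrableD(1)[OF f]
    obtain s where s: "\<And>i. simple_function M (s i)"
      "\<And>x. x \<in> space M \<Longrightarrow> (\<lambda>i. s i x) \<longlonglongrightarrow> f x"
      "\<And>i x. x \<in> space M \<Longrightarrow> cmod (s i x) \<le> 2 * cmod (f x)"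
      using borel_measurable_implies_sequence_metric[OF fm, of 0] unfolding norm_conv_dist by metis
    \<comment> \<open>The simple approximants satisfy |s| <= 2 |f|, so the error is at most 3 |f|;
      squaring gives the 9.\<close>
    show ?thesis
    proof (rule V_lim[of s f "\<lambda>x. 9 * (cmod (f x))\<^sup>2"])
      fix i x assume x: "x \<in> space M"
      have "cmod (f x - s i x) \<le> 3 * cmod (f x)"
        using norm_triangle_ineq4[of "f x" "s i x"] s(3)[OF x, of i] by linarith
      then have "(cmod (f x - s i x))\<^sup>2 \<le> (3 * cmod (f x))\<^sup>2" by (intro power_mono) auto
      then show "(cmod (f x - s i x))\<^sup>2 \<le> 9 * (cmod (f x))\<^sup>2" by (simp add: power_mult_distrib)
    qed (use s f V_simple square_integrableD(2)[OF f] in auto)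
  qed
  then show ?thesis using e by (auto simp: V_def)
qed

text \<open>A countable basis need not be closed under intersection, as the density criterion
  demands. Its finite intersections are, they remain countable, and the empty intersection
  contributes the whole space.\<close>

lemma countable_Int_stable_borel_generator:
  obtains G :: "'a::second_countable_topology set set" where "countable G" "Int_stable G"
    "UNIV \<in> G" "sets borel = sigma_sets UNIV G"
proof -
  obtain B :: "'a set set" where B: "countable B" "topological_basis B"
    using ex_countable_basis by auto
  define G where "G = Inter ` {F. finite F \<and> F \<subseteq> B}"
  have "countable G" unfolding G_def using B by (intro countable_image countable_Collect_finite_subset)
  moreover have "Int_stable G"
  proof (rule Int_stableI)
    fix a b assume "a \<in> G" "b \<in> G"
    then obtain E F where "finite E" "E \<subseteq> B" "a = \<Inter>E" "finite F" "F \<subseteq> B" "b = \<Inter>F"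
      by (auto simp: G_def)
    then show "a \<inter> b \<in> G" unfolding G_def by (intro image_eqI[of _ _ "E \<union> F"]) auto
  qed
  moreover have "UNIV \<in> G" unfolding G_def by (intro image_eqI[of _ _ "{}"]) auto
  moreover have "sets borel = sigma_sets UNIV G"
  proof -
    have "sets (borel :: 'a measure) = sigma_sets UNIV B"
      by (subst borel_eq_countable_basis[OF B]) simp
    also have "\<dots> = sigma_sets UNIV G"
    proof (rule sigma_sets_eqI)
      show "b \<in> sigma_sets UNIV G" if "b \<in> B" for b
        unfolding G_def using that by (intro sigma_sets.Basic image_eqI[of _ _ "{b}"]) auto
      have "open (\<Inter>F)" if "finite F" "F \<subseteq> B" for F
        using that topological_basis_open[OF B(2)] by (intro open_Inter) auto
      then have "G \<subseteq> sets borel" unfolding G_def by (auto intro: borel_open)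
      then show "a \<in> sigma_sets UNIV B" if "a \<in> G" for a
        using that \<open>sets (borel :: 'a measure) = sigma_sets UNIV B\<close> by auto
    qed
    finally show ?thesis .
  qed
  ultimately show thesis by (rule that)
qed

definition rational_complex :: "complex set" where
  "rational_complex = (\<lambda>(a, b). Complex a b) ` (\<rat> \<times> \<rat>)"

lemma countable_rational_complex: "countable rational_complex"
  unfolding rational_complex_def by (intro countable_image countable_SIGMA countable_rat)

lemma rational_complex_iff: "z \<in> rational_complex \<longleftrightarrow> Re z \<in> \<rat> \<and> Im z \<in> \<rat>"
  unfolding rational_complex_def by (force simp: complex_eq_iff image_iff)

lemma rational_complex_dense:
  assumes "e > 0" obtains q where "q \<in> rational_complex" "cmod (c - q) < e"
proof -
  obtain a where a: "a \<in> \<rat>" "Re c - e / 2 < a" "a < Re c + e / 2"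
    using Rats_dense_in_real[of "Re c - e / 2" "Re c + e / 2"] assms by auto
  obtain b where b: "b \<in> \<rat>" "Im c - e / 2 < b" "b < Im c + e / 2"
    using Rats_dense_in_real[of "Im c - e / 2" "Im c + e / 2"] assms by auto
  have "cmod (c - Complex a b) \<le> \<bar>Re c - a\<bar> + \<bar>Im c - b\<bar>"
    using cmod_le[of "c - Complex a b"] by simp
  also have "\<dots> < e" using a b by (auto simp: abs_if)
  finally show thesis using a b by (intro that[of "Complex a b"]) (auto simp: rational_complex_iff)
qed

text \<open>Rational combinations of indicators from a countable generator are countable in number
  and satisfy the density criterion.\<close>

lemma separable_L2:
  fixes M :: "'a::second_countable_topology measure"
  assumes "finite_measure M" and sets: "sets M = sets borel"
  shows "separable (L2 M)"
proof -
  interpret finite_measure M by fact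
  obtain G :: "'a set set" where G: "countable G" "Int_stable G" "UNIV \<in> G"
    and G_sets: "sets borel = sigma_sets UNIV G"
    by (rule countable_Int_stable_borel_generator)
  have sp: "space M = UNIV" using sets_eq_imp_space_eq[OF sets] by simp
  \<comment> \<open>Coding combinations as lists makes addition a concatenation and rational scaling
    a \<open>map\<close>, and yields countability at once.\<close>
  define step where "step l x = (\<Sum>(q, A)\<leftarrow>l. q * indicator A x)"
    for l :: "(complex \<times> 'a set) list" and x :: 'a
  define D where "D = step ` lists (rational_complex \<times> G)"
  have sq: "step l \<in> square_integrable M" if "l \<in> lists (rational_complex \<times> G)" for l
    using that
  proof induction
    case Nil show ?case by (simp add: step_def[abs_def] square_integrable_zero)
  next
    case (Cons p l)
    obtain q A where p: "p = (q, A)" "A \<in> G" using Cons by (cases p) auto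
    have "A \<in> sets M" using p(2) by (simp add: sets G_sets)
    then have "(\<lambda>x. q * indicator A x + step l x) \<in> square_integrable M"
      by (intro square_integrable_add square_integrable_cmult square_integrable_indicator Cons)
    then show ?case by (simp add: step_def[abs_def] p)
  qed
  have "countable D"
    unfolding D_def using G countable_rational_complex by (intro countable_image countable_lists countable_SIGMA)
  have dense: "\<exists>g\<in>D. L2_dist_sq M f g < e" if "f \<in> square_integrable M" "e > 0" for f e
  proof (rule L2_dense_criterion[where G = G])
    show "sets M = sigma_sets (space M) G" by (simp add: sets sp G_sets)
    show "(\<lambda>x. indicator A x) \<in> D" if "A \<in> G" for A
      unfolding D_def using that
      by (intro image_eqI[of _ _ "[(1, A)]"]) (auto simp: step_def[abs_def] rational_complex_iff)
    show "(\<lambda>x. f x + g x) \<in> D" if "f \<in> D" "g \<in> D" for f g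
    proof -
      from that obtain k l where "k \<in> lists (rational_complex \<times> G)"
        "l \<in> lists (rational_complex \<times> G)" "f = step k" "g = step l"
        unfolding D_def by blast
      then show ?thesis
        unfolding D_def by (intro image_eqI[of _ _ "k @ l"]) (auto simp: step_def[abs_def])
    qed
    show "\<exists>g\<in>D. L2_dist_sq M (\<lambda>x. c * f x) g < e" if fD: "f \<in> D" and e: "e > 0" for c f e
    proof -
      obtain l where l: "l \<in> lists (rational_complex \<times> G)" "f = step l"
        using fD unfolding D_def by blast
      define N where "N = (\<integral>x. (cmod (f x))\<^sup>2 \<partial>M)"
      have N: "N \<ge> 0" by (simp add: N_def)
      \<comment> \<open>Replacing \<open>c\<close> by \<open>q\<close> costs |c - q|^2 times
        \<open>N\<close>, so \<open>d\<close> is chosen with d^2 (1 + N) = e; the 1 covers the case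
        \<open>N = 0\<close>.\<close>
      define d where "d = sqrt (e / (1 + N))"
      have "d > 0" using e N by (simp add: d_def)
      then obtain q where q: "q \<in> rational_complex" "cmod (c - q) < d"
        by (rule rational_complex_dense)
      have "(\<lambda>x. q * f x) \<in> D"
        unfolding D_def
      proof (rule image_eqI)
        show "map (\<lambda>(p, A). (q * p, A)) l \<in> lists (rational_complex \<times> G)"
          using l(1) q(1) by (auto simp: rational_complex_iff in_lists_conv_set)
        show "(\<lambda>x. q * f x) = step (map (\<lambda>(p, A). (q * p, A)) l)"
          unfolding l(2) step_def
          by (induction l) (auto simp: fun_eq_iff algebra_simps)
      qed
      moreover have "L2_dist_sq M (\<lambda>x. c * f x) (\<lambda>x. q * f x) = (cmod (c - q))\<^sup>2 * N"
        by (simp add: L2_dist_sq_def N_def left_diff_distrib[symmetric] norm_mult power_mult_distrib)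
      moreover have "(cmod (c - q))\<^sup>2 * N < e"
      proof -
        have "(cmod (c - q))\<^sup>2 * N \<le> (cmod (c - q))\<^sup>2 * (1 + N)" by (intro mult_left_mono) auto
        also have "\<dots> < d\<^sup>2 * (1 + N)"
          using q(2) N by (intro mult_strict_right_mono power_strict_mono) auto
        also have "\<dots> = e" using e N by (simp add: d_def)
        finally show ?thesis .
      qed
      ultimately show ?thesis by metis
    qed
  qed (use G sq that in \<open>auto simp: sp D_def\<close>)
  show ?thesis
    unfolding separable_def
  proof (intro exI[of _ "L2_class M ` D"] conjI ballI allI impI)
    fix X and e :: real assume "X \<in> carrier (L2 M)" and e: "e > 0"
    then obtain f where f: "f \<in> square_integrable M" "X = L2_class M f" by (metis L2_carrierE)
    obtain g where g: "g \<in> D" "L2_dist_sq M f g < e\<^sup>2" using dense[OF f(1), of "e\<^sup>2"] e by auto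
    have "g \<in> square_integrable M" using g(1) sq unfolding D_def by blast
    then have "cdist (L2 M) X (L2_class M g) = sqrt (L2_dist_sq M f g)"
      using f by (simp add: L2_cdist L2_dist_sq_def)
    also have "\<dots> < e" using real_sqrt_less_mono[OF g(2)] e by simp
    finally have "cdist (L2 M) X (L2_class M g) < e" .
    then show "\<exists>d\<in>L2_class M ` D. cdist (L2 M) X d < e" using g by blast
  qed (use \<open>countable D\<close> sq in \<open>auto simp: D_def\<close>)
qed

section \<open>Multiplication by unimodular functions\<close>

definition mult_op :: "'b measure \<Rightarrow> ('b \<Rightarrow> complex) \<Rightarrow> ('b \<Rightarrow> complex) set \<Rightarrow> ('b \<Rightarrow> complex) set" where
  "mult_op M g X = (\<Union>f\<in>X. L2_class M (\<lambda>x. g x * f x))"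

lemma mult_by_z_eq: "mult_by_z = mult_op circle_measure (\<lambda>z. z)"
  by (simp add: fun_eq_iff mult_by_z_def mult_op_def L2_class_def)

text \<open>The modulus is prescribed almost everywhere only, because \<open>factor_law\<close> is a
  measure on the whole plane that is merely concentrated on the circle.\<close>

locale unimodular =
  fixes M :: "'b measure" and g :: "'b \<Rightarrow> complex"
  assumes g_measurable [measurable]: "g \<in> borel_measurable M"
    and g_cmod: "AE x in M. cmod (g x) = 1"
begin

lemma mult_sq: "f \<in> square_integrable M \<Longrightarrow> (\<lambda>x. g x * f x) \<in> square_integrable M"
proof -
  assume f: "f \<in> square_integrable M"
  note [measurable] = square_integrableD(1)[OF f]
  show ?thesis
    by (rule square_integrable_bound[OF square_integrableD(2)[OF f]])
       (use g_cmod in \<open>auto elim!: eventually_mono simp: norm_mult\<close>)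
qed

lemma mult_op_class:
  assumes f: "f \<in> square_integrable M"
  shows "mult_op M g (L2_class M f) = L2_class M (\<lambda>x. g x * f x)"
  unfolding mult_op_def
proof (intro UN_constant_eq[OF L2_class_self[OF f]] ballI)
  fix f' assume f': "f' \<in> L2_class M f"
  then have "AE x in M. f x = f' x" by (simp add: mem_L2_class)
  then have "AE x in M. g x * f' x = g x * f x" by eventually_elim simp
  then show "L2_class M (\<lambda>x. g x * f' x) = L2_class M (\<lambda>x. g x * f x)"
    using f' by (subst L2_class_eq_iff) (auto simp: mem_L2_class intro!: mult_sq)
qed

lemma unitary_mult_op: "unitary_operator (L2 M) (mult_op M g)"
  unfolding unitary_map_def
proof (intro conjI ballI)
  show lin: "linear_map (L2 M) (L2 M) (mult_op M g)"
    unfolding linear_map_def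
  proof (intro conjI ballI allI)
    show "mult_op M g \<in> carrier (L2 M) \<rightarrow> carrier (L2 M)"
      by (rule Pi_I, elim L2_carrierE) (simp add: mult_op_class mult_sq)
  next
    fix X Y assume "X \<in> carrier (L2 M)" "Y \<in> carrier (L2 M)"
    then obtain f h where fh: "f \<in> square_integrable M" "h \<in> square_integrable M"
      and XY: "X = L2_class M f" "Y = L2_class M h" by (metis L2_carrierE)
    show "mult_op M g (X \<oplus>\<^bsub>L2 M\<^esub> Y) = mult_op M g X \<oplus>\<^bsub>L2 M\<^esub> mult_op M g Y"
      unfolding XY L2_add[OF fh] mult_op_class[OF fh(1)] mult_op_class[OF fh(2)]
        mult_op_class[OF square_integrable_add[OF fh]] L2_add[OF mult_sq[OF fh(1)] mult_sq[OF fh(2)]]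
      by (simp add: distrib_left)
  next
    fix a X assume "X \<in> carrier (L2 M)"
    then obtain f where f: "f \<in> square_integrable M" "X = L2_class M f" by (rule L2_carrierE)
    have eq: "(\<lambda>x. g x * (a * f x)) = (\<lambda>x. a * (g x * f x))" by (intro ext) simp
    show "mult_op M g (a \<odot>\<^bsub>L2 M\<^esub> X) = a \<odot>\<^bsub>L2 M\<^esub> mult_op M g X"
      unfolding f(2) L2_smult[OF f(1)] mult_op_class[OF f(1)]
        mult_op_class[OF square_integrable_cmult[OF f(1)]] L2_smult[OF mult_sq[OF f(1)]] eq ..
  qed
  show iso: "cinner (L2 M) (mult_op M g X) (mult_op M g Y) = cinner (L2 M) X Y"
    if "X \<in> carrier (L2 M)" "Y \<in> carrier (L2 M)" for X Y
  proof -
    from that obtain f h where fh: "f \<in> square_integrable M" "X = L2_class M f"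
      "h \<in> square_integrable M" "Y = L2_class M h" by (metis L2_carrierE)
    note [measurable] = square_integrableD(1)[OF fh(1)] square_integrableD(1)[OF fh(3)]
    have "(\<integral>x. g x * f x * cnj (g x * h x) \<partial>M) = (\<integral>x. f x * cnj (h x) \<partial>M)"
    proof (rule integral_cong_AE)
      show "AE x in M. g x * f x * cnj (g x * h x) = f x * cnj (h x)"
        using g_cmod
      proof eventually_elim
        case (elim x)
        have "g x * f x * cnj (g x * h x) = (g x * cnj (g x)) * (f x * cnj (h x))" by simp
        then show ?case using elim by (simp add: complex_norm_square[symmetric])
      qed
    qed measurable
    then show ?thesis using fh by (simp add: mult_op_class L2_cinner mult_sq)
  qed
  interpret complex_inner_space "L2 M" by (rule complex_inner_space_L2)
  have "inj_on (mult_op M g) (carrier (L2 M))"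
  proof (rule inj_onI)
    fix X Y assume X: "X \<in> carrier (L2 M)" and Y: "Y \<in> carrier (L2 M)"
      and eq: "mult_op M g X = mult_op M g Y"
    \<comment> \<open>Expanding the square leaves the four mutual inner products of \<open>X\<close>
      and \<open>Y\<close>. All four agree, since each equals that of the common image.\<close>
    have "cinner (L2 M) (X \<ominus>\<^bsub>L2 M\<^esub> Y) (X \<ominus>\<^bsub>L2 M\<^esub> Y) = 0"
      using X Y iso[of X X] iso[of X Y] iso[of Y X] iso[of Y Y] eq
      by (simp add: cinner_diff_left cinner_diff_right)
    then have "cdist (L2 M) X Y = 0" by (simp add: cdist_def cnorm_def)
    then show "X = Y" using cdist_eq_0 X Y by blast
  qed
  moreover have "X \<in> mult_op M g ` carrier (L2 M)" if "X \<in> carrier (L2 M)" for X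
  proof -
    obtain f where f: "f \<in> square_integrable M" "X = L2_class M f" using \<open>X \<in> _\<close> by (rule L2_carrierE)
    note [measurable] = square_integrableD(1)[OF f(1)]
    \<comment> \<open>The preimage of \<open>f\<close> comes from multiplication by the conjugate,
      which is the inverse of \<open>g\<close> wherever the modulus is 1.\<close>
    have f': "(\<lambda>x. cnj (g x) * f x) \<in> square_integrable M"
      by (rule square_integrable_bound[OF square_integrableD(2)[OF f(1)]])
         (use g_cmod in \<open>auto elim!: eventually_mono simp: norm_mult\<close>)
    have "AE x in M. g x * (cnj (g x) * f x) = f x"
      using g_cmod by eventually_elim (simp add: mult.assoc[symmetric] complex_norm_square[symmetric])
    then have "mult_op M g (L2_class M (\<lambda>x. cnj (g x) * f x)) = X"
      using f f' mult_sq[OF f'] by (simp add: mult_op_class L2_class_eq_iff)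
    then show ?thesis using f' by blast
  qed
  moreover have "mult_op M g \<in> carrier (L2 M) \<rightarrow> carrier (L2 M)" using lin by (simp add: linear_map_def)
  ultimately show "bij_betw (mult_op M g) (carrier (L2 M)) (carrier (L2 M))"
    unfolding bij_betw_def by auto
qed

lemma mult_op_funpow:
  assumes f: "f \<in> square_integrable M"
  shows "(\<lambda>x. g x ^ k * f x) \<in> square_integrable M"
    and "(mult_op M g ^^ k) (L2_class M f) = L2_class M (\<lambda>x. g x ^ k * f x)"
proof -
  show sq: "(\<lambda>x. g x ^ k * f x) \<in> square_integrable M" for k
  proof (induction k)
    case (Suc k)
    then show ?case using mult_sq[OF Suc] by (simp add: mult.assoc)
  qed (use f in simp)
  show "(mult_op M g ^^ k) (L2_class M f) = L2_class M (\<lambda>x. g x ^ k * f x)"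
    by (induction k) (simp_all add: mult_op_class sq mult.assoc)
qed

end

section \<open>Binary digits on the circle\<close>

abbreviation angle :: "real \<Rightarrow> complex" where
  "angle t \<equiv> cis (2 * pi * t)"

lemma angle_measurable [measurable]: "angle \<in> borel_measurable borel"
  by (intro borel_measurable_continuous_onI continuous_intros)

lemma angle_add_int: "angle (t + of_int k) = angle t"
proof -
  have "angle (t + of_int k) = angle t * cis (2 * pi * of_int k)"
    by (subst cis_mult) (simp add: distrib_left)
  also have "cis (2 * pi * of_int k) = 1"
    by (rule cis_multiple_2pi) auto
  finally show ?thesis by simp
qed

lemma angle_power: "angle t ^ k = angle (real k * t)"
  using Complex.DeMoivre[of "2 * pi * t" k] by (simp add: mult_ac)

lemma angle_range:
  assumes "cmod z = 1"
  obtains t where "0 \<le> t" "t < 1" "z = angle t"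
proof
  show "0 \<le> Arg2pi z / (2 * pi)" "Arg2pi z / (2 * pi) < 1"
    using Arg2pi_ge_0[of z] Arg2pi_lt_2pi[of z] by simp_all
  show "z = angle (Arg2pi z / (2 * pi))"
    using Arg2pi_eq[of z] assms by (simp add: cis_conv_exp mult.commute)
qed

lemma angle_in_restrict: "angle \<in> restrict_space lborel {0..<1} \<rightarrow>\<^sub>M restrict_space borel (sphere 0 1)"
  by (rule measurable_restrict_space2) (auto intro!: measurable_restrict_space1)

lemma sets_circle_measure [measurable_cong]: "sets circle_measure = sets (restrict_space borel (sphere 0 1))"
  by (simp add: circle_measure_def)

lemma space_circle_measure [simp]: "space circle_measure = sphere 0 1"
  by (simp add: circle_measure_def space_restrict_space)

lemma measurable_circle_measure: "f \<in> borel_measurable borel \<Longrightarrow> f \<in> borel_measurable circle_measure"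
  using measurable_restrict_space1 measurable_cong_sets[OF sets_circle_measure refl] by blast

lemma prob_space_circle_measure: "prob_space circle_measure"
  unfolding circle_measure_def
proof (rule prob_space.prob_space_distr[OF _ angle_in_restrict])
  show "prob_space (restrict_space lborel {0..<1 :: real})"
    by (rule prob_spaceI) (simp add: space_restrict_space emeasure_restrict_space)
qed

interpretation circle: prob_space circle_measure
  by (rule prob_space_circle_measure)

lemma measure_circle:
  assumes "A \<in> sets borel"
  shows "A \<inter> sphere 0 1 \<in> sets circle_measure"
    and "measure circle_measure (A \<inter> sphere 0 1) = measure lborel {t \<in> {0..<1}. angle t \<in> A}"
proof -
  show A: "A \<inter> sphere 0 1 \<in> sets circle_measure"
    using assms by (auto simp: sets_circle_measure sets_restrict_space)
  have "measure circle_measure (A \<inter> sphere 0 1)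
      = measure (restrict_space lborel {0..<1}) (angle -` (A \<inter> sphere 0 1) \<inter> space (restrict_space lborel {0..<1}))"
    using A unfolding circle_measure_def sets_distr
    by (rule measure_distr[OF angle_in_restrict])
  also have "\<dots> = measure lborel (angle -` (A \<inter> sphere 0 1) \<inter> space (restrict_space lborel {0..<1}))"
    by (rule measure_restrict_space) (auto simp: space_restrict_space)
  also have "angle -` (A \<inter> sphere 0 1) \<inter> space (restrict_space lborel {0..<1}) = {t \<in> {0..<1}. angle t \<in> A}"
    by (auto simp: space_restrict_space)
  finally show "measure circle_measure (A \<inter> sphere 0 1) = measure lborel {t \<in> {0..<1}. angle t \<in> A}" .
qed

text \<open>The leading binary digit of \<open>t\<close>, read off from \<open>z = angle t\<close>; the \<open>i\<close>-th digit
  is the leading digit after \<open>i\<close> doublings of the angle.\<close>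

definition bit0 :: "complex \<Rightarrow> real" where
  "bit0 z = (if 0 < Im z \<or> z = 1 then 0 else 1)"

definition digit :: "nat \<Rightarrow> complex \<Rightarrow> real" where
  "digit i z = bit0 (z ^ (2 ^ i))"

lemma bit0_measurable [measurable]: "bit0 \<in> borel_measurable borel"
  unfolding bit0_def by measurable

lemma digit_measurable [measurable]: "digit i \<in> borel_measurable borel"
  unfolding digit_def by measurable

lemma bit0_cases: "bit0 z = 0 \<or> bit0 z = 1"
  by (simp add: bit0_def)

lemma digit_0: "digit 0 z = bit0 z"
  by (simp add: digit_def)

text \<open>Squaring doubles the angle and thus shifts the digit sequence by one place; this drives
  the induction in \<open>measure_bits\<close>.\<close>

lemma digit_Suc: "digit (Suc i) z = digit i (z\<^sup>2)"
  by (simp add: digit_def power_mult[symmetric])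

text \<open>The two real points of the circle are assigned separately, 1 to digit 0 and -1 to digit
  1, so that the half-open description holds without exceptional points.\<close>

lemma bit0_angle:
  assumes "0 \<le> s" "s < 1"
  shows "bit0 (angle s) = (if s < 1 / 2 then 0 else 1)"
proof -
  consider "s = 0" | "0 < s" "s < 1 / 2" | "s = 1 / 2" | "1 / 2 < s" using assms by linarith
  then show ?thesis
  proof cases
    case 1 then show ?thesis by (simp add: bit0_def)
  next
    case 2
    then have "0 < sin (2 * pi * s)" by (intro sin_gt_zero) auto
    then show ?thesis using 2 by (simp add: bit0_def)
  next
    case 3
    then have "2 * pi * s = pi" by simp
    then have "angle s = - 1" by (simp only: cis_pi)
    then have "bit0 (angle s) = bit0 (- 1)" by (simp only:)
    moreover have "bit0 (- 1) = 1" by (simp add: bit0_def)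
    ultimately show ?thesis using 3 by (simp only:) simp
  next
    case 4
    then have "pi < 2 * pi * s" "2 * pi * s < 2 * pi" using assms by auto
    then have "sin (2 * pi * s) < 0" by (intro sin_lt_zero) auto
    moreover from this have "angle s \<noteq> 1" by (auto simp: complex_eq_iff)
    ultimately show ?thesis using 4 by (simp add: bit0_def)
  qed
qed

section \<open>The digits are independent fair bits\<close>

lemma measure_lborel_double:
  fixes b :: real
  assumes "S \<in> sets borel"
  shows "measure lborel {t. 2 * t - b \<in> S} = measure lborel S / 2"
proof -
  have "emeasure lborel S = emeasure (density (distr lborel borel (\<lambda>x. - b + 2 * x)) (\<lambda>_. ennreal \<bar>2\<bar>)) S"
    using lborel_real_affine[of 2 "- b"] by simp
  also have "\<dots> = 2 * emeasure (distr lborel borel (\<lambda>x. - b + 2 * x)) S"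
    using assms by (simp add: emeasure_density nn_integral_cmult)
  also have "emeasure (distr lborel borel (\<lambda>x. - b + 2 * x)) S = emeasure lborel ((\<lambda>x. - b + 2 * x) -` S)"
    using assms by (subst emeasure_distr) auto
  also have "(\<lambda>x. - b + 2 * x) -` S = {t. 2 * t - b \<in> S}" by (auto simp: algebra_simps)
  finally show ?thesis by (simp add: measure_def enn2real_mult)
qed

text \<open>Fixing the leading digit selects one of the two branches of the doubling map. On it the
  map is affine with slope 2, so pulling back halves the measure: the leading digit is fair and
  independent of the squared point.\<close>

lemma measure_bit0_square:
  assumes b: "b = 0 \<or> b = 1" and B: "B \<in> sets borel"
  shows "measure circle_measure ({z. bit0 z = b \<and> z\<^sup>2 \<in> B} \<inter> sphere 0 1)
    = measure circle_measure (B \<inter> sphere 0 1) / 2"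
proof -
  note [measurable] = B
  have "{z. bit0 z = b \<and> z\<^sup>2 \<in> B} \<in> sets borel" by measurable
  then have "measure circle_measure ({z. bit0 z = b \<and> z\<^sup>2 \<in> B} \<inter> sphere 0 1)
      = measure lborel {t \<in> {0..<1}. angle t \<in> {z. bit0 z = b \<and> z\<^sup>2 \<in> B}}"
    by (rule measure_circle)
  also have "{t \<in> {0..<1}. angle t \<in> {z. bit0 z = b \<and> z\<^sup>2 \<in> B}}
      = {t. 2 * t - b \<in> {s \<in> {0..<1}. angle s \<in> B}}"
  proof (intro Set.set_eqI)
    fix t :: real
    have sq: "(angle t)\<^sup>2 = angle (2 * t - b)"
      using angle_add_int[of "2 * t" "- 1"] b by (auto simp: angle_power)
    have iff: "0 \<le> t \<and> t < 1 \<and> bit0 (angle t) = b \<longleftrightarrow> 0 \<le> 2 * t - b \<and> 2 * t - b < 1"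
    proof (cases "0 \<le> t \<and> t < 1")
      case True
      then have "bit0 (angle t) = (if t < 1 / 2 then 0 else 1)" by (simp add: bit0_angle)
      then show ?thesis using b True by (cases "t < 1 / 2") auto
    next
      case False then show ?thesis using b by auto
    qed
    have "t \<in> {t \<in> {0..<1}. angle t \<in> {z. bit0 z = b \<and> z\<^sup>2 \<in> B}} \<longleftrightarrow>
        (0 \<le> t \<and> t < 1 \<and> bit0 (angle t) = b) \<and> (angle t)\<^sup>2 \<in> B"
      by auto
    also have "\<dots> \<longleftrightarrow> t \<in> {t. 2 * t - b \<in> {s \<in> {0..<1}. angle s \<in> B}}"
      unfolding iff sq by simp
    finally show "t \<in> {t \<in> {0..<1}. angle t \<in> {z. bit0 z = b \<and> z\<^sup>2 \<in> B}} \<longleftrightarrow>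
        t \<in> {t. 2 * t - b \<in> {s \<in> {0..<1}. angle s \<in> B}}" .
  qed
  also have "measure lborel \<dots> = measure lborel {s \<in> {0..<1}. angle s \<in> B} / 2"
    by (rule measure_lborel_double) measurable
  also have "measure lborel {s \<in> {0..<1}. angle s \<in> B} = measure circle_measure (B \<inter> sphere 0 1)"
    by (rule measure_circle(2)[symmetric]) fact
  finally show ?thesis .
qed

definition coin_weight :: "real set \<Rightarrow> real" where
  "coin_weight A = (indicator A 0 + indicator A 1) / 2"

lemma measure_bit0_square_set:
  assumes A: "A \<in> sets borel" and B: "B \<in> sets borel"
  shows "measure circle_measure ({z. bit0 z \<in> A \<and> z\<^sup>2 \<in> B} \<inter> sphere 0 1)
    = coin_weight A * measure circle_measure (B \<inter> sphere 0 1)"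
proof -
  note [measurable] = B
  define E where "E b = {z. bit0 z = b \<and> z\<^sup>2 \<in> B} \<inter> sphere 0 1" for b
  have "{z. bit0 z = b \<and> z\<^sup>2 \<in> B} \<in> sets borel" for b by measurable
  then have E [measurable]: "E b \<in> sets circle_measure" for b
    unfolding E_def by (rule measure_circle)
  have "{z. bit0 z \<in> A \<and> z\<^sup>2 \<in> B} \<inter> sphere 0 1 = (if 0 \<in> A then E 0 else {}) \<union> (if 1 \<in> A then E 1 else {})"
  proof (intro Set.set_eqI)
    fix z
    show "z \<in> {z. bit0 z \<in> A \<and> z\<^sup>2 \<in> B} \<inter> sphere 0 1 \<longleftrightarrow>
        z \<in> (if 0 \<in> A then E 0 else {}) \<union> (if 1 \<in> A then E 1 else {})"
      using bit0_cases[of z] by (auto simp: E_def)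
  qed
  also have "measure circle_measure \<dots>
      = measure circle_measure (if 0 \<in> A then E 0 else {}) + measure circle_measure (if 1 \<in> A then E 1 else {})"
    by (rule circle.finite_measure_Union) (auto simp: E_def[abs_def] split: if_splits intro: E[unfolded E_def])
  also have "\<dots> = coin_weight A * measure circle_measure (B \<inter> sphere 0 1)"
    using measure_bit0_square[of 0, OF _ B] measure_bit0_square[of 1, OF _ B]
    by (simp add: coin_weight_def E_def indicator_def field_simps)
  finally show ?thesis .
qed

text \<open>Induction splits off the leading digit; the others are the digits of the squared point,
  with the sets \<open>A\<close> shifted by one index.\<close>

lemma measure_bits:
  assumes "\<And>j. A j \<in> sets borel"
  shows "measure circle_measure ({z. \<forall>j<m. digit j z \<in> A j} \<inter> sphere 0 1) = (\<Prod>j<m. coin_weight (A j))"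
  using assms
proof (induction m arbitrary: A)
  case 0
  then show ?case using circle.prob_space by simp
next
  case (Suc m)
  note [measurable] = Suc.prems
  have "{z. \<forall>j<Suc m. digit j z \<in> A j} = {z. bit0 z \<in> A 0 \<and> z\<^sup>2 \<in> {z. \<forall>j<m. digit j z \<in> A (Suc j)}}"
    by (auto simp: less_Suc_eq_0_disj digit_0 digit_Suc)
  moreover have "{z. \<forall>j<m. digit j z \<in> A (Suc j)} \<in> sets borel" by measurable
  ultimately have "measure circle_measure ({z. \<forall>j<Suc m. digit j z \<in> A j} \<inter> sphere 0 1)
      = coin_weight (A 0) * measure circle_measure ({z. \<forall>j<m. digit j z \<in> A (Suc j)} \<inter> sphere 0 1)"
    by (simp only: measure_bit0_square_set[OF Suc.prems[of 0]])
  also have "\<dots> = coin_weight (A 0) * (\<Prod>j<m. coin_weight (A (Suc j)))"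
    using Suc.prems by (subst Suc.IH) auto
  also have "\<dots> = (\<Prod>j<Suc m. coin_weight (A j))"
    by (simp add: prod.lessThan_Suc_shift del: prod.lessThan_Suc)
  finally show ?case .
qed

text \<open>An arbitrary finite index set is padded to an initial segment with the trivial condition
  \<open>UNIV\<close>, of weight 1.\<close>

lemma prob_bits:
  assumes J: "finite J" and A: "\<And>j. j \<in> J \<Longrightarrow> A j \<in> sets borel"
  shows "measure circle_measure ({z. \<forall>j\<in>J. digit j z \<in> A j} \<inter> sphere 0 1) = (\<Prod>j\<in>J. coin_weight (A j))"
proof -
  define A' where "A' j = (if j \<in> J then A j else UNIV)" for j
  obtain m where m: "J \<subseteq> {..<m}" using J finite_nat_bounded by blast
  have "{z. \<forall>j\<in>J. digit j z \<in> A j} = {z. \<forall>j<m. digit j z \<in> A' j}"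
    using m by (auto simp: A'_def)
  also have "measure circle_measure (\<dots> \<inter> sphere 0 1) = (\<Prod>j<m. coin_weight (A' j))"
    by (rule measure_bits) (auto simp: A'_def A)
  also have "\<dots> = (\<Prod>j\<in>J. coin_weight (A' j))"
    using m by (intro prod.mono_neutral_right) (auto simp: A'_def coin_weight_def)
  also have "\<dots> = (\<Prod>j\<in>J. coin_weight (A j))" by (simp add: A'_def)
  finally show ?thesis .
qed

lemma prob_bit:
  "A \<in> sets borel \<Longrightarrow> measure circle_measure ({z. digit j z \<in> A} \<inter> sphere 0 1) = coin_weight A"
  using prob_bits[of "{j}" "\<lambda>_. A"] by simp

text \<open>Reindexing serves two purposes: the identity gives independence of all digits, and
  \<open>digit_index n k\<close> that of the digits read by a single factor.\<close>

lemma indep_bits_comp: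
  assumes inj: "inj \<iota>"
  shows "circle.indep_vars (\<lambda>_. borel) (\<lambda>j. digit (\<iota> j)) UNIV"
proof -
  have "circle.indep_sets (\<lambda>j. {digit (\<iota> j) -` A \<inter> space circle_measure | A. A \<in> sets borel}) UNIV"
  proof (rule circle.indep_setsI)
    fix i
    show "{digit (\<iota> i) -` A \<inter> space circle_measure | A. A \<in> sets borel} \<subseteq> circle.events"
      using measurable_sets[OF measurable_circle_measure[OF digit_measurable]] by blast
  next
    fix C J assume J: "J \<noteq> {}" "J \<subseteq> UNIV" "finite J"
      and "\<forall>j\<in>J. C j \<in> {digit (\<iota> j) -` A \<inter> space circle_measure | A. A \<in> sets borel}"
    then have "\<forall>j\<in>J. \<exists>A. A \<in> sets borel \<and> C j = {z. digit (\<iota> j) z \<in> A} \<inter> sphere 0 1" by fastforce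
    then obtain A where A: "\<And>j. j \<in> J \<Longrightarrow> A j \<in> sets borel"
      and C: "\<And>j. j \<in> J \<Longrightarrow> C j = {z. digit (\<iota> j) z \<in> A j} \<inter> sphere 0 1" by metis
    \<comment> \<open>The conditions are moved from the indices to the actual digit numbers, where
      \<open>prob_bits\<close> applies; injectivity makes this unambiguous.\<close>
    define A' where "A' i = A (the_inv \<iota> i)" for i
    have A': "A' (\<iota> j) = A j" for j by (simp add: A'_def the_inv_f_f[OF inj])
    have "(\<Inter>j\<in>J. C j) = {z. \<forall>i\<in>\<iota> ` J. digit i z \<in> A' i} \<inter> sphere 0 1"
      using J(1) C by (auto simp: A')
    also have "measure circle_measure \<dots> = (\<Prod>i\<in>\<iota> ` J. coin_weight (A' i))"
      using J A by (intro prob_bits) (auto simp: A')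
    also have "\<dots> = (\<Prod>j\<in>J. coin_weight (A j))"
      using inj by (subst prod.reindex) (auto simp: A' inj_on_def)
    also have "\<dots> = (\<Prod>j\<in>J. circle.prob (C j))"
      using A by (intro prod.cong) (auto simp: C prob_bit)
    finally show "circle.prob (\<Inter>j\<in>J. C j) = (\<Prod>j\<in>J. circle.prob (C j))" .
  qed
  then show ?thesis
    unfolding circle.indep_vars_def2 using measurable_circle_measure[OF digit_measurable] by auto
qed

lemma distr_bit: "distr circle_measure borel (digit i) = distr circle_measure borel (digit j)"
proof (rule measure_eqI)
  fix A assume "A \<in> sets (distr circle_measure borel (digit i))"
  then have A: "A \<in> sets borel" by simp
  have "digit i -` A \<inter> space circle_measure = {z. digit i z \<in> A} \<inter> sphere 0 1" for i by auto
  then show "emeasure (distr circle_measure borel (digit i)) A = emeasure (distr circle_measure borel (digit j)) A"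
    using A measurable_circle_measure[OF digit_measurable]
    by (simp add: emeasure_distr circle.emeasure_eq_measure prob_bit)
qed simp

text \<open>The remainder after \<open>m\<close> digits is exactly the fractional part of 2^m t
  divided by 2^m. It is below 2^(-m), and one more doubling splits off the next digit.\<close>

lemma binary_expansion:
  assumes "0 \<le> t" "t < 1"
  shows "(\<lambda>i. digit i (angle t) / 2 ^ Suc i) sums t"
proof -
  have "(\<Sum>i<m. digit i (angle t) / 2 ^ Suc i) = t - frac (2 ^ m * t) / 2 ^ m" for m
  proof (induction m)
    case 0
    then show ?case using assms by (simp add: frac_eq)
  next
    case (Suc m)
    define s where "s = frac (2 ^ m * t)"
    have s: "0 \<le> s" "s < 1" by (auto simp: s_def frac_ge_0 frac_lt_1)
    have t: "2 ^ m * t = s + of_int \<lfloor>2 ^ m * t\<rfloor>" by (simp add: s_def frac_def)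
    have "digit m (angle t) = bit0 (angle s)"
      using angle_add_int[of s "\<lfloor>2 ^ m * t\<rfloor>"] t by (simp add: digit_def angle_power)
    also have "\<dots> = 2 * s - frac (2 * s)"
    proof (cases "s < 1 / 2")
      case True
      then have "frac (2 * s) = 2 * s" using s by (simp add: frac_eq)
      then show ?thesis using True s by (simp add: bit0_angle)
    next
      case False
      then have "\<lfloor>2 * s\<rfloor> = 1" using s by (simp add: floor_eq_iff)
      then show ?thesis using False s by (simp add: bit0_angle frac_def)
    qed
    also have "frac (2 * s) = frac (2 ^ Suc m * t)"
    proof -
      have "2 ^ Suc m * t = 2 * s + of_int (2 * \<lfloor>2 ^ m * t\<rfloor>)" using t by simp
      then show ?thesis by (simp only: frac_add_of_int_right)
    qed
    finally show ?case
      using Suc.IH by (simp add: s_def field_simps)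
  qed
  moreover have "(\<lambda>m. t - frac (2 ^ m * t) / 2 ^ m) \<longlonglongrightarrow> t - 0"
  proof (intro tendsto_diff tendsto_const)
    have "(\<lambda>m. (1 / 2 :: real) ^ m) \<longlonglongrightarrow> 0" by (rule LIMSEQ_power_zero) simp
    then show "(\<lambda>m. frac (2 ^ m * t) / 2 ^ m) \<longlonglongrightarrow> 0"
      by (rule Lim_null_comparison[rotated])
         (auto intro!: always_eventually less_imp_le frac_lt_1 simp: power_one_over divide_simps frac_ge_0 abs_of_nonneg)
  qed
  ultimately show ?thesis by (simp add: sums_def)
qed

text \<open>The binary digits of the angle of \<open>z\<close> are distributed cyclically among \<open>n + 1\<close> factors: the
  digit of index \<open>(n + 1) * j + (n - k)\<close>, whose weight is \<open>2 ^ k / 2 ^ ((n + 1) * (j + 1))\<close>, goes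
  to position \<open>j\<close> of factor \<open>k\<close>.\<close>

definition sparse_sum :: "nat \<Rightarrow> (nat \<Rightarrow> real) \<Rightarrow> real" where
  "sparse_sum n w = (\<Sum>j. w j / 2 ^ (Suc n * Suc j))"

definition digit_index :: "nat \<Rightarrow> nat \<Rightarrow> nat \<Rightarrow> nat" where
  "digit_index n k j = j * Suc n + (n - k)"

definition factor :: "nat \<Rightarrow> nat \<Rightarrow> complex \<Rightarrow> complex" where
  "factor n k z = angle (sparse_sum n (\<lambda>j. digit (digit_index n k j) z))"

lemma sparse_sum_measurable [measurable]:
  assumes "\<And>j. (\<lambda>x. w x j) \<in> borel_measurable M"
  shows "(\<lambda>x. sparse_sum n (w x)) \<in> borel_measurable M"
  unfolding sparse_sum_def using assms by measurable

lemma factor_measurable [measurable]: "factor n k \<in> borel_measurable borel"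
  unfolding factor_def by measurable

lemma cmod_factor [simp]: "cmod (factor n k z) = 1"
  by (simp add: factor_def)

lemma digit_index_div_mod:
  "k \<le> n \<Longrightarrow> digit_index n k j div Suc n = j" "k \<le> n \<Longrightarrow> digit_index n k j mod Suc n = n - k"
  using div_mult_self3[of "Suc n" j "n - k"] mod_mult_self3[of j "Suc n" "n - k"]
  by (simp_all add: digit_index_def del: mult_Suc_right)

lemma inj_digit_index: "inj (digit_index n k)"
  by (rule injI) (simp add: digit_index_def del: mult_Suc_right)

text \<open>The expansion of the angle is cut into blocks of n + 1 consecutive digits, each block
  giving one digit to every factor. Exchanging the series over blocks with the finite sum over
  factors expresses \<open>t\<close> as the sum of 2^k times the \<open>k\<close>-th angle, exactly
  and not only modulo 1.\<close>

lemma prod_factor: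
  assumes z: "cmod z = 1"
  shows "(\<Prod>k\<in>{0..n}. factor n k z ^ (2 ^ k)) = z"
proof -
  obtain t where t: "0 \<le> t" "t < 1" "z = angle t" using angle_range[OF z] .
  have summ: "summable (\<lambda>j. digit (digit_index n k j) z / 2 ^ (Suc n * Suc j))" for k
  proof (rule summable_comparison_test')
    show "summable (\<lambda>j. (1 / 2 :: real) ^ j)" by (simp add: summable_geometric)
    fix j :: nat
    have "digit (digit_index n k j) z \<in> {0, 1}" using bit0_cases by (auto simp: digit_def)
    then have "norm (digit (digit_index n k j) z / 2 ^ (Suc n * Suc j)) \<le> 1 / 2 ^ (Suc n * Suc j)"
      by (auto simp: divide_simps)
    also have "\<dots> \<le> 1 / 2 ^ j"
      by (intro divide_left_mono power_increasing) auto
    finally show "norm (digit (digit_index n k j) z / 2 ^ (Suc n * Suc j)) \<le> (1 / 2) ^ j"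
      by (simp add: power_one_over)
  qed
  have group: "(\<Sum>i\<in>{j * Suc n..<j * Suc n + Suc n}. digit i z / 2 ^ Suc i)
      = (\<Sum>k\<in>{0..n}. 2 ^ k * (digit (digit_index n k j) z / 2 ^ (Suc n * Suc j)))" for j
    \<comment> \<open>Inside a block the offset \<open>r\<close> belongs to factor
      \<open>n - r\<close>, since earlier digits weigh more and must receive the larger power of
      2.\<close>
    proof (rule sum.reindex_bij_witness[where i = "\<lambda>k. digit_index n k j" and j = "\<lambda>i. n - (i - j * Suc n)"])
    fix i assume i: "i \<in> {j * Suc n..<j * Suc n + Suc n}"
    define r where "r = i - j * Suc n"
    have r: "r \<le> n" "i = j * Suc n + r" using i by (auto simp: r_def)
    have eq: "digit_index n (n - r) j = i"
      using r by (simp add: digit_index_def del: mult_Suc_right)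
    then show "digit_index n (n - (i - j * Suc n)) j = i" by (simp only: r_def)
    show "n - (i - j * Suc n) \<in> {0..n}" by simp
    \<comment> \<open>Digit \<open>i\<close> has weight 2^(-(i + 1)), hence \<open>Suc i\<close>;
      the missing \<open>n - r\<close> is the exponent of the power applied to the factor.\<close>
    have "Suc n * Suc j = (n - r) + Suc i" using r by simp
    then have "(2 :: real) ^ (Suc n * Suc j) = 2 ^ (n - r) * 2 ^ Suc i" by (metis power_add)
    then show "2 ^ (n - (i - j * Suc n)) *
        (digit (digit_index n (n - (i - j * Suc n)) j) z / 2 ^ (Suc n * Suc j)) = digit i z / 2 ^ Suc i"
      unfolding r_def[symmetric] eq by (simp only:) simp
  next
    fix k assume k: "k \<in> {0..n}"
    then show "n - (digit_index n k j - j * Suc n) = k"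
      by (simp add: digit_index_def del: mult_Suc_right)
    have "n - k < Suc n" by simp
    then show "digit_index n k j \<in> {j * Suc n..<j * Suc n + Suc n}"
      unfolding digit_index_def atLeastLessThan_iff by (intro conjI le_add1 add_strict_left_mono)
  qed
  have "(\<lambda>j. \<Sum>i\<in>{j * Suc n..<j * Suc n + Suc n}. digit i z / 2 ^ Suc i) sums t"
    using sums_group[OF binary_expansion[OF t(1,2)], of "Suc n"] t(3) by simp
  then have "(\<lambda>j. \<Sum>k\<in>{0..n}. 2 ^ k * (digit (digit_index n k j) z / 2 ^ (Suc n * Suc j))) sums t"
    by (simp only: group)
  moreover have "(\<lambda>j. \<Sum>k\<in>{0..n}. 2 ^ k * (digit (digit_index n k j) z / 2 ^ (Suc n * Suc j)))
      sums (\<Sum>k\<in>{0..n}. 2 ^ k * sparse_sum n (\<lambda>j. digit (digit_index n k j) z))"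
    unfolding sparse_sum_def by (intro sums_sum sums_mult summable_sums summ)
  ultimately have "t = (\<Sum>k\<in>{0..n}. 2 ^ k * sparse_sum n (\<lambda>j. digit (digit_index n k j) z))"
    by (rule sums_unique2)
  moreover have "(\<Prod>k\<in>S. angle (f k)) = angle (\<Sum>k\<in>S. f k)" if "finite S" for f and S :: "nat set"
    using that by induction (auto simp: cis_mult distrib_left)
  ultimately show ?thesis
    by (simp add: factor_def angle_power t(3))
qed

text \<open>The factors read disjoint sets of digits, told apart by the residue modulo n + 1.
  Independence passes to disjoint groups of the digits and then to measurable functions of the
  groups.\<close>

lemma indep_factors: "circle.indep_vars (\<lambda>_. borel) (factor n) {0..n}"
proof -
  have "circle.indep_vars (\<lambda>_. borel) digit UNIV"
    using indep_bits_comp[of id] by simp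
  then have "circle.indep_vars (\<lambda>k. PiM (range (digit_index n k)) (\<lambda>_. borel))
      (\<lambda>k z. restrict (\<lambda>i. digit i z) (range (digit_index n k))) {0..n}"
  proof (rule circle.indep_vars_restrict)
    show "disjoint_family_on (\<lambda>k. range (digit_index n k)) {0..n}"
    proof (unfold disjoint_family_on_def, intro ballI impI)
      fix k l assume kl: "k \<in> {0..n}" "l \<in> {0..n}" "k \<noteq> l"
      have "digit_index n k i \<noteq> digit_index n l j" for i j
      proof
        assume "digit_index n k i = digit_index n l j"
        then have "n - k = n - l"
          using digit_index_div_mod(2)[of k n i] digit_index_div_mod(2)[of l n j] kl by simp
        then show False using kl by simp
      qed
      then show "range (digit_index n k) \<inter> range (digit_index n l) = {}" by blast
    qed
  qed simp
  then have "circle.indep_vars (\<lambda>_. borel)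
      (\<lambda>k z. angle (sparse_sum n (\<lambda>j. restrict (\<lambda>i. digit i z) (range (digit_index n k)) (digit_index n k j)))) {0..n}"
  proof (rule circle.indep_vars_compose2)
    fix k
    have "(\<lambda>w. w (digit_index n k j)) \<in> borel_measurable (PiM (range (digit_index n k)) (\<lambda>_. borel))" for j
      by (rule measurable_component_singleton) simp
    then show "(\<lambda>w. angle (sparse_sum n (\<lambda>j. w (digit_index n k j))))
        \<in> borel_measurable (PiM (range (digit_index n k)) (\<lambda>_. borel :: real measure))"
      by measurable
  qed
  then show ?thesis by (simp add: factor_def[abs_def])
qed

text \<open>Each factor applies the same functional \<open>S\<close> to a sequence of independent,
  identically distributed bits, whose joint law is the same product measure. This is what permits
  one space and one operator in all tensor positions.\<close>

lemma distr_factor: "distr circle_measure borel (factor n k) = distr circle_measure borel (factor n l)"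
proof -
  define S where "S w = angle (sparse_sum n w)" for w
  have S [measurable]: "S \<in> borel_measurable (PiM UNIV (\<lambda>_. borel))"
    unfolding S_def by measurable
  have "distr circle_measure borel (factor n k)
      = distr (PiM UNIV (\<lambda>_. distr circle_measure borel (digit 0))) borel S" for k
  proof -
    let ?Y = "\<lambda>z. \<lambda>j\<in>UNIV. digit (digit_index n k j) z"
    have Y: "?Y \<in> circle_measure \<rightarrow>\<^sub>M PiM UNIV (\<lambda>_. borel)"
      by (intro measurable_restrict measurable_circle_measure digit_measurable)
    have "distr circle_measure (PiM UNIV (\<lambda>_. borel)) ?Y
        = PiM UNIV (\<lambda>j. distr circle_measure borel (digit (digit_index n k j)))"
      using indep_bits_comp[OF inj_digit_index, of n k]
      by (subst (asm) circle.indep_vars_iff_distr_eq_PiM)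
         (auto intro: measurable_circle_measure)
    also have "\<dots> = PiM UNIV (\<lambda>_. distr circle_measure borel (digit 0))"
      by (intro PiM_cong refl distr_bit)
    finally have "distr (PiM UNIV (\<lambda>_. distr circle_measure borel (digit 0))) borel S
        = distr (distr circle_measure (PiM UNIV (\<lambda>_. borel)) ?Y) borel S" by simp
    also have "\<dots> = distr circle_measure borel (S \<circ> ?Y)"
      using S Y by (rule distr_distr)
    also have "S \<circ> ?Y = factor n k" by (rule ext) (simp add: S_def factor_def restrict_def)
    finally show ?thesis ..
  qed
  then show ?thesis by simp
qed

section \<open>The tensor product of the powers\<close>

text \<open>By \<open>distr_factor\<close> this is the common law of all the factors, the measure
  \<mu> of the overview.\<close>

definition factor_law :: "nat \<Rightarrow> complex measure" where
  "factor_law n = distr circle_measure borel (factor n 0)"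

lemma factor_random_variable [measurable]: "factor n k \<in> borel_measurable circle_measure"
  by (rule measurable_circle_measure) measurable

lemma sets_factor_law [simp, measurable_cong]: "sets (factor_law n) = sets borel"
  by (simp add: factor_law_def)

lemma factor_law_eq: "distr circle_measure borel (factor n k) = factor_law n"
  unfolding factor_law_def by (rule distr_factor)

lemma prob_space_factor_law: "prob_space (factor_law n)"
  unfolding factor_law_def by (rule circle.prob_space_distr) measurable

lemma finite_measure_factor_law: "finite_measure (factor_law n)"
  using prob_space_factor_law prob_space.axioms(1) by blast

lemma unimodular_factor_law: "unimodular (factor_law n) (\<lambda>z. z)"
proof
  show "(\<lambda>z. z) \<in> borel_measurable (factor_law n)" by measurable
  show "AE z in factor_law n. cmod z = 1"
    unfolding factor_law_def by (subst AE_distr_iff) auto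
qed

lemma unimodular_circle: "unimodular circle_measure (\<lambda>z. z)"
  by unfold_locales (auto intro: measurable_circle_measure AE_I2)

section \<open>Simple tensors as products of functions of the factors\<close>

definition repr :: "('b \<Rightarrow> complex) set \<Rightarrow> 'b \<Rightarrow> complex" where
  "repr X = (SOME f. f \<in> X)"

lemma repr:
  assumes "X \<in> carrier (L2 M)"
  shows "repr X \<in> square_integrable M" "L2_class M (repr X) = X"
proof -
  obtain f where f: "f \<in> square_integrable M" "X = L2_class M f" using assms by (rule L2_carrierE)
  have "repr X \<in> L2_class M f"
    unfolding f(2) repr_def using L2_class_self[OF f(1)]
    by (rule someI[where P = "\<lambda>g. g \<in> L2_class M f"])
  then have *: "repr X \<in> square_integrable M" "AE x in M. f x = repr X x" by (simp_all add: mem_L2_class)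
  then show "repr X \<in> square_integrable M" by simp
  show "L2_class M (repr X) = X"
    using L2_class_eq_iff[OF f(1) *(1)] *(2) f(2) by simp
qed

definition factor_prod :: "nat \<Rightarrow> (nat \<Rightarrow> complex \<Rightarrow> complex) \<Rightarrow> complex \<Rightarrow> complex" where
  "factor_prod n f z = (\<Prod>k\<in>{0..n}. f k (factor n k z))"

text \<open>This is the map \<open>\<tau>\<close> of the abstract part. Composition with the factors
  acts on functions rather than classes, so representatives are chosen;
  \<open>factor_class_eq\<close> frees the result from the choice.\<close>

definition factor_class ::
  "nat \<Rightarrow> (nat \<Rightarrow> (complex \<Rightarrow> complex) set) \<Rightarrow> (complex \<Rightarrow> complex) set" where
  "factor_class n x = L2_class circle_measure (factor_prod n (\<lambda>k. repr (x k)))"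

lemma square_integrable_factor_law_measurable:
  "f \<in> square_integrable (factor_law n) \<Longrightarrow> f \<in> borel_measurable borel"
  using square_integrableD(1)[of f "factor_law n"] measurable_cong_sets[OF sets_factor_law refl] by blast

lemma integral_factor:
  fixes g :: "complex \<Rightarrow> 'c::{banach, second_countable_topology}"
  assumes "g \<in> borel_measurable borel"
  shows "(\<integral>z. g (factor n k z) \<partial>circle_measure) = (\<integral>x. g x \<partial>factor_law n)"
    and "integrable circle_measure (\<lambda>z. g (factor n k z)) \<longleftrightarrow> integrable (factor_law n) g"
  unfolding factor_law_eq[of n k, symmetric] using assms
  by (simp_all add: integral_distr integrable_distr_eq)

text \<open>Products of square-integrable functions need not be square integrable. Here the squared
  moduli are independent integrable variables, so their product is integrable.\<close>

lemma factor_prod_square_integrable: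
  assumes f: "\<And>k. k \<in> {0..n} \<Longrightarrow> f k \<in> square_integrable (factor_law n)"
  shows "factor_prod n f \<in> square_integrable circle_measure"
proof -
  have fm: "f k \<in> borel_measurable borel" if "k \<in> {0..n}" for k
    using square_integrable_factor_law_measurable[OF f[OF that]] .
  have m: "factor_prod n f \<in> borel_measurable circle_measure"
    unfolding factor_prod_def
    by (intro borel_measurable_prod measurable_compose[OF factor_random_variable] fm)
  have "integrable circle_measure (\<lambda>z. \<Prod>k\<in>{0..n}. (cmod (f k (factor n k z)))\<^sup>2)"
  proof (rule circle.indep_vars_integrable)
    show "circle.indep_vars (\<lambda>_. borel) (\<lambda>k z. (cmod (f k (factor n k z)))\<^sup>2) {0..n}"
      by (rule circle.indep_vars_compose2[OF indep_factors]) (use fm in measurable)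
    show "integrable circle_measure (\<lambda>z. (cmod (f k (factor n k z)))\<^sup>2)" if "k \<in> {0..n}" for k
      using fm[OF that] square_integrableD(2)[OF f[OF that]]
      by (subst integral_factor(2)[of "\<lambda>x. (cmod (f k x))\<^sup>2"]) measurable
  qed simp
  then have "integrable circle_measure (\<lambda>z. (cmod (factor_prod n f z))\<^sup>2)"
    by (simp add: factor_prod_def prod_norm[symmetric] prod_power_distrib)
  then show ?thesis using m by (simp add: square_integrable_def)
qed

text \<open>The expectation of a product of independent variables factorises; this is the isometry
  property of \<open>factor_class\<close>.\<close>

lemma factor_prod_integral:
  assumes f: "\<And>k. k \<in> {0..n} \<Longrightarrow> f k \<in> square_integrable (factor_law n)"
    and g: "\<And>k. k \<in> {0..n} \<Longrightarrow> g k \<in> square_integrable (factor_law n)"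
  shows "(\<integral>z. factor_prod n f z * cnj (factor_prod n g z) \<partial>circle_measure)
    = (\<Prod>k\<in>{0..n}. \<integral>x. f k x * cnj (g k x) \<partial>factor_law n)"
proof -
  have m: "(\<lambda>x. f k x * cnj (g k x)) \<in> borel_measurable borel" if "k \<in> {0..n}" for k
    using square_integrable_factor_law_measurable[OF f[OF that]]
      square_integrable_factor_law_measurable[OF g[OF that]] by measurable
  have "(\<integral>z. factor_prod n f z * cnj (factor_prod n g z) \<partial>circle_measure)
      = (\<integral>z. (\<Prod>k\<in>{0..n}. f k (factor n k z) * cnj (g k (factor n k z))) \<partial>circle_measure)"
    by (simp add: factor_prod_def prod.distrib)
  also have "\<dots> = (\<Prod>k\<in>{0..n}. \<integral>z. f k (factor n k z) * cnj (g k (factor n k z)) \<partial>circle_measure)"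
  proof (rule circle.indep_vars_lebesgue_integral)
    show "circle.indep_vars (\<lambda>_. borel) (\<lambda>k z. f k (factor n k z) * cnj (g k (factor n k z))) {0..n}"
      by (rule circle.indep_vars_compose2[OF indep_factors m])
    show "integrable circle_measure (\<lambda>z. f k (factor n k z) * cnj (g k (factor n k z)))"
      if "k \<in> {0..n}" for k
      using integral_factor(2)[OF m[OF that]] integrable_mult_cnj[OF f[OF that] g[OF that]] by simp
  qed simp
  also have "\<dots> = (\<Prod>k\<in>{0..n}. \<integral>x. f k x * cnj (g k x) \<partial>factor_law n)"
    by (intro prod.cong refl integral_factor(1) m)
  finally show ?thesis .
qed

text \<open>A null set of \<open>factor_law n\<close> pulls back along each factor to a null set of
  the circle, and a finite union of these carries all the disagreement.\<close>

lemma factor_class_eq: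
  assumes f: "\<And>k. k \<in> {0..n} \<Longrightarrow> f k \<in> square_integrable (factor_law n)"
    and x: "\<And>k. k \<in> {0..n} \<Longrightarrow> x k = L2_class (factor_law n) (f k)"
  shows "factor_class n x = L2_class circle_measure (factor_prod n f)"
proof -
  have r: "repr (x k) \<in> square_integrable (factor_law n)" "L2_class (factor_law n) (repr (x k)) = x k"
    if "k \<in> {0..n}" for k
    using repr[of "x k"] f x that by auto
  have "AE z in circle_measure. \<forall>k\<in>{0..n}. repr (x k) (factor n k z) = f k (factor n k z)"
  proof (rule AE_finite_allI)
    fix k assume k: "k \<in> {0..n}"
    have "AE u in factor_law n. repr (x k) u = f k u"
      using L2_class_eq_iff[OF r(1)[OF k] f[OF k]] r(2)[OF k] x[OF k] by simp
    then show "AE z in circle_measure. repr (x k) (factor n k z) = f k (factor n k z)"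
      unfolding factor_law_eq[of n k, symmetric] by (rule AE_distrD[OF factor_random_variable])
  qed simp
  then have "AE z in circle_measure. factor_prod n (\<lambda>k. repr (x k)) z = factor_prod n f z"
    by eventually_elim (auto simp: factor_prod_def intro!: prod.cong)
  then show ?thesis
    unfolding factor_class_def using r(1) f
    by (subst L2_class_eq_iff) (auto intro!: factor_prod_square_integrable)
qed

lemma tensor_isometry_factor_class:
  "tensor_isometry {0..n} (\<lambda>k. L2 (factor_law n)) (L2 circle_measure) (factor_class n)"
proof (intro tensor_isometry.intro tensor_isometry_axioms.intro circle.hilbert_space_L2)
  fix x y assume x: "x \<in> tuples {0..n} (\<lambda>k. L2 (factor_law n))"
    and y: "y \<in> tuples {0..n} (\<lambda>k. L2 (factor_law n))"
  have rx: "repr (x k) \<in> square_integrable (factor_law n)" "L2_class (factor_law n) (repr (x k)) = x k"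
    and ry: "repr (y k) \<in> square_integrable (factor_law n)" "L2_class (factor_law n) (repr (y k)) = y k"
    if "k \<in> {0..n}" for k
    using repr[of "x k"] repr[of "y k"] x y that by (auto simp: PiE_iff)
  have "factor_prod n (\<lambda>k. repr (x k)) \<in> square_integrable circle_measure"
    by (rule factor_prod_square_integrable) (rule rx(1))
  moreover have "factor_prod n (\<lambda>k. repr (y k)) \<in> square_integrable circle_measure"
    by (rule factor_prod_square_integrable) (rule ry(1))
  ultimately have "cinner (L2 circle_measure) (factor_class n x) (factor_class n y)
      = (\<Prod>k\<in>{0..n}. \<integral>u. repr (x k) u * cnj (repr (y k) u) \<partial>factor_law n)"
    using factor_prod_integral[of n "\<lambda>k. repr (x k)" "\<lambda>k. repr (y k)", OF rx(1) ry(1)]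
    by (simp add: factor_class_def L2_cinner)
  also have "\<dots> = (\<Prod>k\<in>{0..n}. cinner (L2 (factor_law n)) (x k) (y k))"
  proof (intro prod.cong refl)
    fix k assume k: "k \<in> {0..n}"
    show "(\<integral>u. repr (x k) u * cnj (repr (y k) u) \<partial>factor_law n) = cinner (L2 (factor_law n)) (x k) (y k)"
      using L2_cinner[OF rx(1)[OF k] ry(1)[OF k]] by (simp only: rx(2)[OF k] ry(2)[OF k])
  qed
  finally show "cinner (L2 circle_measure) (factor_class n x) (factor_class n y)
      = (\<Prod>k\<in>{0..n}. cinner (L2 (factor_law n)) (x k) (y k))" .
next
  fix x assume x: "x \<in> tuples {0..n} (\<lambda>k. L2 (factor_law n))"
  then show "factor_class n x \<in> carrier (L2 circle_measure)"
    unfolding factor_class_def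
    using repr(1)[of "x k" "factor_law n" for k]
    by (intro L2_class_in factor_prod_square_integrable) (auto simp: PiE_iff)
qed

text \<open>Cylinder sets of the factors generate the Borel sets of the circle because the factors
  determine \<open>z\<close>, by \<open>prod_factor\<close>.\<close>

definition cylinder :: "nat \<Rightarrow> (nat \<Rightarrow> complex set) \<Rightarrow> complex set" where
  "cylinder n B = {z \<in> sphere 0 1. \<forall>k\<in>{0..n}. factor n k z \<in> B k}"

definition cylinders :: "nat \<Rightarrow> complex set set" where
  "cylinders n = {cylinder n B | B. \<forall>k. B k \<in> sets borel}"

lemma cylinder_sets:
  assumes "\<And>k. B k \<in> sets borel"
  shows "cylinder n B \<in> sets circle_measure"
proof -
  note [measurable] = assms
  have "cylinder n B = {z \<in> space circle_measure. \<forall>k\<in>{0..n}. factor n k z \<in> B k}"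
    by (simp add: cylinder_def)
  also have "\<dots> \<in> sets circle_measure" by measurable
  finally show ?thesis .
qed

lemma sets_circle_eq_cylinders: "sets circle_measure = sigma_sets (sphere 0 1) (cylinders n)"
proof (intro equalityI subsetI)
  fix A assume "A \<in> sigma_sets (sphere 0 1) (cylinders n)"
  moreover have "cylinders n \<subseteq> sets circle_measure"
    using cylinder_sets by (auto simp: cylinders_def)
  ultimately show "A \<in> sets circle_measure"
    using sets.sigma_sets_subset[of "cylinders n" circle_measure] by auto
next
  fix A assume "A \<in> sets circle_measure"
  then obtain B where B: "B \<in> sets borel" "A = sphere 0 1 \<inter> B"
    by (auto simp: sets_circle_measure sets_restrict_space)
  define N where "N = sigma (sphere 0 1) (cylinders n)"
  have cyl: "cylinders n \<subseteq> Pow (sphere 0 1)" by (auto simp: cylinders_def cylinder_def)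
  have N: "space N = sphere 0 1" "sets N = sigma_sets (sphere 0 1) (cylinders n)"
    using cyl by (simp_all add: N_def)
  have "factor n k \<in> borel_measurable N" if k: "k \<in> {0..n}" for k
  proof (rule measurableI)
    fix C :: "complex set" assume C: "C \<in> sets borel"
    have "factor n k -` C \<inter> space N = cylinder n (\<lambda>i. if i = k then C else UNIV)"
      using k by (auto simp: cylinder_def N)
    also have "\<dots> \<in> sets N"
      unfolding N cylinders_def using C by (intro sigma_sets.Basic) auto
    finally show "factor n k -` C \<inter> space N \<in> sets N" .
  qed simp
  then have "(\<lambda>z. \<Prod>k\<in>{0..n}. factor n k z ^ (2 ^ k)) \<in> borel_measurable N"
    by (intro borel_measurable_prod borel_measurable_power)
  moreover have "(\<lambda>z. \<Prod>k\<in>{0..n}. factor n k z ^ (2 ^ k)) \<in> borel_measurable N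
      \<longleftrightarrow> (\<lambda>z. z) \<in> borel_measurable N"
    by (rule measurable_cong) (simp add: N prod_factor)
  ultimately have "(\<lambda>z. z) -` B \<inter> space N \<in> sets N"
    using B(1) by (intro measurable_sets) auto
  then show "A \<in> sigma_sets (sphere 0 1) (cylinders n)"
    using B(2) by (simp add: N Int_commute)
qed

lemma Int_stable_cylinders: "Int_stable (cylinders n)"
proof (rule Int_stableI)
  fix a b assume "a \<in> cylinders n" "b \<in> cylinders n"
  then obtain B C where B: "\<And>k. B k \<in> sets borel" "a = cylinder n B"
    and C: "\<And>k. C k \<in> sets borel" "b = cylinder n C" by (auto simp: cylinders_def)
  have "a \<inter> b = cylinder n (\<lambda>k. B k \<inter> C k)" using B C by (auto simp: cylinder_def)
  moreover have "\<forall>k. B k \<inter> C k \<in> sets borel" using B C by auto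
  ultimately show "a \<inter> b \<in> cylinders n"
    unfolding cylinders_def mem_Collect_eq by blast
qed

text \<open>The indicator of a cylinder is a product of indicators of the factors, hence the image
  of a simple tensor. Since cylinders form a generator stable under intersection, the density
  criterion applies to the span.\<close>

lemma tensor_realization_factor_class:
  "tensor_realization {0..n} (\<lambda>k. L2 (factor_law n)) (L2 circle_measure) (factor_class n)"
proof -
  interpret T: tensor_isometry "{0..n}" "\<lambda>k. L2 (factor_law n)" "L2 circle_measure" "factor_class n"
    by (rule tensor_isometry_factor_class)
  interpret law: finite_measure "factor_law n" by (rule finite_measure_factor_law)
  define D where "D = {f \<in> square_integrable circle_measure. L2_class circle_measure f \<in> T.span_tau}"
  have dense: "\<exists>g\<in>D. L2_dist_sq circle_measure f g < e"
    if "f \<in> square_integrable circle_measure" "e > 0" for f e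
  proof (rule circle.L2_dense_criterion[where G = "cylinders n"])
    show "sets circle_measure = sigma_sets (space circle_measure) (cylinders n)"
      by (simp add: sets_circle_eq_cylinders)
    show "cylinders n \<subseteq> Pow (space circle_measure)" by (auto simp: cylinders_def cylinder_def)
    have "sphere 0 1 = cylinder n (\<lambda>_. UNIV)" by (auto simp: cylinder_def)
    then show "space circle_measure \<in> cylinders n"
      unfolding cylinders_def by (auto intro!: exI[of _ "\<lambda>_. UNIV"])
    show "(\<lambda>z. indicator A z) \<in> D" if A: "A \<in> cylinders n" for A
    proof -
      obtain B where B: "\<And>k. B k \<in> sets borel" "A = cylinder n B" using A by (auto simp: cylinders_def)
      have ind: "(\<lambda>x. indicator (B k) x) \<in> square_integrable (factor_law n)" for k
        using B(1) by (intro law.square_integrable_indicator) simp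
      define x where "x = (\<lambda>k\<in>{0..n}. L2_class (factor_law n) (\<lambda>u. indicator (B k) u))"
      have "x \<in> tuples {0..n} (\<lambda>k. L2 (factor_law n))"
        using ind by (auto simp: x_def)
      then have "factor_class n x \<in> T.span_tau" by (rule T.tau_span)
      moreover have "factor_class n x = L2_class circle_measure (factor_prod n (\<lambda>k u. indicator (B k) u))"
        by (rule factor_class_eq) (simp_all add: ind x_def)
      moreover have "\<dots> = L2_class circle_measure (\<lambda>z. indicator A z)"
      proof (subst L2_class_eq_iff)
        show "AE z in circle_measure. factor_prod n (\<lambda>k u. indicator (B k) u) z = (indicator A z :: complex)"
        proof (rule AE_I2)
          fix z assume "z \<in> space circle_measure"
          then show "factor_prod n (\<lambda>k u. indicator (B k) u) z = (indicator A z :: complex)"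
            unfolding factor_prod_def B(2) cylinder_def
            by (cases "\<forall>k\<in>{0..n}. factor n k z \<in> B k") (auto simp: indicator_def)
        qed
      qed (use B ind cylinder_sets in \<open>auto intro!: factor_prod_square_integrable circle.square_integrable_indicator\<close>)
      ultimately show ?thesis
        unfolding D_def using B cylinder_sets by (auto intro!: circle.square_integrable_indicator)
    qed
    show "(\<lambda>z. f z + g z) \<in> D" if "f \<in> D" "g \<in> D" for f g
      using that T.span_add[of "L2_class circle_measure f" "L2_class circle_measure g"]
      by (auto simp: D_def L2_add square_integrable_add)
    \<comment> \<open>The span is closed under complex scalars, so the multiple itself serves as
      approximant, at distance 0.\<close>
    show "\<exists>g\<in>D. L2_dist_sq circle_measure (\<lambda>z. c * f z) g < e" if "f \<in> D" "e > 0" for c f e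
    proof
      show "(\<lambda>z. c * f z) \<in> D"
        using that T.span_smult[of "L2_class circle_measure f" c]
        by (auto simp: D_def L2_smult square_integrable_cmult)
    qed (use that in simp)
  qed (use that Int_stable_cylinders in \<open>auto simp: D_def\<close>)
  show ?thesis
  proof unfold_locales
    fix X and e :: real assume X: "X \<in> carrier (L2 circle_measure)" and e: "e > 0"
    obtain f where f: "f \<in> square_integrable circle_measure" "X = L2_class circle_measure f"
      using X by (rule L2_carrierE)
    obtain g where g: "g \<in> D" "L2_dist_sq circle_measure f g < e\<^sup>2"
      using dense[OF f(1), of "e\<^sup>2"] e by auto
    then have g': "g \<in> square_integrable circle_measure" "L2_class circle_measure g \<in> T.span_tau"
      by (auto simp: D_def)
    have "cdist (L2 circle_measure) (L2_class circle_measure g) X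
        = cdist (L2 circle_measure) X (L2_class circle_measure g)"
      using X g' by (intro T.K.cdist_commute) auto
    also have "\<dots> = sqrt (L2_dist_sq circle_measure f g)"
      using f g' by (simp add: L2_cdist L2_dist_sq_def)
    also have "\<dots> < e" using real_sqrt_less_mono[OF g(2)] e by simp
    finally show "\<exists>v\<in>T.span_tau. cdist (L2 circle_measure) v X < e" using g'(2) by blast
  qed
qed

text \<open>The 2^k-th power of the operator contributes the 2^k-th power of factor
  \<open>k\<close>; by \<open>prod_factor\<close> these powers multiply to \<open>z\<close> at every
  point of the circle.\<close>

lemma factor_class_mult:
  assumes x: "x \<in> tuples {0..n} (\<lambda>k. L2 (factor_law n))"
  shows "factor_class n (\<lambda>k\<in>{0..n}. (mult_op (factor_law n) (\<lambda>z. z) ^^ (2 ^ k)) (x k))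
    = mult_by_z (factor_class n x)"
proof -
  interpret law: unimodular "factor_law n" "\<lambda>z. z" by (rule unimodular_factor_law)
  interpret circ: unimodular circle_measure "\<lambda>z. z" by (rule unimodular_circle)
  have r: "repr (x k) \<in> square_integrable (factor_law n)" "x k = L2_class (factor_law n) (repr (x k))"
    if "k \<in> {0..n}" for k
    using repr[of "x k"] x that by (auto simp: PiE_iff)
  have sq: "factor_prod n (\<lambda>k. repr (x k)) \<in> square_integrable circle_measure"
    using r by (intro factor_prod_square_integrable)
  have "factor_class n (\<lambda>k\<in>{0..n}. (mult_op (factor_law n) (\<lambda>z. z) ^^ (2 ^ k)) (x k))
      = L2_class circle_measure (factor_prod n (\<lambda>k u. u ^ (2 ^ k) * repr (x k) u))"
  proof (rule factor_class_eq)
    fix k assume k: "k \<in> {0..n}"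
    show "(\<lambda>u. u ^ (2 ^ k) * repr (x k) u) \<in> square_integrable (factor_law n)"
      by (rule law.mult_op_funpow(1)[OF r(1)[OF k]])
    have "(mult_op (factor_law n) (\<lambda>z. z) ^^ (2 ^ k)) (L2_class (factor_law n) (repr (x k)))
        = L2_class (factor_law n) (\<lambda>u. u ^ (2 ^ k) * repr (x k) u)"
      by (rule law.mult_op_funpow(2)[OF r(1)[OF k]])
    then show "(\<lambda>k\<in>{0..n}. (mult_op (factor_law n) (\<lambda>z. z) ^^ (2 ^ k)) (x k)) k
        = L2_class (factor_law n) (\<lambda>u. u ^ (2 ^ k) * repr (x k) u)"
      using k r(2)[OF k] by simp
  qed
  also have "\<dots> = L2_class circle_measure (\<lambda>z. z * factor_prod n (\<lambda>k. repr (x k)) z)"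
  proof (subst L2_class_eq_iff)
    show "AE z in circle_measure. factor_prod n (\<lambda>k u. u ^ (2 ^ k) * repr (x k) u) z
        = z * factor_prod n (\<lambda>k. repr (x k)) z"
      by (intro AE_I2) (simp add: factor_prod_def prod.distrib prod_factor)
    show "factor_prod n (\<lambda>k u. u ^ (2 ^ k) * repr (x k) u) \<in> square_integrable circle_measure"
      using r(1) by (intro factor_prod_square_integrable law.mult_op_funpow(1))
    show "(\<lambda>z. z * factor_prod n (\<lambda>k. repr (x k)) z) \<in> square_integrable circle_measure"
      by (rule circ.mult_sq[OF sq])
  qed
  also have "\<dots> = mult_by_z (factor_class n x)"
    unfolding mult_by_z_eq factor_class_def by (rule circ.mult_op_class[OF sq, symmetric])
  finally show ?thesis .
qed

theorem theorem1:
  fixes n :: nat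
  assumes "n > 0"
  shows "\<exists>(H :: (complex \<Rightarrow> complex) set inner_module) U.
    hilbert_space H \<and> separable H \<and> unitary_operator H U \<and>
    unitarily_equivalent
      (hilbert_tensor {0..n} (\<lambda>k. H)) (tensor_operator {0..n} (\<lambda>k. H) (\<lambda>k. U ^^ (2 ^ k)))
      (L2 circle_measure) mult_by_z"
proof (intro exI conjI)
  interpret law: finite_measure "factor_law n" by (rule finite_measure_factor_law)
  interpret lawu: unimodular "factor_law n" "\<lambda>z. z" by (rule unimodular_factor_law)
  interpret circ: unimodular circle_measure "\<lambda>z. z" by (rule unimodular_circle)
  interpret T: tensor_realization "{0..n}" "\<lambda>k. L2 (factor_law n)" "L2 circle_measure" "factor_class n"
    by (rule tensor_realization_factor_class)
  show "hilbert_space (L2 (factor_law n))" by (rule law.hilbert_space_L2)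
  show "separable (L2 (factor_law n))"
    by (rule separable_L2[OF finite_measure_factor_law sets_factor_law])
  show "unitary_operator (L2 (factor_law n)) (mult_op (factor_law n) (\<lambda>z. z))"
    by (rule lawu.unitary_mult_op)
  show "unitarily_equivalent (hilbert_tensor {0..n} (\<lambda>k. L2 (factor_law n)))
      (tensor_operator {0..n} (\<lambda>k. L2 (factor_law n)) (\<lambda>k. mult_op (factor_law n) (\<lambda>z. z) ^^ (2 ^ k)))
      (L2 circle_measure) mult_by_z"
  proof (rule T.unitarily_equivalent_tensor_operator)
    show "unitary_operator (L2 circle_measure) mult_by_z"
      unfolding mult_by_z_eq by (rule circ.unitary_mult_op)
    show "(mult_op (factor_law n) (\<lambda>z. z) ^^ (2 ^ k)) X \<in> carrier (L2 (factor_law n))"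
      if "X \<in> carrier (L2 (factor_law n))" for k X
      using repr[OF that] lawu.mult_op_funpow[OF repr(1)[OF that], of "2 ^ k"] by auto
  qed (rule factor_class_mult)
qed

end
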